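(* Let $n\ge 2$ and let $C\subseteq\mathbb C^n$ be a complex cone. Then the following are equivalent: (i) every continuous function $f:\mathbb C^n\to\mathbb C$ satisfying $f\times\mu_r(z)=0$ for all $r>0$ and all $z\in C$ is identically zero; (ii) for all $p,q\in\mathbb Z_+$ and every nonzero $P\in H_{p,q}$, one has $C\nsubseteq P^{-1}(0)$.
   Context: $\mathbb Z_+$ denotes the non-negative integers. A set $C\subseteq\mathbb C^n$ is a complex cone if $\lambda C\subseteq C$ for all $\lambda\in\mathbb C$. For $r>0$, $\mu_r$ is the normalized surface measure on the sphere $\{w\in\mathbb C^n:|w|=r\}$, and the twisted spherical mean of $f$ is $$f\times\mu_r(z)=\int_{|w|=r}f(z-w)\,e^{\frac{i}{2}\mathrm{Im}(z\cdot\bar w)}\,d\mu_r(w),\qquad z\cdot\bar w=\sum_{j=1}^n z_j\bar w_j.$$ For $p,q\in\mathbb Z_+$, $P_{p,q}$ is the space of polynomials of the form $P(z)=\sum_{|\alpha|=p}\sum_{|\beta|=q}c_{\alpha\beta}z^\alpha\bar z^\beta$ ($c_{\alpha\beta}\in\mathbb C$, $\alpha,\beta\in\mathbb Z_+^n$ multi-indices), and $H_{p,q}=\{P\in P_{p,q}:\Delta P=0\}$, where $\Delta=4\sum_{k=1}^n\frac{\partial^2}{\partial z_k\partial\bar z_k}$. *)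

theory Defs
  imports "HOL-Analysis.Analysis"
begin

text \<open>
  Points of \<open>n\<close>-dimensional complex space are elements of \<^typ>\<open>complex ^ 'n\<close>, with \<open>n = CARD('n)\<close>.
\<close>

definition is_complex_cone :: "(complex ^ 'n) set \<Rightarrow> bool" where
  "is_complex_cone C \<longleftrightarrow> (\<forall>a::complex. (\<lambda>z. a *s z) ` C \<subseteq> C)"

text \<open>
  Surface measure on the sphere of radius \<open>r > 0\<close> centred at the origin, given by polar coordinates:
  a Borel set \<open>A\<close> of the sphere has surface area \<open>d / r\<close> times the Lebesgue volume of the
  truncated cone over \<open>A\<close>, where \<open>d\<close> is the real dimension. The lemma
  \<open>emeasure_sphere_surface_measure\<close> below states this formula.
\<close>

definition sphere_surface_measure :: "real \<Rightarrow> 'a::euclidean_space measure" where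
  "sphere_surface_measure r =
     scale_measure (ennreal (real DIM('a) / r))
       (distr (restrict_space lborel (cball 0 r - {0})) (restrict_space borel (sphere 0 r))
          (\<lambda>x. (r / norm x) *\<^sub>R x))"

definition normalized_sphere_measure :: "real \<Rightarrow> 'a::euclidean_space measure" where
  "normalized_sphere_measure r = uniform_measure (sphere_surface_measure r) (sphere 0 r)"

lemma space_sphere_surface_measure [simp]:
  "space (sphere_surface_measure r) = sphere 0 r"
  by (simp add: sphere_surface_measure_def space_scale_measure space_restrict_space)

lemma sets_sphere_surface_measure [measurable_cong]:
  "sets (sphere_surface_measure r) = sets (restrict_space borel (sphere 0 r))"
  by (simp add: sphere_surface_measure_def)

lemma space_normalized_sphere_measure [simp]:
  "space (normalized_sphere_measure r) = sphere 0 r"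
  by (simp add: normalized_sphere_measure_def)

lemma sets_normalized_sphere_measure [measurable_cong]:
  "sets (normalized_sphere_measure r) = sets (restrict_space borel (sphere 0 r))"
  by (simp add: normalized_sphere_measure_def sets_sphere_surface_measure)

lemma emeasure_sphere_surface_measure:
  fixes A :: "'a::euclidean_space set"
  assumes r: "r > 0" and A: "A \<in> sets borel" "A \<subseteq> sphere 0 r"
  shows "emeasure (sphere_surface_measure r) A =
           ennreal (real DIM('a) / r) * emeasure lborel {t *\<^sub>R a | t a. 0 < t \<and> t \<le> 1 \<and> a \<in> A}"
proof -
  let ?p = "\<lambda>x::'a. (r / norm x) *\<^sub>R x"
  have p: "?p \<in> measurable (restrict_space lborel (cball 0 r - {0})) (restrict_space borel (sphere 0 r))"
    using r by (intro measurable_restrict_space3) auto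
  have S: "A \<in> sets (restrict_space borel (sphere 0 r))"
    using A by (simp add: sets_restrict_space_iff)
  have "?p -` A \<inter> (cball 0 r - {0}) = {t *\<^sub>R a | t a. 0 < t \<and> t \<le> 1 \<and> a \<in> A}"
  proof (intro set_eqI iffI)
    fix x assume "x \<in> ?p -` A \<inter> (cball 0 r - {0})"
    then have "x \<noteq> 0" "norm x \<le> r" "?p x \<in> A" by auto
    moreover from this have "x = (norm x / r) *\<^sub>R ?p x" using r by simp
    moreover have "0 < norm x / r" "norm x / r \<le> 1" using \<open>x \<noteq> 0\<close> \<open>norm x \<le> r\<close> r by auto
    ultimately show "x \<in> {t *\<^sub>R a | t a. 0 < t \<and> t \<le> 1 \<and> a \<in> A}" by blast
  next
    fix x assume "x \<in> {t *\<^sub>R a | t a. 0 < t \<and> t \<le> 1 \<and> a \<in> A}"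
    then obtain t a where x: "x = t *\<^sub>R a" "0 < t" "t \<le> 1" "a \<in> A" by blast
    then have n: "norm a = r" using A by auto
    then have "norm x = t * r" "norm x \<le> r" using x r by (auto simp: mult_left_le_one_le)
    moreover have "?p x = a" using x n r by (simp add: field_simps)
    ultimately show "x \<in> ?p -` A \<inter> (cball 0 r - {0})" using x r by auto
  qed
  then have "emeasure (distr (restrict_space lborel (cball 0 r - {0}))
               (restrict_space borel (sphere 0 r)) ?p) A
             = emeasure (restrict_space lborel (cball 0 r - {0}))
                 {t *\<^sub>R a | t a. 0 < t \<and> t \<le> 1 \<and> a \<in> A}"
    by (subst emeasure_distr[OF p S]) (simp add: space_restrict_space)
  also have "\<dots> = emeasure lborel {t *\<^sub>R a | t a. 0 < t \<and> t \<le> 1 \<and> a \<in> A}"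
  proof (rule emeasure_restrict_space)
    show "(cball 0 r - {0}) \<inter> space lborel \<in> sets (lborel :: 'a measure)" by auto
    show "{t *\<^sub>R a | t a. 0 < t \<and> t \<le> 1 \<and> a \<in> A} \<subseteq> cball 0 r - {0}"
      using A r by (auto simp: mult_left_le_one_le subset_iff)
  qed
  finally show ?thesis by (simp add: sphere_surface_measure_def)
qed

lemma emeasure_sphere_surface_measure_total:
  assumes r: "r > 0"
  shows "emeasure (sphere_surface_measure r) (sphere (0::'a::euclidean_space) r) =
           ennreal (real DIM('a) / r * measure lborel (cball (0::'a) r))"
proof -
  have *: "{t *\<^sub>R a | t a. 0 < t \<and> t \<le> 1 \<and> a \<in> sphere (0::'a) r} = cball 0 r - {0}" (is "?L = ?R")
  proof (intro subset_antisym subsetI)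
    fix x assume "x \<in> ?L" then show "x \<in> ?R" using r by (auto simp: mult_left_le_one_le)
  next
    fix x assume x: "x \<in> ?R"
    then have "x = (norm x / r) *\<^sub>R ((r / norm x) *\<^sub>R x)" "0 < norm x / r" "norm x / r \<le> 1"
      "(r / norm x) *\<^sub>R x \<in> sphere 0 r" using r by auto
    then show "x \<in> ?L" by blast
  qed
  have "emeasure lborel (cball (0::'a) r - {0}) = emeasure lborel (cball (0::'a) r)"
    using r by (subst emeasure_Diff) auto
  also have "\<dots> = ennreal (measure lborel (cball (0::'a) r))"
    using emeasure_lborel_cball_finite[of "0::'a" r] by (intro emeasure_eq_ennreal_measure) auto
  finally show ?thesis
    using r by (subst emeasure_sphere_surface_measure) (simp_all only: *, simp_all add: ennreal_mult[symmetric])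
qed

lemma emeasure_normalized_sphere_measure_total:
  assumes r: "r > 0"
  shows "emeasure (normalized_sphere_measure r) (sphere (0::'a::euclidean_space) r) = 1"
proof -
  have "sphere (0::'a) r \<in> sets (sphere_surface_measure r)"
    using sets.top[of "sphere_surface_measure r :: 'a measure"] by simp
  then show ?thesis
    using r content_cball_pos[OF r, of "0::'a"] unfolding normalized_sphere_measure_def
    by (subst emeasure_uniform_measure_1)
       (auto simp: emeasure_sphere_surface_measure_total ennreal_eq_0_iff not_le)
qed

definition hermitian_product :: "complex ^ 'n \<Rightarrow> complex ^ 'n \<Rightarrow> complex" where
  "hermitian_product z w = (\<Sum>j\<in>UNIV. z $ j * cnj (w $ j))"

definition twisted_spherical_mean ::
    "(complex ^ 'n \<Rightarrow> complex) \<Rightarrow> real \<Rightarrow> complex ^ 'n \<Rightarrow> complex" where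
  "twisted_spherical_mean f r z =
     (LINT w|normalized_sphere_measure r.
        f (z - w) * exp (\<i> / 2 * of_real (Im (hermitian_product z w))))"

definition multi_indices :: "nat \<Rightarrow> ('n::finite \<Rightarrow> nat) set" where
  "multi_indices p = {\<alpha>. (\<Sum>j\<in>UNIV. \<alpha> j) = p}"

lemma finite_multi_indices: "finite (multi_indices p :: ('n::finite \<Rightarrow> nat) set)"
proof (rule finite_subset)
  show "multi_indices p \<subseteq> (PiE UNIV (\<lambda>_. {..p}) :: ('n \<Rightarrow> nat) set)"
    by (auto simp: multi_indices_def PiE_def intro: member_le_sum)
qed (auto intro: finite_PiE)

text \<open>
  Polynomials in \<open>z\<close> and its conjugate are identified with the functions they induce; such a
  polynomial is zero if and only if its function is.
\<close>

definition bihomogeneous_polys :: "nat \<Rightarrow> nat \<Rightarrow> (complex ^ 'n \<Rightarrow> complex) set" where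
  "bihomogeneous_polys p q =
     {P. \<exists>c. \<forall>z. P z = (\<Sum>\<alpha>\<in>multi_indices p. \<Sum>\<beta>\<in>multi_indices q.
        c \<alpha> \<beta> * (\<Prod>j\<in>UNIV. (z $ j) ^ \<alpha> j) * (\<Prod>j\<in>UNIV. cnj (z $ j) ^ \<beta> j))}"

text \<open>
  Wirtinger derivatives, with \<open>z\<^sub>k = x\<^sub>k + i y\<^sub>k\<close>.
\<close>

definition partial_x :: "'n \<Rightarrow> (complex ^ 'n \<Rightarrow> complex) \<Rightarrow> complex ^ 'n \<Rightarrow> complex" where
  "partial_x k f z = vector_derivative (\<lambda>t. f (z + t *\<^sub>R axis k 1)) (at 0)"

definition partial_y :: "'n \<Rightarrow> (complex ^ 'n \<Rightarrow> complex) \<Rightarrow> complex ^ 'n \<Rightarrow> complex" where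
  "partial_y k f z = vector_derivative (\<lambda>t. f (z + t *\<^sub>R axis k \<i>)) (at 0)"

definition wirtinger_z :: "'n \<Rightarrow> (complex ^ 'n \<Rightarrow> complex) \<Rightarrow> complex ^ 'n \<Rightarrow> complex" where
  "wirtinger_z k f z = (partial_x k f z - \<i> * partial_y k f z) / 2"

definition wirtinger_zbar :: "'n \<Rightarrow> (complex ^ 'n \<Rightarrow> complex) \<Rightarrow> complex ^ 'n \<Rightarrow> complex" where
  "wirtinger_zbar k f z = (partial_x k f z + \<i> * partial_y k f z) / 2"

definition laplacian :: "(complex ^ 'n \<Rightarrow> complex) \<Rightarrow> complex ^ 'n \<Rightarrow> complex" where
  "laplacian f z = 4 * (\<Sum>k\<in>UNIV. wirtinger_z k (wirtinger_zbar k f) z)"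

definition bigraded_harmonics :: "nat \<Rightarrow> nat \<Rightarrow> (complex ^ 'n \<Rightarrow> complex) set" where
  "bigraded_harmonics p q = {P \<in> bihomogeneous_polys p q. \<forall>z. laplacian P z = 0}"

end

theory Submission
  imports Defs
begin

text \<open>
  Multiplication by a Gaussian turns the twist into a holomorphic exponential. For \<open>u = z - w\<close>,
  \<open>exp ((norm w)^2 / 4) * exp (\<i> / 2 * Im \<langle>z, w\<rangle>) =
      exp ((norm z)^2 / 4) * exp ((norm u)^2 / 4) * exp (- \<langle>z, u\<rangle> / 2)\<close>,
  where \<open>\<langle>z, w\<rangle>\<close> is the hermitian product. Both implications use this identity. Spherical means for all
  radii carry the same information as integrals against the radial weights
  \<open>max 0 (\<rho> - (norm w)^2) ^ m / m!\<close> for all \<open>\<rho>\<close>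
  (\<open>lborel_integral_eq_0_if_sphere_means_0\<close>, \<open>sphere_mean_eq_0_if_trunc_integrals_0\<close>), and these weights can
  be differentiated and integrated by parts.
  
  A nonzero harmonic polynomial \<open>P\<close> that vanishes on the cone contradicts injectivity: all
  twisted spherical means of \<open>P u * exp (- (norm u)^2 / 4)\<close> vanish at every zero \<open>z\<close> of \<open>P\<close>
  (\<open>twisted_spherical_mean_eq_0_at_zero\<close>). One has to see that the weighted integrals of
  \<open>P (z - w) * exp (\<langle>z, w\<rangle> / 2)\<close> vanish. Replacing \<open>w\<close> by \<open>s w\<close> in both factors and
  differentiating in \<open>s\<close>, integration by parts and harmonicity reduce the derivative to the same
  integral for the holomorphic derivative of \<open>P\<close> in the direction \<open>z\<close>. This is 0 or a harmonic
  polynomial of lower degree, and it vanishes at \<open>z\<close> by Euler's identity.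
  
  Conversely, let \<open>f\<close> be continuous with vanishing means on the cone, and let
  \<open>g u = f u * exp ((norm u)^2 / 4)\<close>. For \<open>\<omega>\<close> in the cone, \<open>x = \<langle>\<omega>, u\<rangle>\<close> and \<open>z = \<mu> \<omega>\<close>, the means give
  \<open>\<integral> g u * exp (- \<mu> x / 2) * k (\<rho> - (norm u)^2 + \<mu> x + cnj (\<mu> x)) du = 0\<close> for all complex \<open>\<mu>\<close>, where \<open>k\<close> is
  a truncated power; the term \<open>(norm z)^2\<close> has been absorbed in \<open>\<rho>\<close>. Differentiation at \<open>\<mu> = 0\<close> shows that
  the integrals of \<open>g u * x^p * (cnj x)^q\<close> against a suitable radial weight vanish (\<open>line_moment_eq_0\<close>).
  As functions of \<open>\<omega>\<close> these moments are polynomials of bidegree \<open>(p, q)\<close>, whose Laplacian is a moment of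
  bidegree \<open>(p - 1, q - 1)\<close> (\<open>laplacian_moment\<close>). By induction they are harmonic, and they vanish on the
  cone, so they vanish identically. First-order differential equations in \<open>\<rho>\<close> lead from these weights
  back to the truncated powers (\<open>kernel_integral_peel\<close>). Hence \<open>g\<close> is orthogonal to all polynomials and vanishes
  (\<open>continuous_eq_0_if_moments_0\<close>).
\<close>

section \<open>Truncated powers and compactly supported integrands\<close>

text \<open>
  The weights \<open>trunc_power m (\<rho> - (norm w)^2)\<close> are the basic radial test functions. For
  \<open>m \<ge> 1\<close> they are continuous and compactly supported, and this family in \<open>m\<close> and \<open>\<rho>\<close> is closed under the three operations the proof
  needs: differentiation in \<open>\<rho>\<close>, differentiation in \<open>w\<close> (up to linear factors), and
  multiplication by \<open>(norm w)^2\<close>. The factorial normalises the derivative with respect to \<open>a\<close>.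
\<close>

definition trunc_power :: "nat \<Rightarrow> real \<Rightarrow> real" where
  "trunc_power m a = max 0 a ^ m / fact m"

lemma trunc_power_nonpos: "m \<ge> 1 \<Longrightarrow> a \<le> 0 \<Longrightarrow> trunc_power m a = 0"
  by (simp add: trunc_power_def)

lemma continuous_on_trunc_power [continuous_intros]:
  "continuous_on S f \<Longrightarrow> continuous_on S (\<lambda>x. trunc_power m (f x))"
  unfolding trunc_power_def by (intro continuous_intros) auto

lemma mult_trunc_power:
  "m \<ge> 1 \<Longrightarrow> a * trunc_power m a = real (Suc m) * trunc_power (Suc m) a"
  by (auto simp: trunc_power_def max_def simp del: of_nat_Suc)

text \<open>
  From the exponent 2 on, the truncation at the origin is differentiable: the difference quotient
  there is dominated by a positive power.
\<close>

lemma has_derivative_trunc_power: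
  "((trunc_power (Suc (Suc m))) has_real_derivative trunc_power (Suc m) a) (at a)"
proof -
  have base: "((\<lambda>a. max 0 a ^ (m + 2)) has_real_derivative real (m + 2) * max 0 a ^ (m + 1)) (at a)"
    for a :: real
  proof (cases "a = 0")
    case True
    have "((\<lambda>h. max 0 h ^ (m + 2) / h) \<longlongrightarrow> 0) (at (0::real))"
    proof (rule Lim_null_comparison)
      show "\<forall>\<^sub>F h in at (0::real). norm (max 0 h ^ (m + 2) / h) \<le> max 0 h ^ (m + 1)"
        by (intro always_eventually allI) (auto simp: max_def power_add)
      have "((\<lambda>h. max 0 h ^ (m + 1)) \<longlongrightarrow> max 0 0 ^ (m + 1)) (at (0::real))"
        by (intro tendsto_intros)
      then show "((\<lambda>h. max 0 h ^ (m + 1)) \<longlongrightarrow> 0) (at (0::real))" by simp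
    qed
    then show ?thesis using True by (simp add: DERIV_def)
  next
    case False
    then consider "a > 0" | "a < 0" by linarith
    then show ?thesis
    proof cases
      case 1
      have "((\<lambda>a. a ^ (m + 2)) has_real_derivative real (m + 2) * max 0 a ^ (m + 1)) (at a)"
        using 1 DERIV_pow[of "m + 2" a] by simp
      moreover have "\<forall>\<^sub>F x in nhds a. max 0 x ^ (m + 2) = x ^ (m + 2)"
        using eventually_nhds_in_open[of "{0<..}" a] 1 by (auto elim!: eventually_mono)
      ultimately show ?thesis by (subst DERIV_cong_ev[OF refl _ refl]) auto
    next
      case 2
      have "((\<lambda>a. 0) has_real_derivative real (m + 2) * max 0 a ^ (m + 1)) (at a)"
        using 2 by (auto intro!: derivative_eq_intros)
      moreover have "\<forall>\<^sub>F x in nhds a. max 0 x ^ (m + 2) = 0"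
        using eventually_nhds_in_open[of "{..<0}" a] 2 by (auto elim!: eventually_mono)
      ultimately show ?thesis by (subst DERIV_cong_ev[OF refl _ refl]) auto
    qed
  qed
  have "((\<lambda>a. max 0 a ^ (m + 2) / fact (m + 2)) has_real_derivative
          real (m + 2) * max 0 a ^ (m + 1) / fact (m + 2)) (at a)"
    by (intro DERIV_cdivide base)
  moreover have "real (m + 2) * max 0 a ^ (m + 1) / fact (m + 2) = trunc_power (Suc m) a"
    by (simp add: trunc_power_def fact_Suc[of "Suc m"] numeral_2_eq_2 del: of_nat_Suc fact_Suc)
  ultimately show ?thesis
    unfolding trunc_power_def by (simp add: numeral_2_eq_2)
qed

lemma has_vector_derivative_trunc_power_compose:
  assumes m: "m \<ge> 1" and h: "(h has_real_derivative h') (at t within S)"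
  shows "((\<lambda>t. complex_of_real (trunc_power (Suc m) (h t))) has_vector_derivative
            of_real (trunc_power m (h t) * h')) (at t within S)"
proof -
  obtain l where l: "m = Suc l" using m by (cases m) auto
  have "((\<lambda>t. trunc_power (Suc m) (h t)) has_real_derivative trunc_power m (h t) * h') (at t within S)"
    using DERIV_chain2[OF has_derivative_trunc_power h] l by simp
  then show ?thesis
    by (intro has_vector_derivative_of_real) (simp add: has_real_derivative_iff_has_vector_derivative)
qed

definition vanishes_outside :: "real \<Rightarrow> ('a::real_normed_vector \<Rightarrow> complex) \<Rightarrow> bool" where
  "vanishes_outside R F \<longleftrightarrow> (\<forall>u. norm u > R \<longrightarrow> F u = 0)"

lemma cball_subset_cbox_One:
  "cball (0::'a::euclidean_space) R \<subseteq> cbox (- (R *\<^sub>R One)) (R *\<^sub>R One)"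
proof
  fix x :: 'a assume "x \<in> cball 0 R"
  then have "\<bar>x \<bullet> b\<bar> \<le> R" if "b \<in> Basis" for b
    using Basis_le_norm[OF that, of x] by auto
  then show "x \<in> cbox (- (R *\<^sub>R One)) (R *\<^sub>R One)"
    by (auto simp: mem_box abs_le_iff inner_add_left) (smt (verit))
qed

lemma
  fixes F :: "'a::euclidean_space \<Rightarrow> complex"
  assumes F: "continuous_on UNIV F" "vanishes_outside R F"
  shows integrable_compact_support: "integrable lborel F"
    and lborel_integral_compact_support:
      "integral\<^sup>L lborel F = integral (cbox (- (R *\<^sub>R One)) (R *\<^sub>R One)) F"
proof -
  let ?B = "cbox (- (R *\<^sub>R One)) (R *\<^sub>R One) :: 'a set"
  have *: "(\<lambda>x. indicator ?B x *\<^sub>R F x) = F"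
    using F(2) cball_subset_cbox_One[of R, where 'a='a]
    by (force simp: vanishes_outside_def indicator_def not_less)
  have "set_integrable lborel ?B F"
    unfolding set_integrable_def
    by (rule borel_integrable_compact) (auto intro: continuous_on_subset[OF F(1)])
  then show "integrable lborel F" "integral\<^sup>L lborel F = integral ?B F"
    using set_borel_integral_eq_integral(2)[of ?B F]
    by (simp_all add: set_integrable_def set_lebesgue_integral_def *)
qed

text \<open>
  Differentiation under the integral sign over the whole space, reduced to the compact box that
  contains all the supports. The parameter derivative of a family with supports in a common ball
  vanishes outside that ball too, so both sides are integrals over the box.
\<close>

lemma leibniz_compact_support:
  fixes f f' :: "real \<Rightarrow> 'a::euclidean_space \<Rightarrow> complex"
  assumes U: "open U" "convex U" "t0 \<in> U"
    and der: "\<And>t u. t \<in> U \<Longrightarrow> ((\<lambda>t. f t u) has_vector_derivative f' t u) (at t)"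
    and cf: "\<And>t. t \<in> U \<Longrightarrow> continuous_on UNIV (f t)"
    and cf': "continuous_on (U \<times> UNIV) (\<lambda>(t, u). f' t u)"
    and supp: "\<And>t. t \<in> U \<Longrightarrow> vanishes_outside R (f t)"
  shows "((\<lambda>t. integral\<^sup>L lborel (f t)) has_vector_derivative integral\<^sup>L lborel (f' t0)) (at t0)"
proof -
  let ?B = "cbox (- (R *\<^sub>R One)) (R *\<^sub>R One) :: 'a set"
  have supp': "vanishes_outside R (f' t)" if t: "t \<in> U" for t
    unfolding vanishes_outside_def
  proof (intro allI impI)
    fix u :: 'a assume u: "norm u > R"
    have "((\<lambda>t. f t u) has_vector_derivative 0) (at t)"
    proof (rule has_vector_derivative_transform_within_open[OF has_vector_derivative_const U(1) t])
      show "0 = f s u" if "s \<in> U" for s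
        using supp[OF that] u by (simp add: vanishes_outside_def)
    qed
    then show "f' t u = 0"
      by (rule vector_derivative_unique_at[OF der[OF t]])
  qed
  have cf'1: "continuous_on UNIV (f' t)" if t: "t \<in> U" for t
  proof -
    have "continuous_on UNIV (\<lambda>u::'a. (t, u))"
      by (rule continuous_on_Pair[OF continuous_on_const continuous_on_id])
    then show ?thesis
      using continuous_on_compose2[OF cf', of UNIV "Pair t"] t by auto
  qed
  have "((\<lambda>t. integral ?B (f t)) has_vector_derivative integral ?B (f' t0)) (at t0 within U)"
  proof (rule leibniz_rule_vector_derivative)
    fix t u assume t: "t \<in> U"
    show "((\<lambda>t. f t u) has_vector_derivative f' t u) (at t within U)"
      by (rule has_vector_derivative_at_within[OF der[OF t]])
    show "f t integrable_on ?B"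
      by (rule integrable_continuous[OF continuous_on_subset[OF cf[OF t] subset_UNIV]])
  next
    show "continuous_on (U \<times> ?B) (\<lambda>(t, u). f' t u)"
      by (rule continuous_on_subset[OF cf']) auto
  qed (use U in auto)
  then have "((\<lambda>t. integral ?B (f t)) has_vector_derivative integral\<^sup>L lborel (f' t0)) (at t0)"
    using lborel_integral_compact_support[OF cf'1[OF U(3)] supp'[OF U(3)]]
    by (simp add: at_within_open[OF U(3,1)])
  then show ?thesis
  proof (rule has_vector_derivative_transform_within_open[OF _ U(1) U(3)])
    show "integral ?B (f t) = integral\<^sup>L lborel (f t)" if "t \<in> U" for t
      by (rule lborel_integral_compact_support[OF cf[OF that] supp[OF that], symmetric])
  qed
qed

section \<open>Spherical means and volume integrals\<close>

definition sphere_mean :: "real \<Rightarrow> ('a::euclidean_space \<Rightarrow> complex) \<Rightarrow> complex" where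
  "sphere_mean r F = (LINT w|normalized_sphere_measure r. F w)"

text \<open>
  The constant factors in the surface measure cancel in the normalisation: the normalised
  measure is the image of the uniform distribution on the ball under radial projection.
\<close>

lemma normalized_sphere_measure_eq_density:
  assumes r: "r > 0"
  shows "(normalized_sphere_measure r :: 'a::euclidean_space measure) =
    density (distr (restrict_space lborel (cball 0 r - {0})) (restrict_space borel (sphere 0 r))
          (\<lambda>x. (r / norm x) *\<^sub>R x)) (\<lambda>_. ennreal (1 / measure lborel (cball (0::'a) r)))"
    (is "_ = density ?D _")
proof (rule measure_eqI)
  show "sets (normalized_sphere_measure r) = sets (density ?D (\<lambda>_. ennreal (1 / measure lborel (cball (0::'a) r))))"
    by (simp add: sets_normalized_sphere_measure)
next
  let ?V = "measure lborel (cball (0::'a) r)" and ?d = "real DIM('a) / r"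
  fix A :: "'a set" assume "A \<in> sets (normalized_sphere_measure r)"
  then have A: "A \<in> sets (restrict_space borel (sphere 0 r))"
    by (simp add: sets_normalized_sphere_measure)
  then have AS: "sphere 0 r \<inter> A = A"
    using sets.sets_into_space[OF A] by (auto simp: space_restrict_space)
  have V: "?V > 0" using r by (rule content_cball_pos)
  have d: "?d > 0" using r by simp
  have "emeasure (normalized_sphere_measure r) A
      = emeasure (sphere_surface_measure r) A / emeasure (sphere_surface_measure r) (sphere (0::'a) r)"
    unfolding normalized_sphere_measure_def
    by (subst emeasure_uniform_measure)
       (use A sets.top[of "sphere_surface_measure r :: 'a measure"] in
         \<open>auto simp: sets_sphere_surface_measure AS\<close>)
  also have "\<dots> = ennreal ?d * emeasure ?D A / ennreal (?d * ?V)"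
    by (simp add: emeasure_sphere_surface_measure_total[OF r]) (simp add: sphere_surface_measure_def)
  also have "\<dots> = ennreal (1 / ?V) * emeasure ?D A"
  proof -
    have "ennreal ?d / ennreal (?d * ?V) = ennreal (1 / ?V)"
      using V d by (simp add: divide_ennreal)
    then have "ennreal (1 / ?V) * emeasure ?D A = emeasure ?D A * (ennreal ?d / ennreal (?d * ?V))"
      by (simp only: mult.commute)
    also have "\<dots> = ennreal ?d * emeasure ?D A / ennreal (?d * ?V)"
      by (simp only: ennreal_times_divide mult.commute[of _ "emeasure ?D A"])
    finally show ?thesis ..
  qed
  also have "\<dots> = emeasure (density ?D (\<lambda>_. ennreal (1 / ?V))) A"
    using A by (subst emeasure_density_const) simp_all
  finally show "emeasure (normalized_sphere_measure r) A = \<dots>" .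
qed

lemma borel_measurable_radial_projection:
  fixes F :: "'a::euclidean_space \<Rightarrow> complex"
  assumes "continuous_on UNIV F"
  shows "(\<lambda>x. F ((r / norm x) *\<^sub>R x)) \<in> borel_measurable borel"
proof -
  have "F \<in> borel_measurable borel"
    using assms by (rule borel_measurable_continuous_onI)
  then show ?thesis by measurable
qed

lemma sphere_mean_eq_cball_integral:
  fixes F :: "'a::euclidean_space \<Rightarrow> complex"
  assumes r: "r > 0" and F: "continuous_on UNIV F"
  shows "sphere_mean r F =
    (LINT x|lborel. indicator (cball 0 r) x *\<^sub>R F ((r / norm x) *\<^sub>R x)) /\<^sub>R measure lborel (cball (0::'a) r)"
proof -
  let ?p = "\<lambda>x::'a. (r / norm x) *\<^sub>R x"
  let ?D = "distr (restrict_space lborel (cball 0 r - {0})) (restrict_space borel (sphere 0 r)) ?p"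
  let ?V = "measure lborel (cball (0::'a) r)"
  have Fm: "F \<in> borel_measurable (restrict_space borel (sphere 0 r))"
    using borel_measurable_continuous_onI[OF F] by (rule measurable_restrict_space1)
  have p: "?p \<in> measurable (restrict_space lborel (cball 0 r - {0})) (restrict_space borel (sphere 0 r))"
    using r by (intro measurable_restrict_space3) auto
  have "sphere_mean r F = integral\<^sup>L (density ?D (\<lambda>_. ennreal (1 / ?V))) F"
    by (simp add: sphere_mean_def normalized_sphere_measure_eq_density[OF r])
  also have "\<dots> = (LINT x|?D. (1 / ?V) *\<^sub>R F x)"
    by (subst integral_density) (use Fm in auto)
  also have "\<dots> = (LINT x|restrict_space lborel (cball 0 r - {0}). (1 / ?V) *\<^sub>R F (?p x))"
    by (subst integral_distr[OF p]) (use Fm in auto)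
  also have "\<dots> = (LINT x|lborel. indicator (cball 0 r - {0}) x *\<^sub>R (1 / ?V) *\<^sub>R F (?p x))"
    by (subst integral_restrict_space) auto
  also have "\<dots> = (LINT x|lborel. (1 / ?V) *\<^sub>R indicator (cball 0 r) x *\<^sub>R F (?p x))"
  proof (rule integral_cong_AE)
    have "AE x in lborel. x \<noteq> (0::'a)" by (rule AE_lborel_singleton)
    then show "AE x in lborel. indicator (cball 0 r - {0}) x *\<^sub>R (1 / ?V) *\<^sub>R F (?p x) =
        (1 / ?V) *\<^sub>R indicator (cball 0 r) x *\<^sub>R F (?p x)"
      by eventually_elim (auto simp: indicator_def)
  next
    show "(\<lambda>x. indicator (cball 0 r - {0}) x *\<^sub>R (1 / ?V) *\<^sub>R F (?p x)) \<in> borel_measurable lborel"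
      unfolding measurable_lborel1
      by (intro borel_measurable_scaleR borel_measurable_indicator borel_measurable_const)
        (auto intro: borel_measurable_radial_projection[OF F])
    show "(\<lambda>x. (1 / ?V) *\<^sub>R indicator (cball 0 r) x *\<^sub>R F (?p x)) \<in> borel_measurable lborel"
      unfolding measurable_lborel1
      by (intro borel_measurable_scaleR borel_measurable_indicator borel_measurable_const)
        (auto intro: borel_measurable_radial_projection[OF F])
  qed
  finally show ?thesis by (simp only: integral_scaleR_right inverse_eq_divide)
qed

lemma lborel_integral_scale:
  fixes F :: "'a::euclidean_space \<Rightarrow> complex"
  assumes c: "c > 0" and F: "F \<in> borel_measurable borel"
  shows "integral\<^sup>L lborel F = c ^ DIM('a) *\<^sub>R (LINT x|lborel. F (c *\<^sub>R x))"
proof -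
  have "integral\<^sup>L lborel F = integral\<^sup>L (density (distr lborel borel (\<lambda>x. 0 + c *\<^sub>R x)) (\<lambda>_. ennreal (c ^ DIM('a)))) F"
    using lborel_affine[of c "0::'a"] c by simp
  also have "\<dots> = (LINT x|distr lborel borel (\<lambda>x. 0 + c *\<^sub>R x). c ^ DIM('a) *\<^sub>R F x)"
    by (subst integral_density) (use F c in auto)
  also have "\<dots> = (LINT x|lborel. c ^ DIM('a) *\<^sub>R F (c *\<^sub>R x))"
    by (subst integral_distr) (use F in auto)
  finally show ?thesis by simp
qed

lemma lborel_integral_translate:
  fixes F :: "'a::euclidean_space \<Rightarrow> complex"
  assumes F: "F \<in> borel_measurable borel"
  shows "(LINT x|lborel. F (c + x)) = integral\<^sup>L lborel F"
proof -
  have "integral\<^sup>L lborel F = integral\<^sup>L (distr lborel borel ((+) c)) F"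
    by (simp add: lborel_distr_plus)
  also have "\<dots> = (LINT x|lborel. F (c + x))"
    by (subst integral_distr) (use F in auto)
  finally show ?thesis by simp
qed

lemma lborel_integral_reflect:
  fixes F :: "'a::euclidean_space \<Rightarrow> complex"
  assumes F: "F \<in> borel_measurable borel"
  shows "(LINT x|lborel. F (c - x)) = integral\<^sup>L lborel F"
proof -
  have "integral\<^sup>L lborel F =
      integral\<^sup>L (density (distr lborel borel (\<lambda>x. c + (-1) *\<^sub>R x)) (\<lambda>_. ennreal 1)) F"
    using lborel_affine[of "-1" c] by simp
  also have "\<dots> = (LINT x|distr lborel borel (\<lambda>x. c + (-1) *\<^sub>R x). F x)"
    by (subst integral_density) (use F in auto)
  also have "\<dots> = (LINT x|lborel. F (c - x))"
    by (subst integral_distr) (use F in auto)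
  finally show ?thesis by simp
qed

lemma integrable_indicator_bounded:
  fixes F :: "'a::euclidean_space \<Rightarrow> complex"
  assumes "F \<in> borel_measurable borel" "A \<in> sets borel" "A \<subseteq> cball 0 R" "\<And>x. x \<in> A \<Longrightarrow> norm (F x) \<le> B"
  shows "integrable lborel (\<lambda>x. indicator A x *\<^sub>R F x)"
proof (rule integrableI_bounded_set_indicator)
  have "emeasure lborel A \<le> emeasure lborel (cball (0::'a) R)"
    using assms by (intro emeasure_mono) auto
  then show "emeasure lborel A < \<infinity>"
    using emeasure_lborel_cball_finite[of "0::'a" R] by (simp add: order_le_less_trans)
qed (use assms in auto)

text \<open>
  The function \<open>F\<close> composed with radial projection is homogeneous of degree 0, so dilations
  relate its integral over any ball to the integral over the ball of radius \<open>r\<close>, which is the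
  spherical mean. This scaling takes the place of integration in polar coordinates.
\<close>

lemma cball_radial_projection_integral:
  fixes F :: "'a::euclidean_space \<Rightarrow> complex"
  assumes r: "r > 0" and F: "continuous_on UNIV F" and s: "s \<ge> 0"
  shows "(LINT x|lborel. indicator (cball 0 s) x *\<^sub>R F ((r / norm x) *\<^sub>R x))
           = measure lborel (cball (0::'a) s) *\<^sub>R sphere_mean r F"
proof (cases "s = 0")
  case True
  have "(LINT x|lborel. indicator {0::'a} x *\<^sub>R F ((r / norm x) *\<^sub>R x)) = 0"
    by (rule integral_eq_zero_AE) (use AE_lborel_singleton[of "0::'a"] in eventually_elim, auto)
  then show ?thesis using True by simp
next
  case False
  then have s: "s > 0" using s by simp
  let ?\<Phi> = "\<lambda>x::'a. F ((r / norm x) *\<^sub>R x)"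
  define c where "c = s / r"
  have c: "c > 0" using s r by (simp add: c_def)
  have m: "(\<lambda>x::'a. indicator (cball 0 s) x *\<^sub>R ?\<Phi> x) \<in> borel_measurable borel"
    by (intro borel_measurable_scaleR borel_measurable_indicator borel_measurable_radial_projection[OF F]) auto
  have "(LINT x|lborel. indicator (cball 0 s) x *\<^sub>R ?\<Phi> x)
      = c ^ DIM('a) *\<^sub>R (LINT x|lborel. indicator (cball 0 s) (c *\<^sub>R x) *\<^sub>R ?\<Phi> (c *\<^sub>R x))"
    by (rule lborel_integral_scale[OF c m])
  also have "(\<lambda>x::'a. indicator (cball 0 s) (c *\<^sub>R x) *\<^sub>R ?\<Phi> (c *\<^sub>R x)) =
      (\<lambda>x. indicator (cball 0 r) x *\<^sub>R ?\<Phi> x)"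
    using c r s by (auto simp: fun_eq_iff indicator_def c_def field_simps)
  also have "(LINT x|lborel. indicator (cball 0 r) x *\<^sub>R ?\<Phi> x) = measure lborel (cball (0::'a) r) *\<^sub>R sphere_mean r F"
    using content_cball_pos[OF r, of "0::'a"] by (simp add: sphere_mean_eq_cball_integral[OF r F])
  also have "c ^ DIM('a) *\<^sub>R measure lborel (cball (0::'a) r) *\<^sub>R sphere_mean r F
      = measure lborel (cball (0::'a) s) *\<^sub>R sphere_mean r F"
    using r s by (simp add: c_def content_cball power_divide)
  finally show ?thesis .
qed

text \<open>
  On a thin annulus a continuous function is close to its radial projection, so its integral is
  the volume of the annulus times a nearby spherical mean, up to a small multiple of that volume.
  Both passages between spherical means and volume integrals rest on this estimate.
\<close>

lemma norm_annulus_integral_minus_mean_le: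
  fixes F :: "'a::euclidean_space \<Rightarrow> complex"
  assumes F: "continuous_on UNIV F" and r: "r > 0" and r12: "0 \<le> r1" "r1 \<le> r2"
    and close: "\<And>w. r1 < norm w \<Longrightarrow> norm w \<le> r2 \<Longrightarrow> norm (F w - F ((r / norm w) *\<^sub>R w)) \<le> e"
  defines "V \<equiv> measure lborel (cball (0::'a) r2) - measure lborel (cball (0::'a) r1)"
  shows "norm ((LINT x|lborel. indicator (cball 0 r2) x *\<^sub>R F x)
           - (LINT x|lborel. indicator (cball 0 r1) x *\<^sub>R F x) - V *\<^sub>R sphere_mean r F) \<le> e * V"
proof -
  let ?A = "cball (0::'a) r2 - cball 0 r1" and ?\<Phi> = "\<lambda>x::'a. F ((r / norm x) *\<^sub>R x)"
  have Fm: "F \<in> borel_measurable borel" using F by (rule borel_measurable_continuous_onI)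
  note \<Phi>m = borel_measurable_radial_projection[OF F, of r]
  have "compact (F ` cball 0 (max r2 r))"
    by (rule compact_continuous_image[OF continuous_on_subset[OF F]]) auto
  then obtain B where B: "\<And>x. norm x \<le> max r2 r \<Longrightarrow> norm (F x) \<le> B"
    using compact_imp_bounded bounded_iff by (metis (no_types, lifting) image_eqI mem_cball_0)
  have iF: "integrable lborel (\<lambda>x. indicator (cball 0 s) x *\<^sub>R F x)" if "s \<le> r2" for s
    by (rule integrable_indicator_bounded[OF Fm, of _ r2 B]) (use that B in auto)
  have i\<Phi>: "integrable lborel (\<lambda>x. indicator (cball 0 s) x *\<^sub>R ?\<Phi> x)" if "s \<le> r2" for s
  proof (rule integrable_indicator_bounded[OF \<Phi>m, of _ r2 B])
    fix x :: 'a
    have "norm ((r / norm x) *\<^sub>R x) \<le> r" using r by auto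
    then show "norm (?\<Phi> x) \<le> B" by (intro B) auto
  qed (use that in auto)
  have iV: "integrable lborel (\<lambda>x::'a. indicator (cball 0 s) x :: real)" for s
    using emeasure_lborel_cball_finite[of "0::'a" s] by (intro integrable_real_indicator) auto
  have "(LINT x|lborel. indicator (cball 0 r2) x *\<^sub>R F x)
           - (LINT x|lborel. indicator (cball 0 r1) x *\<^sub>R F x) - V *\<^sub>R sphere_mean r F
      = (LINT x|lborel. (indicator (cball 0 r2) x *\<^sub>R F x - indicator (cball 0 r1) x *\<^sub>R F x)
          - (indicator (cball 0 r2) x *\<^sub>R ?\<Phi> x - indicator (cball 0 r1) x *\<^sub>R ?\<Phi> x))"
    using r12 cball_radial_projection_integral[OF r F, of r1] cball_radial_projection_integral[OF r F, of r2]
    by (simp add: iF i\<Phi> V_def scaleR_left_diff_distrib)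
  also have "norm \<dots> \<le> (LINT x|lborel. e * (indicator (cball (0::'a) r2) x - indicator (cball 0 r1) x))"
  proof (rule Bochner_Integration.integral_norm_bound_integral)
    fix x :: 'a
    show "norm ((indicator (cball 0 r2) x *\<^sub>R F x - indicator (cball 0 r1) x *\<^sub>R F x)
          - (indicator (cball 0 r2) x *\<^sub>R ?\<Phi> x - indicator (cball 0 r1) x *\<^sub>R ?\<Phi> x))
        \<le> e * (indicator (cball (0::'a) r2) x - indicator (cball 0 r1) x)"
      using close[of x] r12 by (auto simp: indicator_def)
  qed (use r12 in \<open>auto intro!: Bochner_Integration.integrable_diff iF i\<Phi> integrable_mult_right iV\<close>)
  also have "\<dots> = e * V"
    by (simp add: iV V_def)
  finally show ?thesis .
qed

lemma dist_radial_projection: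
  fixes w :: "'a::real_normed_vector"
  assumes "w \<noteq> 0"
  shows "dist w ((r / norm w) *\<^sub>R w) = \<bar>norm w - r\<bar>"
proof -
  have 1: "w - (r / norm w) *\<^sub>R w = (1 - r / norm w) *\<^sub>R w" by (simp add: algebra_simps)
  have "dist w ((r / norm w) *\<^sub>R w) = \<bar>1 - r / norm w\<bar> * norm w"
    unfolding dist_norm 1 by simp
  also have "\<dots> = \<bar>(1 - r / norm w) * norm w\<bar>" by (simp add: abs_mult)
  also have "(1 - r / norm w) * norm w = norm w - r" using assms by (simp add: left_diff_distrib)
  finally show ?thesis .
qed

text \<open>
  The ball is cut into annuli so thin that \<open>F\<close> varies by less than \<open>e\<close> along their radii. As the
  means vanish, each annulus contributes at most \<open>e\<close> times its volume.
\<close>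

lemma cball_integral_eq_0_if_sphere_means_0:
  fixes F :: "'a::euclidean_space \<Rightarrow> complex"
  assumes F: "continuous_on UNIV F" and mean: "\<And>r. r > 0 \<Longrightarrow> sphere_mean r F = 0" and R: "R > 0"
  shows "(LINT x|lborel. indicator (cball 0 R) x *\<^sub>R F x) = 0"
proof -
  define J where "J s = (LINT x|lborel. indicator (cball 0 s) x *\<^sub>R F x)" for s
  define V where "V s = measure lborel (cball (0::'a) s)" for s
  have J0: "J 0 = 0"
    unfolding J_def by (rule integral_eq_zero_AE) (use AE_lborel_singleton[of "0::'a"] in eventually_elim, auto)
  have "norm (J R) \<le> e * V R" if e: "e > 0" for e
  proof -
    have "uniformly_continuous_on (cball 0 R) F"
      by (intro compact_uniformly_continuous continuous_on_subset[OF F]) auto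
    then obtain d where d: "d > 0"
      "\<And>x y. x \<in> cball 0 R \<Longrightarrow> y \<in> cball 0 R \<Longrightarrow> dist x y < d \<Longrightarrow> dist (F x) (F y) < e"
      unfolding uniformly_continuous_on_def using e by meson
    obtain N where N: "R / d < real N" using reals_Archimedean2 by blast
    have N0: "N > 0" using N R d(1) by (intro Nat.gr0I) (auto simp: divide_less_0_iff not_less)
    \<comment> \<open>The width of the annuli is smaller than the modulus of continuity \<open>d\<close>.\<close>
    define h where "h = R / real N"
    have h: "0 < h" "h < d" "real N * h = R" using N N0 R d(1) by (auto simp: h_def field_simps)
    have "norm (J (real k * h)) \<le> e * V (real k * h)" if "k \<le> N" for k
      using that
    proof (induction k)
      case 0
      then show ?case using J0 by (simp add: V_def)
    next
      case (Suc k)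
      let ?r = "real (Suc k) * h"
      have r: "?r > 0" using h(1) by (simp del: of_nat_Suc)
      have rR: "?r \<le> R"
        unfolding h(3)[symmetric] using Suc.prems h(1) by (intro mult_right_mono) auto
      have kr: "0 \<le> real k * h" "real k * h \<le> ?r" using h(1) by (auto simp: algebra_simps)
      have close: "norm (F w - F ((?r / norm w) *\<^sub>R w)) \<le> e" if w: "real k * h < norm w" "norm w \<le> ?r" for w
      proof -
        have w0: "norm w > 0" using w(1) kr(1) by linarith
        have "dist w ((?r / norm w) *\<^sub>R w) = \<bar>norm w - ?r\<bar>"
          using w0 by (intro dist_radial_projection) auto
        also have "\<dots> < d" using w h by (simp add: algebra_simps)
        finally have dist: "dist w ((?r / norm w) *\<^sub>R w) < d" .
        have "norm ((?r / norm w) *\<^sub>R w) = ?r" using w0 r by simp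
        then show ?thesis
          using d(2)[OF _ _ dist] w(2) rR unfolding dist_norm mem_cball_0 by linarith
      qed
      have "norm (J ?r - J (real k * h)) \<le> e * (V ?r - V (real k * h))"
      proof -
        have "norm (J ?r - J (real k * h) - (V ?r - V (real k * h)) *\<^sub>R sphere_mean ?r F)
            \<le> e * (V ?r - V (real k * h))"
          unfolding J_def V_def by (rule norm_annulus_integral_minus_mean_le[OF F r kr]) (rule close)
        then show ?thesis by (simp only: mean[OF r] scaleR_zero_right diff_zero)
      qed
      moreover have "norm (J (real k * h)) \<le> e * V (real k * h)" using Suc by simp
      ultimately show ?case
        using norm_triangle_ineq2[of "J ?r" "J (real k * h)"] unfolding right_diff_distrib by linarith
    qed
    from this[of N] show ?thesis by (simp add: h(3))
  qed
  note bound = this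
  have V: "V R > 0" using R by (simp add: V_def content_cball_pos)
  have "norm (J R) \<le> 0"
  proof (rule field_le_epsilon)
    fix e :: real assume "e > 0"
    then show "norm (J R) \<le> 0 + e" using bound[of "e / V R"] V by simp
  qed
  then show ?thesis by (simp add: J_def)
qed

text \<open>
  Multiplying \<open>F\<close> by a radial factor keeps the hypothesis, so this also covers integrals against
  continuous, compactly supported radial weights.
\<close>

lemma lborel_integral_eq_0_if_sphere_means_0:
  fixes F :: "'a::euclidean_space \<Rightarrow> complex"
  assumes F: "continuous_on UNIV F" "vanishes_outside R F"
    and mean: "\<And>r. r > 0 \<Longrightarrow> sphere_mean r F = 0"
  shows "integral\<^sup>L lborel F = 0"
proof -
  have "(\<lambda>x. indicator (cball 0 (max R 1)) x *\<^sub>R F x) = F"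
    using F(2) by (auto simp: fun_eq_iff indicator_def vanishes_outside_def)
  then show ?thesis
    using cball_integral_eq_0_if_sphere_means_0[OF F(1) mean, of "max R 1"] by simp
qed

text \<open>
  Lipschitz bound that makes the difference quotients of the weight converge boundedly to the
  indicator function of a ball.
\<close>

lemma trunc_power_1_increment:
  assumes "d \<ge> 0"
  shows "0 \<le> trunc_power 1 (a + d) - trunc_power 1 a" "trunc_power 1 (a + d) - trunc_power 1 a \<le> d"
  using assms by (auto simp: trunc_power_def)

lemma vanishes_outside_trunc_power:
  assumes "m \<ge> 1"
  shows "vanishes_outside (\<bar>\<rho>\<bar> + 1) (\<lambda>w. of_real (trunc_power m (\<rho> - (norm w)\<^sup>2)) * F w)"
  unfolding vanishes_outside_def
proof (intro allI impI)
  fix u :: 'a assume u: "\<bar>\<rho>\<bar> + 1 < norm u"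
  then have "norm u \<le> (norm u)\<^sup>2"
    using mult_left_mono[of 1 "norm u" "norm u"] by (simp add: power2_eq_square)
  then show "of_real (trunc_power m (\<rho> - (norm u)\<^sup>2)) * F u = 0"
    using u assms by (simp add: trunc_power_nonpos)
qed

text \<open>
  Difference quotients in \<open>\<rho>\<close> of \<open>trunc_power 1 (\<rho> - (norm w)^2)\<close> tend to the indicator function
  of the ball of radius \<open>sqrt \<rho>\<close>.
\<close>

lemma cball_integral_eq_0_if_trunc_integrals_0:
  fixes F :: "'a::euclidean_space \<Rightarrow> complex"
  assumes F: "continuous_on UNIV F"
    and trunc: "\<And>\<rho>. (LINT w|lborel. of_real (trunc_power 1 (\<rho> - (norm w)\<^sup>2)) * F w) = 0"
    and s: "s > 0"
  shows "(LINT x|lborel. indicator (cball 0 s) x *\<^sub>R F x) = 0"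
proof -
  \<comment> \<open>The difference quotient with increment \<open>1 / Suc n\<close>: it is 1 on the ball and 0 away from it, with
    values in between on a shell that shrinks to the sphere.\<close>
  define q where "q n w = real (Suc n) * (trunc_power 1 (s\<^sup>2 - (norm w)\<^sup>2 + 1 / real (Suc n))
      - trunc_power 1 (s\<^sup>2 - (norm w)\<^sup>2))" for n and w :: 'a
  have Fm: "F \<in> borel_measurable borel" using F by (rule borel_measurable_continuous_onI)
  have "compact (F ` cball 0 (s + 1))"
    by (rule compact_continuous_image[OF continuous_on_subset[OF F]]) auto
  then obtain B where B: "\<And>x. norm x \<le> s + 1 \<Longrightarrow> norm (F x) \<le> B"
    using compact_imp_bounded bounded_iff by (metis (no_types, lifting) image_eqI mem_cball_0)
  have qc: "continuous_on UNIV (q n)" for n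
    unfolding q_def by (intro continuous_intros)
  have q01: "0 \<le> q n w" "q n w \<le> 1" for n w
  proof -
    show "0 \<le> q n w"
      unfolding q_def using trunc_power_1_increment(1) by (intro mult_nonneg_nonneg) auto
    have "q n w \<le> real (Suc n) * (1 / real (Suc n))"
      unfolding q_def using trunc_power_1_increment(2) by (intro mult_left_mono) auto
    then show "q n w \<le> 1" by simp
  qed
  have qout: "q n w = 0" if "1 / real (Suc n) \<le> (norm w)\<^sup>2 - s\<^sup>2" for n w
  proof -
    have "0 < 1 / real (Suc n)" by simp
    then have "s\<^sup>2 - (norm w)\<^sup>2 \<le> 0" "s\<^sup>2 - (norm w)\<^sup>2 + 1 / real (Suc n) \<le> 0" using that by linarith+
    then show ?thesis by (simp add: q_def trunc_power_nonpos)
  qed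
  \<comment> \<open>A common bounded support for all \<open>n\<close>, for dominated convergence.\<close>
  have qbig: "q n w = 0" if "w \<notin> cball 0 (s + 1)" for n w
  proof (rule qout)
    have "(s + 1)\<^sup>2 \<le> (norm w)\<^sup>2" using that s by (intro power_mono) auto
    then have "1 \<le> (norm w)\<^sup>2 - s\<^sup>2" using s by (simp add: power2_sum)
    moreover have "1 / real (Suc n) \<le> 1" by simp
    ultimately show "1 / real (Suc n) \<le> (norm w)\<^sup>2 - s\<^sup>2" by linarith
  qed
  have "(\<lambda>n. LINT w|lborel. of_real (q n w) * F w) \<longlonglongrightarrow> (LINT w|lborel. indicator (cball 0 s) w *\<^sub>R F w)"
  proof (rule integral_dominated_convergence[where w = "\<lambda>w. indicator (cball 0 (s + 1)) w * norm (F w)"])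
    show "(\<lambda>w. indicator (cball 0 s) w *\<^sub>R F w) \<in> borel_measurable lborel"
      using Fm by (intro borel_measurable_scaleR borel_measurable_indicator) auto
    show "(\<lambda>w. of_real (q n w) * F w) \<in> borel_measurable lborel" for n
    proof -
      have "continuous_on UNIV (\<lambda>w. complex_of_real (q n w) * F w)"
        by (rule continuous_on_mult[OF continuous_on_of_real[OF qc] F])
      then show ?thesis using borel_measurable_continuous_onI by simp
    qed
    have "integrable lborel (\<lambda>x. norm (indicator (cball 0 (s + 1)) x *\<^sub>R F x))"
      by (intro integrable_norm integrable_indicator_bounded[OF Fm, of _ "s + 1" B]) (use B in auto)
    then show "integrable lborel (\<lambda>w. indicator (cball 0 (s + 1)) w * norm (F w))" by simp
    show "AE w in lborel. (\<lambda>n. of_real (q n w) * F w) \<longlonglongrightarrow> indicator (cball 0 s) w *\<^sub>R F w"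
    proof (rule AE_I2)
      fix w :: 'a
      have "\<forall>\<^sub>F n in sequentially. of_real (q n w) * F w = indicator (cball 0 s) w *\<^sub>R F w"
      proof (cases "norm w \<le> s")
        case True
        then have "(norm w)\<^sup>2 \<le> s\<^sup>2" by (intro power_mono) auto
        then have nonneg: "s\<^sup>2 - (norm w)\<^sup>2 \<ge> 0" by simp
        have pos: "trunc_power 1 a = a" if "a \<ge> 0" for a using that by (simp add: trunc_power_def)
        have "q n w = 1" for n
          unfolding q_def using nonneg pos[OF nonneg]
            pos[of "s\<^sup>2 - (norm w)\<^sup>2 + 1 / real (Suc n)"] by simp
        then show ?thesis using True by simp
      next
        case False
        then have "s\<^sup>2 < (norm w)\<^sup>2" using s by (intro power_strict_mono) auto
        then have "\<forall>\<^sub>F n in sequentially. 1 / real (Suc n) < (norm w)\<^sup>2 - s\<^sup>2"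
          using order_tendstoD(2)[OF LIMSEQ_inverse_real_of_nat, of "(norm w)\<^sup>2 - s\<^sup>2"]
          by (simp add: inverse_eq_divide)
        then show ?thesis
          by eventually_elim (use False qout in auto)
      qed
      then show "(\<lambda>n. of_real (q n w) * F w) \<longlonglongrightarrow> indicator (cball 0 s) w *\<^sub>R F w"
        by (rule tendsto_eventually)
    qed
    show "AE w in lborel. norm (of_real (q n w) * F w) \<le> indicator (cball 0 (s + 1)) w * norm (F w)" for n
    proof (rule AE_I2)
      fix w :: 'a
      show "norm (of_real (q n w) * F w) \<le> indicator (cball 0 (s + 1)) w * norm (F w)"
        using q01[of n w] qbig[of w n] by (auto simp: indicator_def norm_mult mult_left_le_one_le)
    qed
  qed
  moreover have "(LINT w|lborel. of_real (q n w) * F w) = 0" for n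
  proof -
    have int: "integrable lborel (\<lambda>w. of_real (trunc_power 1 (\<rho> - (norm w)\<^sup>2)) * F w)" for \<rho>
    proof (rule integrable_compact_support[of _ "\<bar>\<rho>\<bar> + 1"])
      show "continuous_on UNIV (\<lambda>w. of_real (trunc_power 1 (\<rho> - (norm w)\<^sup>2)) * F w)"
        by (intro continuous_intros F)
    qed (rule vanishes_outside_trunc_power, simp)
    have "(LINT w|lborel. of_real (q n w) * F w) = (LINT w|lborel. of_real (real (Suc n)) *
        (of_real (trunc_power 1 ((s\<^sup>2 + 1 / real (Suc n)) - (norm w)\<^sup>2)) * F w
         - of_real (trunc_power 1 (s\<^sup>2 - (norm w)\<^sup>2)) * F w))"
      by (intro Bochner_Integration.integral_cong refl) (simp add: q_def algebra_simps)
    also have "\<dots> = 0"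
      by (simp only: integral_mult_right_zero Bochner_Integration.integral_diff[OF int int] trunc) simp
    finally show ?thesis .
  qed
  ultimately show ?thesis
    by (simp add: LIMSEQ_const_iff)
qed

text \<open>
  The converse passage: integrals over all balls vanish by the preceding lemma, hence those over
  annuli, and thin annuli around the sphere recover the mean.
\<close>

lemma sphere_mean_eq_0_if_trunc_integrals_0:
  fixes F :: "'a::euclidean_space \<Rightarrow> complex"
  assumes F: "continuous_on UNIV F"
    and trunc: "\<And>\<rho>. (LINT w|lborel. of_real (trunc_power 1 (\<rho> - (norm w)\<^sup>2)) * F w) = 0"
    and r: "r > 0"
  shows "sphere_mean r F = 0"
proof -
  have "norm (sphere_mean r F) \<le> e" if e: "e > 0" for e
  proof -
    have "uniformly_continuous_on (cball 0 (r + 1)) F"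
      by (intro compact_uniformly_continuous continuous_on_subset[OF F]) auto
    then obtain d where d: "d > 0"
      "\<And>x y. x \<in> cball 0 (r + 1) \<Longrightarrow> y \<in> cball 0 (r + 1) \<Longrightarrow> dist x y < d \<Longrightarrow> dist (F x) (F y) < e"
      unfolding uniformly_continuous_on_def using e by meson
    define h where "h = min 1 (d / 2)"
    have h: "0 < h" "h < d" "h \<le> 1" using d(1) by (auto simp: h_def)
    define V where "V = measure lborel (cball (0::'a) (r + h)) - measure lborel (cball (0::'a) r)"
    have close: "norm (F w - F ((r / norm w) *\<^sub>R w)) \<le> e" if w: "r < norm w" "norm w \<le> r + h" for w
    proof -
      have w0: "norm w > 0" using w(1) r by linarith
      have "dist w ((r / norm w) *\<^sub>R w) = \<bar>norm w - r\<bar>"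
        using w0 by (intro dist_radial_projection) auto
      also have "\<dots> < d" using w h by (simp add: algebra_simps)
      finally have dist: "dist w ((r / norm w) *\<^sub>R w) < d" .
      have "norm ((r / norm w) *\<^sub>R w) = r" using w0 r by simp
      then show ?thesis
        using d(2)[OF _ _ dist] w(2) h r unfolding dist_norm mem_cball_0 by linarith
    qed
    have "V > 0"
    proof -
      have "r ^ DIM('a) < (r + h) ^ DIM('a)" using r h by (intro power_strict_mono) auto
      moreover have "unit_ball_vol DIM('a) > 0" by simp
      ultimately show ?thesis using r h by (simp add: V_def content_cball)
    qed
    have "norm ((LINT x|lborel. indicator (cball 0 (r + h)) x *\<^sub>R F x)
        - (LINT x|lborel. indicator (cball 0 r) x *\<^sub>R F x) - V *\<^sub>R sphere_mean r F) \<le> e * V"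
      unfolding V_def
    proof (rule norm_annulus_integral_minus_mean_le[OF F r])
      show "0 \<le> r" "r \<le> r + h" using r h by auto
    qed (rule close)
    moreover have "(LINT x|lborel. indicator (cball 0 s) x *\<^sub>R F x) = 0" if "s > 0" for s
      by (rule cball_integral_eq_0_if_trunc_integrals_0[OF F _ that]) (rule trunc)
    ultimately have "norm (V *\<^sub>R sphere_mean r F) \<le> e * V"
      using r h by simp
    then show ?thesis using \<open>V > 0\<close> by simp
  qed
  then have "norm (sphere_mean r F) \<le> 0"
    using field_le_epsilon[of "norm (sphere_mean r F)" 0] by simp
  then show ?thesis by simp
qed

section \<open>Integrals against truncated powers\<close>

definition trunc_integral :: "nat \<Rightarrow> real \<Rightarrow> ('a::euclidean_space \<Rightarrow> complex) \<Rightarrow> complex" where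
  "trunc_integral m \<rho> F = (LINT w|lborel. of_real (trunc_power m (\<rho> - (norm w)\<^sup>2)) * F w)"

lemma integrable_trunc_power_mult:
  fixes F :: "'a::euclidean_space \<Rightarrow> complex"
  assumes "m \<ge> 1" "continuous_on UNIV F"
  shows "integrable lborel (\<lambda>w. of_real (trunc_power m (\<rho> - (norm w)\<^sup>2)) * F w)"
  by (rule integrable_compact_support[OF _ vanishes_outside_trunc_power])
     (intro continuous_intros assms)+

lemma trunc_integral_cmult: "trunc_integral m \<rho> (\<lambda>w. c * F w) = c * trunc_integral m \<rho> F"
  by (simp add: trunc_integral_def mult.left_commute)

lemma trunc_integral_0 [simp]: "trunc_integral m \<rho> (\<lambda>w. 0) = 0"
  by (simp add: trunc_integral_def)

lemma trunc_integral_uminus: "trunc_integral m \<rho> (\<lambda>w. - F w) = - trunc_integral m \<rho> F"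
  using trunc_integral_cmult[of m \<rho> "-1" F] by simp

lemma trunc_integral_add:
  assumes "m \<ge> 1" "continuous_on UNIV F" "continuous_on UNIV G"
  shows "trunc_integral m \<rho> (\<lambda>w. F w + G w) = trunc_integral m \<rho> F + trunc_integral m \<rho> G"
  using assms by (simp add: trunc_integral_def distrib_left integrable_trunc_power_mult)

lemma trunc_integral_diff:
  assumes "m \<ge> 1" "continuous_on UNIV F" "continuous_on UNIV G"
  shows "trunc_integral m \<rho> (\<lambda>w. F w - G w) = trunc_integral m \<rho> F - trunc_integral m \<rho> G"
  using assms by (simp add: trunc_integral_def right_diff_distrib integrable_trunc_power_mult)

lemma trunc_integral_sum:
  assumes "m \<ge> 1" "\<And>i. i \<in> A \<Longrightarrow> continuous_on UNIV (F i)"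
  shows "trunc_integral m \<rho> (\<lambda>w. \<Sum>i\<in>A. F i w) = (\<Sum>i\<in>A. trunc_integral m \<rho> (F i))"
  using assms by (simp add: trunc_integral_def sum_distrib_left integrable_trunc_power_mult)

lemma trunc_integral_has_derivative:
  assumes m: "m \<ge> 1" and F: "continuous_on UNIV F"
  shows "((\<lambda>\<rho>. trunc_integral (Suc m) \<rho> F) has_vector_derivative trunc_integral m \<rho> F) (at \<rho>)"
  unfolding trunc_integral_def
proof (rule leibniz_compact_support[where U = "{\<rho> - 1<..<\<rho> + 1}" and R = "\<bar>\<rho>\<bar> + 2"])
  fix t u assume t: "t \<in> {\<rho> - 1<..<\<rho> + 1}"
  show "((\<lambda>t. of_real (trunc_power (Suc m) (t - (norm u)\<^sup>2)) * F u) has_vector_derivative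
      of_real (trunc_power m (t - (norm u)\<^sup>2)) * F u) (at t)"
  proof -
    have "((\<lambda>t. t - (norm u)\<^sup>2) has_real_derivative 1) (at t)"
      by (auto intro!: derivative_eq_intros)
    from has_vector_derivative_mult_left[OF has_vector_derivative_trunc_power_compose[OF m this], of "F u"]
    show ?thesis by simp
  qed
  have "\<bar>t\<bar> + 1 \<le> \<bar>\<rho>\<bar> + 2" using t by auto
  then show "vanishes_outside (\<bar>\<rho>\<bar> + 2) (\<lambda>u. of_real (trunc_power (Suc m) (t - (norm u)\<^sup>2)) * F u)"
    using vanishes_outside_trunc_power[of "Suc m" t F] by (auto simp: vanishes_outside_def)
  show "continuous_on UNIV (\<lambda>u. of_real (trunc_power (Suc m) (t - (norm u)\<^sup>2)) * F u)"
    by (intro continuous_intros F)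
next
  show "continuous_on ({\<rho> - 1<..<\<rho> + 1} \<times> UNIV)
      (\<lambda>(t, u). of_real (trunc_power m (t - (norm u)\<^sup>2)) * F u)"
    unfolding split_beta
    by (intro continuous_intros continuous_on_compose2[OF F]) auto
qed auto

text \<open>
  The integral of the product \<open>trunc_power (Suc m) (\<rho> - (norm w)^2) * G w\<close> does not change when
  \<open>w\<close> is translated along \<open>e\<close>. The derivative of the translate is therefore 0, which is the
  asserted identity, because the weight has the derivative
  \<open>- 2 * (w \<bullet> e) * trunc_power m (\<rho> - (norm w)^2)\<close> along \<open>e\<close>.
\<close>

lemma trunc_integral_by_parts:
  assumes m: "m \<ge> 1" and G: "continuous_on UNIV G" "continuous_on UNIV G'"
    and der: "\<And>w t. ((\<lambda>t. G (w + t *\<^sub>R e)) has_vector_derivative G' (w + t *\<^sub>R e)) (at t)"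
  shows "trunc_integral m \<rho> (\<lambda>w. of_real (2 * (w \<bullet> e)) * G w) = trunc_integral (Suc m) \<rho> G'"
proof -
  \<comment> \<open>\<open>f\<close> is the translated integrand and \<open>f'\<close> its derivative in \<open>t\<close>.\<close>
  define f where "f t w = of_real (trunc_power (Suc m) (\<rho> - (norm (w + t *\<^sub>R e))\<^sup>2)) * G (w + t *\<^sub>R e)" for t w
  define f' where "f' t w = of_real (trunc_power (Suc m) (\<rho> - (norm (w + t *\<^sub>R e))\<^sup>2)) * G' (w + t *\<^sub>R e)
    + of_real (trunc_power m (\<rho> - (norm (w + t *\<^sub>R e))\<^sup>2) * - (2 * ((w + t *\<^sub>R e) \<bullet> e))) * G (w + t *\<^sub>R e)" for t w
  have "((\<lambda>t. integral\<^sup>L lborel (f t)) has_vector_derivative integral\<^sup>L lborel (f' 0)) (at 0)"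
  proof (rule leibniz_compact_support[where U = "{-1<..<1}" and R = "\<bar>\<rho>\<bar> + 1 + norm e"])
    fix t :: real and u assume t: "t \<in> {-1<..<1}"
    have "((\<lambda>t. \<rho> - (norm (u + t *\<^sub>R e))\<^sup>2) has_real_derivative - (2 * ((u + t *\<^sub>R e) \<bullet> e))) (at t)"
      unfolding power2_norm_eq_inner
      by (auto intro!: derivative_eq_intros simp: inner_add_left inner_add_right inner_commute algebra_simps)
    then have "((\<lambda>t. complex_of_real (trunc_power (Suc m) (\<rho> - (norm (u + t *\<^sub>R e))\<^sup>2))) has_vector_derivative
        of_real (trunc_power m (\<rho> - (norm (u + t *\<^sub>R e))\<^sup>2) * - (2 * ((u + t *\<^sub>R e) \<bullet> e)))) (at t)"
      by (rule has_vector_derivative_trunc_power_compose[OF m])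
    from has_vector_derivative_mult[OF this der]
    show "((\<lambda>t. f t u) has_vector_derivative f' t u) (at t)"
      unfolding f_def f'_def .
    show "continuous_on UNIV (f t)"
      unfolding f_def
      by (intro continuous_intros continuous_on_compose2[OF G(1)]) auto
    show "vanishes_outside (\<bar>\<rho>\<bar> + 1 + norm e) (f t)"
      unfolding vanishes_outside_def f_def
    proof (intro allI impI)
      fix w :: 'a assume w: "\<bar>\<rho>\<bar> + 1 + norm e < norm w"
      have "norm (t *\<^sub>R e) \<le> norm e" using t by (auto simp: mult_left_le_one_le)
      then have "\<bar>\<rho>\<bar> + 1 < norm (w + t *\<^sub>R e)"
        using norm_triangle_ineq4[of "w + t *\<^sub>R e" "t *\<^sub>R e"] w by simp
      then show "of_real (trunc_power (Suc m) (\<rho> - (norm (w + t *\<^sub>R e))\<^sup>2)) * G (w + t *\<^sub>R e) = 0"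
        using vanishes_outside_trunc_power[of "Suc m" \<rho> G] by (auto simp: vanishes_outside_def)
    qed
  next
    show "continuous_on ({-1<..<1} \<times> UNIV) (\<lambda>(t, u). f' t u)"
      unfolding split_beta f'_def
      by (intro continuous_intros continuous_on_compose2[OF G(1)] continuous_on_compose2[OF G(2)]) auto
  qed auto
  moreover have "integral\<^sup>L lborel (f t) = trunc_integral (Suc m) \<rho> G" for t
  proof -
    have "(LINT w|lborel. of_real (trunc_power (Suc m) (\<rho> - (norm (t *\<^sub>R e + w))\<^sup>2)) * G (t *\<^sub>R e + w))
        = trunc_integral (Suc m) \<rho> G"
      unfolding trunc_integral_def
      by (rule lborel_integral_translate[of "\<lambda>w. of_real (trunc_power (Suc m) (\<rho> - (norm w)\<^sup>2)) * G w"])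
         (rule borel_measurable_continuous_onI, intro continuous_intros G)
    then show ?thesis by (simp add: f_def[abs_def] add.commute)
  qed
  ultimately have "((\<lambda>t::real. trunc_integral (Suc m) \<rho> G) has_vector_derivative integral\<^sup>L lborel (f' 0)) (at 0)"
    by simp
  then have "integral\<^sup>L lborel (f' 0) = 0"
    using vector_derivative_unique_at[OF _ has_vector_derivative_const] by blast
  moreover have "integral\<^sup>L lborel (f' 0) =
      trunc_integral (Suc m) \<rho> G' - trunc_integral m \<rho> (\<lambda>w. of_real (2 * (w \<bullet> e)) * G w)"
  proof -
    have "f' 0 = (\<lambda>w. of_real (trunc_power (Suc m) (\<rho> - (norm w)\<^sup>2)) * G' w
        - of_real (trunc_power m (\<rho> - (norm w)\<^sup>2)) * (of_real (2 * (w \<bullet> e)) * G w))"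
      by (simp add: f'_def fun_eq_iff)
    moreover have "integrable lborel (\<lambda>w. of_real (trunc_power m (\<rho> - (norm w)\<^sup>2)) * (of_real (2 * (w \<bullet> e)) * G w))"
      by (rule integrable_trunc_power_mult[OF m]) (intro continuous_intros G)
    moreover have "integrable lborel (\<lambda>w. of_real (trunc_power (Suc m) (\<rho> - (norm w)\<^sup>2)) * G' w)"
      by (rule integrable_trunc_power_mult[OF _ G(2)]) simp
    ultimately show ?thesis by (simp only: trunc_integral_def Bochner_Integration.integral_diff)
  qed
  ultimately show ?thesis by simp
qed

section \<open>Wirtinger calculus along lines\<close>

text \<open>
  The derivative along every real line is the complex-linear form \<open>D\<close> plus the antilinear form
  \<open>E\<close>. Derivatives along lines suffice: they determine the Wirtinger derivatives, they obey the
  usual rules of calculus, and they are what integration by parts and differentiation along a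
  path use.
\<close>

definition has_wirtinger ::
    "(complex ^ 'n \<Rightarrow> complex) \<Rightarrow> ('n \<Rightarrow> complex ^ 'n \<Rightarrow> complex) \<Rightarrow> ('n \<Rightarrow> complex ^ 'n \<Rightarrow> complex) \<Rightarrow> bool" where
  "has_wirtinger f D E \<longleftrightarrow> (\<forall>a b t. ((\<lambda>t. f (a + t *\<^sub>R b)) has_vector_derivative
     (\<Sum>k\<in>UNIV. b $ k * D k (a + t *\<^sub>R b) + cnj (b $ k) * E k (a + t *\<^sub>R b))) (at t))"

lemma has_wirtinger_line:
  "has_wirtinger f D E \<Longrightarrow> ((\<lambda>t. f (a + t *\<^sub>R b)) has_vector_derivative
     (\<Sum>k\<in>UNIV. b $ k * D k (a + t *\<^sub>R b) + cnj (b $ k) * E k (a + t *\<^sub>R b))) (at t)"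
  by (simp add: has_wirtinger_def)

lemma sum_axis_mult:
  fixes F :: "'n::finite \<Rightarrow> complex"
  shows "(\<Sum>k\<in>UNIV. axis j c $ k * F k) = c * F j" "(\<Sum>k\<in>UNIV. cnj (axis j c $ k) * F k) = cnj c * F j"
proof -
  have "(\<Sum>k\<in>UNIV. axis j c $ k * F k) = (\<Sum>k\<in>UNIV. if k = j then c * F k else 0)"
    "(\<Sum>k\<in>UNIV. cnj (axis j c $ k) * F k) = (\<Sum>k\<in>UNIV. if k = j then cnj c * F k else 0)"
    by (intro sum.cong refl; simp add: axis_def)+
  then show "(\<Sum>k\<in>UNIV. axis j c $ k * F k) = c * F j" "(\<Sum>k\<in>UNIV. cnj (axis j c $ k) * F k) = cnj c * F j"
    by simp_all
qed

lemma has_wirtinger_axis: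
  assumes "has_wirtinger f D E"
  shows "((\<lambda>t. f (a + t *\<^sub>R axis k 1)) has_vector_derivative
      D k (a + t *\<^sub>R axis k 1) + E k (a + t *\<^sub>R axis k 1)) (at t)"
    and "((\<lambda>t. f (a + t *\<^sub>R axis k \<i>)) has_vector_derivative
      \<i> * D k (a + t *\<^sub>R axis k \<i>) - \<i> * E k (a + t *\<^sub>R axis k \<i>)) (at t)"
  using has_wirtinger_line[OF assms, of a "axis k 1" t] has_wirtinger_line[OF assms, of a "axis k \<i>" t]
  by (simp_all only: sum.distrib sum_axis_mult) simp_all

lemma has_wirtinger_unique:
  assumes "has_wirtinger f D E"
  shows "wirtinger_z k f = D k" "wirtinger_zbar k f = E k"
proof -
  have p: "partial_x k f z = D k z + E k z" "partial_y k f z = \<i> * D k z - \<i> * E k z" for z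
    unfolding partial_x_def partial_y_def
    using has_wirtinger_axis[OF assms, of z k 0] by (simp_all add: vector_derivative_at)
  show "wirtinger_z k f = D k" "wirtinger_zbar k f = E k"
    by (simp_all add: wirtinger_z_def wirtinger_zbar_def p fun_eq_iff right_diff_distrib)
qed

lemma has_wirtinger_cong:
  "has_wirtinger f D E \<Longrightarrow> (\<And>k z. D k z = D' k z) \<Longrightarrow> (\<And>k z. E k z = E' k z) \<Longrightarrow> has_wirtinger f D' E'"
  by (simp add: has_wirtinger_def)

lemma has_wirtinger_const: "has_wirtinger (\<lambda>z. c) (\<lambda>k z. 0) (\<lambda>k z. 0)"
  by (simp add: has_wirtinger_def)

lemma has_wirtinger_component:
  "has_wirtinger (\<lambda>z::complex ^ 'n. z $ j) (\<lambda>k z. if k = j then 1 else 0) (\<lambda>k z. 0)"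
  unfolding has_wirtinger_def
proof (intro allI)
  fix a b :: "complex ^ 'n" and t :: real
  have "((\<lambda>t. a $ j + t *\<^sub>R b $ j) has_vector_derivative b $ j) (at t)"
    by (auto intro!: derivative_eq_intros)
  then show "((\<lambda>t. (a + t *\<^sub>R b) $ j) has_vector_derivative
      (\<Sum>k\<in>UNIV. b $ k * (if k = j then 1 else 0) + cnj (b $ k) * 0)) (at t)"
    by (simp add: mult_delta_right)
qed

lemma has_wirtinger_cnj_component:
  "has_wirtinger (\<lambda>z::complex ^ 'n. cnj (z $ j)) (\<lambda>k z. 0) (\<lambda>k z. if k = j then 1 else 0)"
  unfolding has_wirtinger_def
proof (intro allI)
  fix a b :: "complex ^ 'n" and t :: real
  have "((\<lambda>t. cnj (a $ j) + t *\<^sub>R cnj (b $ j)) has_vector_derivative cnj (b $ j)) (at t)"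
    by (auto intro!: derivative_eq_intros)
  then show "((\<lambda>t. cnj ((a + t *\<^sub>R b) $ j)) has_vector_derivative
      (\<Sum>k\<in>UNIV. b $ k * 0 + cnj (b $ k) * (if k = j then 1 else 0))) (at t)"
    by (simp add: mult_delta_right)
qed

lemma has_wirtinger_add:
  fixes f :: "complex ^ 'n \<Rightarrow> complex"
  assumes "has_wirtinger f D E" "has_wirtinger g D' E'"
  shows "has_wirtinger (\<lambda>z. f z + g z) (\<lambda>k z. D k z + D' k z) (\<lambda>k z. E k z + E' k z)"
  unfolding has_wirtinger_def
proof (intro allI)
  fix a b :: "complex ^ 'n" and t :: real
  show "((\<lambda>t. f (a + t *\<^sub>R b) + g (a + t *\<^sub>R b)) has_vector_derivative
      (\<Sum>k\<in>UNIV. b $ k * (D k (a + t *\<^sub>R b) + D' k (a + t *\<^sub>R b)) +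
        cnj (b $ k) * (E k (a + t *\<^sub>R b) + E' k (a + t *\<^sub>R b)))) (at t)"
    using has_vector_derivative_add[OF has_wirtinger_line[OF assms(1), of a b t] has_wirtinger_line[OF assms(2), of a b t]]
    by (simp add: sum.distrib algebra_simps)
qed

lemma has_wirtinger_mult:
  fixes f :: "complex ^ 'n \<Rightarrow> complex"
  assumes "has_wirtinger f D E" "has_wirtinger g D' E'"
  shows "has_wirtinger (\<lambda>z. f z * g z) (\<lambda>k z. f z * D' k z + D k z * g z) (\<lambda>k z. f z * E' k z + E k z * g z)"
  unfolding has_wirtinger_def
proof (intro allI)
  fix a b :: "complex ^ 'n" and t :: real
  show "((\<lambda>t. f (a + t *\<^sub>R b) * g (a + t *\<^sub>R b)) has_vector_derivative
      (\<Sum>k\<in>UNIV. b $ k * (f (a + t *\<^sub>R b) * D' k (a + t *\<^sub>R b) + D k (a + t *\<^sub>R b) * g (a + t *\<^sub>R b)) +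
        cnj (b $ k) * (f (a + t *\<^sub>R b) * E' k (a + t *\<^sub>R b) + E k (a + t *\<^sub>R b) * g (a + t *\<^sub>R b)))) (at t)"
    using has_vector_derivative_mult[OF has_wirtinger_line[OF assms(1), of a b t] has_wirtinger_line[OF assms(2), of a b t]]
    by (simp add: sum.distrib sum_distrib_left sum_distrib_right algebra_simps)
qed

lemma has_wirtinger_sum:
  assumes "\<And>i. i \<in> A \<Longrightarrow> has_wirtinger (f i) (D i) (E i)"
  shows "has_wirtinger (\<lambda>z. \<Sum>i\<in>A. f i z) (\<lambda>k z. \<Sum>i\<in>A. D i k z) (\<lambda>k z. \<Sum>i\<in>A. E i k z)"
  using assms
  by (induction A rule: infinite_finite_induct) (auto intro: has_wirtinger_const has_wirtinger_add)

lemma has_wirtinger_cmult: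
  "has_wirtinger f D E \<Longrightarrow> has_wirtinger (\<lambda>z. c * f z) (\<lambda>k z. c * D k z) (\<lambda>k z. c * E k z)"
  by (rule has_wirtinger_cong[OF has_wirtinger_mult[OF has_wirtinger_const]]) auto

lemma has_wirtinger_affine:
  fixes f :: "complex ^ 'n \<Rightarrow> complex"
  assumes "has_wirtinger f D E"
  shows "has_wirtinger (\<lambda>w. f (z - s *\<^sub>R w)) (\<lambda>k w. - (of_real s * D k (z - s *\<^sub>R w))) (\<lambda>k w. - (of_real s * E k (z - s *\<^sub>R w)))"
  unfolding has_wirtinger_def
proof (intro allI)
  fix a b :: "complex ^ 'n" and t :: real
  have *: "z - s *\<^sub>R (a + t *\<^sub>R b) = (z - s *\<^sub>R a) + t *\<^sub>R (- (s *\<^sub>R b))" for t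
    by (simp add: algebra_simps)
  show "((\<lambda>t. f (z - s *\<^sub>R (a + t *\<^sub>R b))) has_vector_derivative
      (\<Sum>k\<in>UNIV. b $ k * - (of_real s * D k (z - s *\<^sub>R (a + t *\<^sub>R b))) +
        cnj (b $ k) * - (of_real s * E k (z - s *\<^sub>R (a + t *\<^sub>R b))))) (at t)"
    unfolding *
    by (rule has_vector_derivative_eq_rhs[OF has_wirtinger_line[OF assms]])
       (auto intro!: sum.cong simp: scaleR_conv_of_real[where 'a=complex])
qed

lemma has_wirtinger_exp:
  fixes f :: "complex ^ 'n \<Rightarrow> complex"
  assumes "has_wirtinger f D E"
  shows "has_wirtinger (\<lambda>z. exp (f z)) (\<lambda>k z. D k z * exp (f z)) (\<lambda>k z. E k z * exp (f z))"
  unfolding has_wirtinger_def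
proof (intro allI)
  fix a b :: "complex ^ 'n" and t :: real
  from has_wirtinger_line[OF assms, of a b t]
  have "((\<lambda>t. exp (f (a + t *\<^sub>R b))) has_vector_derivative
      (\<Sum>k\<in>UNIV. b $ k * D k (a + t *\<^sub>R b) + cnj (b $ k) * E k (a + t *\<^sub>R b)) * exp (f (a + t *\<^sub>R b))) (at t)"
    using field_vector_diff_chain_at[of "\<lambda>t. f (a + t *\<^sub>R b)" _ t exp "exp (f (a + t *\<^sub>R b))"]
    by (simp add: o_def DERIV_exp)
  then show "((\<lambda>t. exp (f (a + t *\<^sub>R b))) has_vector_derivative
      (\<Sum>k\<in>UNIV. b $ k * (D k (a + t *\<^sub>R b) * exp (f (a + t *\<^sub>R b))) +
        cnj (b $ k) * (E k (a + t *\<^sub>R b) * exp (f (a + t *\<^sub>R b))))) (at t)"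
    by (simp add: sum_distrib_left algebra_simps)
qed

lemma has_wirtinger_hermitian_right:
  "has_wirtinger (\<lambda>w. hermitian_product z w) (\<lambda>k w. 0) (\<lambda>k w. z $ k)"
proof -
  have "has_wirtinger (\<lambda>w. \<Sum>j\<in>UNIV. z $ j * cnj (w $ j)) (\<lambda>k w. \<Sum>j\<in>UNIV. z $ j * 0) (\<lambda>k w. \<Sum>j\<in>UNIV. z $ j * (if k = j then 1 else 0))"
    by (intro has_wirtinger_sum has_wirtinger_cmult has_wirtinger_cnj_component)
  then have "has_wirtinger (\<lambda>w. \<Sum>j\<in>UNIV. z $ j * cnj (w $ j)) (\<lambda>k w. 0) (\<lambda>k w. z $ k)"
    by (rule has_wirtinger_cong) (simp_all add: mult_delta_right)
  then show ?thesis by (simp add: hermitian_product_def[abs_def])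
qed

text \<open>
  Complex form of integration by parts: the real identities for the directions \<open>axis k 1\<close> and
  \<open>axis k \<i>\<close>, combined with coefficients \<open>1\<close> and \<open>\<mp> \<i>\<close>.
\<close>

lemma trunc_integral_by_parts_wirtinger:
  fixes G :: "complex ^ 'n \<Rightarrow> complex"
  assumes m: "m \<ge> 1" and G: "continuous_on UNIV G" "continuous_on UNIV (D k)" "continuous_on UNIV (E k)"
    and w: "has_wirtinger G D E"
  shows "trunc_integral m \<rho> (\<lambda>w. cnj (w $ k) * G w) = trunc_integral (Suc m) \<rho> (D k)"
    and "trunc_integral m \<rho> (\<lambda>w. w $ k * G w) = trunc_integral (Suc m) \<rho> (E k)"
proof -
  have inner: "w \<bullet> axis k 1 = Re (w $ k)" "w \<bullet> axis k \<i> = Im (w $ k)" for w :: "complex ^ 'n"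
    by (simp_all add: inner_axis inner_complex_def)
  have x: "trunc_integral m \<rho> (\<lambda>w. of_real (2 * Re (w $ k)) * G w) = trunc_integral (Suc m) \<rho> (\<lambda>w. D k w + E k w)"
    unfolding inner[symmetric]
    by (rule trunc_integral_by_parts[OF m G(1) _ has_wirtinger_axis(1)[OF w]]) (intro continuous_intros G)
  have y: "trunc_integral m \<rho> (\<lambda>w. of_real (2 * Im (w $ k)) * G w) = trunc_integral (Suc m) \<rho> (\<lambda>w. \<i> * D k w - \<i> * E k w)"
    unfolding inner[symmetric]
    by (rule trunc_integral_by_parts[OF m G(1) _ has_wirtinger_axis(2)[OF w]]) (intro continuous_intros G)
  have cG: "continuous_on UNIV (\<lambda>w. of_real (2 * Re (w $ k)) * G w)" "continuous_on UNIV (\<lambda>w. of_real (2 * Im (w $ k)) * G w)"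
    by (intro continuous_intros G)+
  have lin: "trunc_integral m \<rho> (\<lambda>w. of_real (2 * Re (w $ k)) * G w + c * (of_real (2 * Im (w $ k)) * G w)) =
      (1 + c * \<i>) * trunc_integral (Suc m) \<rho> (D k) + (1 - c * \<i>) * trunc_integral (Suc m) \<rho> (E k)" for c
  proof -
    have "trunc_integral m \<rho> (\<lambda>w. of_real (2 * Re (w $ k)) * G w + c * (of_real (2 * Im (w $ k)) * G w)) =
        trunc_integral (Suc m) \<rho> (\<lambda>w. D k w + E k w) + c * trunc_integral (Suc m) \<rho> (\<lambda>w. \<i> * D k w - \<i> * E k w)"
      by (subst trunc_integral_add[OF m]) (intro continuous_intros cG | simp only: trunc_integral_cmult x y)+
    also have "trunc_integral (Suc m) \<rho> (\<lambda>w. D k w + E k w) = trunc_integral (Suc m) \<rho> (D k) + trunc_integral (Suc m) \<rho> (E k)"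
      by (rule trunc_integral_add) (simp_all add: G)
    also have "trunc_integral (Suc m) \<rho> (\<lambda>w. \<i> * D k w - \<i> * E k w) = trunc_integral (Suc m) \<rho> (\<lambda>w. \<i> * D k w) - trunc_integral (Suc m) \<rho> (\<lambda>w. \<i> * E k w)"
      by (rule trunc_integral_diff) (auto intro!: continuous_intros G)
    finally show ?thesis by (simp add: trunc_integral_cmult algebra_simps)
  qed
  have "2 * (cnj (w $ k) * G w) = of_real (2 * Re (w $ k)) * G w + (- \<i>) * (of_real (2 * Im (w $ k)) * G w)"
    "2 * (w $ k * G w) = of_real (2 * Re (w $ k)) * G w + \<i> * (of_real (2 * Im (w $ k)) * G w)" for w
    by (auto simp: complex_eq_iff algebra_simps)
  then have "2 * trunc_integral m \<rho> (\<lambda>w. cnj (w $ k) * G w) = 2 * trunc_integral (Suc m) \<rho> (D k)"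
    "2 * trunc_integral m \<rho> (\<lambda>w. w $ k * G w) = 2 * trunc_integral (Suc m) \<rho> (E k)"
    unfolding trunc_integral_cmult[symmetric, of 2 m] using lin[of "- \<i>"] lin[of \<i>] by simp_all
  then show "trunc_integral m \<rho> (\<lambda>w. cnj (w $ k) * G w) = trunc_integral (Suc m) \<rho> (D k)"
    "trunc_integral m \<rho> (\<lambda>w. w $ k * G w) = trunc_integral (Suc m) \<rho> (E k)"
    by simp_all
qed

section \<open>Bihomogeneous polynomials\<close>

text \<open>
  Inductive description of the bihomogeneous polynomials of bidegree \<open>(p, q)\<close>. Induction along it
  replaces calculations with multi-indices: the Wirtinger derivatives of a generator are given by
  the product rule.
\<close>

inductive bipoly :: "nat \<Rightarrow> nat \<Rightarrow> (complex ^ 'n \<Rightarrow> complex) \<Rightarrow> bool" where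
  const: "bipoly 0 0 (\<lambda>z. c)"
| component_mult: "bipoly p q f \<Longrightarrow> bipoly (Suc p) q (\<lambda>z. z $ k * f z)"
| cnj_mult: "bipoly p q f \<Longrightarrow> bipoly p (Suc q) (\<lambda>z. cnj (z $ k) * f z)"
| add: "bipoly p q f \<Longrightarrow> bipoly p q g \<Longrightarrow> bipoly p q (\<lambda>z. f z + g z)"

lemma bipoly_cmult: "bipoly p q f \<Longrightarrow> bipoly p q (\<lambda>z. c * f z)"
proof (induction rule: bipoly.induct)
  case (const d)
  then show ?case using bipoly.const[of "c * d"] by simp
next
  case (component_mult p q f k)
  then show ?case using bipoly.component_mult[OF component_mult.IH, of k] by (simp add: mult.left_commute)
next
  case (cnj_mult p q f k)
  then show ?case using bipoly.cnj_mult[OF cnj_mult.IH, of k] by (simp add: mult.left_commute)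
next
  case (add p q f g)
  then show ?case using bipoly.add[OF add.IH] by (simp add: distrib_left)
qed

lemma bipoly_0: "bipoly p q (\<lambda>z. 0)"
proof (induction p)
  case 0
  show ?case
    by (induction q) (use bipoly.const[of 0] bipoly.cnj_mult[of 0 _ "\<lambda>z. 0"] in auto)
next
  case (Suc p)
  then show ?case using bipoly.component_mult[of p q "\<lambda>z. 0"] by simp
qed

lemma bipoly_sum: "(\<And>i. i \<in> A \<Longrightarrow> bipoly p q (f i)) \<Longrightarrow> bipoly p q (\<lambda>z. \<Sum>i\<in>A. f i z)"
  by (induction A rule: infinite_finite_induct) (auto intro: bipoly_0 bipoly.add)

lemma bipoly_mult: "bipoly p q f \<Longrightarrow> bipoly p' q' g \<Longrightarrow> bipoly (p + p') (q + q') (\<lambda>z. f z * g z)"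
proof (induction rule: bipoly.induct)
  case (const c)
  then show ?case by (simp add: bipoly_cmult)
next
  case (component_mult p q f k)
  then show ?case using bipoly.component_mult[OF component_mult.IH, of k] by (simp add: mult.assoc)
next
  case (cnj_mult p q f k)
  then show ?case using bipoly.cnj_mult[OF cnj_mult.IH, of k] by (simp add: mult.assoc)
next
  case (add p q f g)
  then show ?case using bipoly.add[OF add.IH] by (simp add: distrib_right)
qed

lemma bipoly_monomial:
  fixes \<alpha> :: "'n::finite \<Rightarrow> nat"
  shows "bipoly (\<Sum>j\<in>A. \<alpha> j) 0 (\<lambda>z. \<Prod>j\<in>A. (z $ j) ^ \<alpha> j)"
    and "bipoly 0 (\<Sum>j\<in>A. \<alpha> j) (\<lambda>z. \<Prod>j\<in>A. cnj (z $ j) ^ \<alpha> j)"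
proof -
  have pow: "bipoly n 0 (\<lambda>z. (z $ j) ^ n)" "bipoly 0 n (\<lambda>z. cnj (z $ j) ^ n)" for n and j :: 'n
    by (induction n) (auto intro: bipoly.component_mult bipoly.cnj_mult simp: bipoly.const)
  show "bipoly (\<Sum>j\<in>A. \<alpha> j) 0 (\<lambda>z. \<Prod>j\<in>A. (z $ j) ^ \<alpha> j)"
  proof (induction A rule: infinite_finite_induct)
    case (insert j A)
    then show ?case using bipoly_mult[OF pow(1) insert.IH] by simp
  qed (auto simp: bipoly.const)
  show "bipoly 0 (\<Sum>j\<in>A. \<alpha> j) (\<lambda>z. \<Prod>j\<in>A. cnj (z $ j) ^ \<alpha> j)"
  proof (induction A rule: infinite_finite_induct)
    case (insert j A)
    then show ?case using bipoly_mult[OF pow(2) insert.IH] by simp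
  qed (auto simp: bipoly.const)
qed

lemma bihomogeneous_polys_sum:
  assumes "\<And>i. i \<in> A \<Longrightarrow> f i \<in> bihomogeneous_polys p q"
  shows "(\<lambda>z. \<Sum>i\<in>A. f i z) \<in> bihomogeneous_polys p q"
proof -
  have "\<forall>i\<in>A. \<exists>c. \<forall>z. f i z = (\<Sum>\<alpha>\<in>multi_indices p. \<Sum>\<beta>\<in>multi_indices q.
        c \<alpha> \<beta> * (\<Prod>j\<in>UNIV. (z $ j) ^ \<alpha> j) * (\<Prod>j\<in>UNIV. cnj (z $ j) ^ \<beta> j))"
    using assms unfolding bihomogeneous_polys_def mem_Collect_eq by (rule ballI)
  from bchoice[OF this] obtain c where "\<forall>i\<in>A. \<forall>z. f i z = (\<Sum>\<alpha>\<in>multi_indices p. \<Sum>\<beta>\<in>multi_indices q.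
        c i \<alpha> \<beta> * (\<Prod>j\<in>UNIV. (z $ j) ^ \<alpha> j) * (\<Prod>j\<in>UNIV. cnj (z $ j) ^ \<beta> j))"
    by (elim exE)
  note c = this[rule_format]
  have "(\<Sum>i\<in>A. f i z) = (\<Sum>\<alpha>\<in>multi_indices p. \<Sum>\<beta>\<in>multi_indices q.
        (\<Sum>i\<in>A. c i \<alpha> \<beta>) * (\<Prod>j\<in>UNIV. (z $ j) ^ \<alpha> j) * (\<Prod>j\<in>UNIV. cnj (z $ j) ^ \<beta> j))" for z
  proof -
    have "(\<Sum>i\<in>A. f i z) = (\<Sum>i\<in>A. \<Sum>\<alpha>\<in>multi_indices p. \<Sum>\<beta>\<in>multi_indices q.
        c i \<alpha> \<beta> * (\<Prod>j\<in>UNIV. (z $ j) ^ \<alpha> j) * (\<Prod>j\<in>UNIV. cnj (z $ j) ^ \<beta> j))"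
      by (intro sum.cong refl c)
    also have "\<dots> = (\<Sum>\<alpha>\<in>multi_indices p. \<Sum>i\<in>A. \<Sum>\<beta>\<in>multi_indices q.
        c i \<alpha> \<beta> * (\<Prod>j\<in>UNIV. (z $ j) ^ \<alpha> j) * (\<Prod>j\<in>UNIV. cnj (z $ j) ^ \<beta> j))"
      by (rule sum.swap)
    also have "\<dots> = (\<Sum>\<alpha>\<in>multi_indices p. \<Sum>\<beta>\<in>multi_indices q. \<Sum>i\<in>A.
        c i \<alpha> \<beta> * (\<Prod>j\<in>UNIV. (z $ j) ^ \<alpha> j) * (\<Prod>j\<in>UNIV. cnj (z $ j) ^ \<beta> j))"
      by (intro sum.cong refl sum.swap)
    finally show ?thesis by (simp add: sum_distrib_right)
  qed
  then show ?thesis unfolding bihomogeneous_polys_def mem_Collect_eq by (intro exI allI)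
qed

lemma monomial_in_bihomogeneous_polys:
  fixes \<alpha> \<beta> :: "'n::finite \<Rightarrow> nat"
  shows "(\<lambda>z. c * (\<Prod>j\<in>UNIV. (z $ j) ^ \<alpha> j) * (\<Prod>j\<in>UNIV. cnj (z $ j) ^ \<beta> j))
    \<in> bihomogeneous_polys (\<Sum>j\<in>UNIV. \<alpha> j) (\<Sum>j\<in>UNIV. \<beta> j)" (is "?f \<in> bihomogeneous_polys ?p ?q")
proof -
  have "?f z = (\<Sum>\<alpha>'\<in>multi_indices ?p. \<Sum>\<beta>'\<in>multi_indices ?q.
        (if \<alpha>' = \<alpha> \<and> \<beta>' = \<beta> then c else 0) * (\<Prod>j\<in>UNIV. (z $ j) ^ \<alpha>' j) * (\<Prod>j\<in>UNIV. cnj (z $ j) ^ \<beta>' j))" for z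
  proof -
    have "(\<Sum>\<alpha>'\<in>multi_indices ?p. \<Sum>\<beta>'\<in>multi_indices ?q.
        (if \<alpha>' = \<alpha> \<and> \<beta>' = \<beta> then c else 0) * (\<Prod>j\<in>UNIV. (z $ j) ^ \<alpha>' j) * (\<Prod>j\<in>UNIV. cnj (z $ j) ^ \<beta>' j))
      = (\<Sum>\<alpha>'\<in>multi_indices ?p. if \<alpha>' = \<alpha> then (\<Sum>\<beta>'\<in>multi_indices ?q. if \<beta>' = \<beta> then ?f z else 0) else 0)"
      by (intro sum.cong refl) (auto intro!: sum.cong)
    also have "\<dots> = ?f z"
      by (simp add: finite_multi_indices) (simp add: multi_indices_def)
    finally show ?thesis by simp
  qed
  then show ?thesis unfolding bihomogeneous_polys_def mem_Collect_eq by (intro exI allI)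
qed

text \<open>
  Multiplication by a coordinate raises one exponent of every monomial.
\<close>

lemma bihomogeneous_polys_mult_component:
  fixes f :: "complex ^ 'n \<Rightarrow> complex"
  assumes f: "f \<in> bihomogeneous_polys p q"
  shows "(\<lambda>z. z $ k * f z) \<in> bihomogeneous_polys (Suc p) q" "(\<lambda>z. cnj (z $ k) * f z) \<in> bihomogeneous_polys p (Suc q)"
proof -
  from f obtain c where "\<forall>z. f z = (\<Sum>\<alpha>\<in>multi_indices p. \<Sum>\<beta>\<in>multi_indices q.
        c \<alpha> \<beta> * (\<Prod>j\<in>UNIV. (z $ j) ^ \<alpha> j) * (\<Prod>j\<in>UNIV. cnj (z $ j) ^ \<beta> j))"
    unfolding bihomogeneous_polys_def mem_Collect_eq by (elim exE)
  note c = this[rule_format]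
  have shift: "(\<Prod>j\<in>UNIV. x j ^ (\<alpha>(k := Suc (\<alpha> k))) j) = x k * (\<Prod>j\<in>UNIV. x j ^ \<alpha> j)"
    "(\<Sum>j\<in>UNIV. (\<alpha>(k := Suc (\<alpha> k))) j) = Suc (\<Sum>j\<in>UNIV. \<alpha> j)" for x :: "'n \<Rightarrow> complex" and \<alpha>
  proof -
    have "(\<Prod>j\<in>UNIV - {k}. x j ^ (\<alpha>(k := Suc (\<alpha> k))) j) = (\<Prod>j\<in>UNIV - {k}. x j ^ \<alpha> j)"
      by (intro prod.cong) auto
    then show "(\<Prod>j\<in>UNIV. x j ^ (\<alpha>(k := Suc (\<alpha> k))) j) = x k * (\<Prod>j\<in>UNIV. x j ^ \<alpha> j)"
      using prod.remove[of UNIV k "\<lambda>j. x j ^ (\<alpha>(k := Suc (\<alpha> k))) j"]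
        prod.remove[of UNIV k "\<lambda>j. x j ^ \<alpha> j"] by (simp only: finite UNIV_I fun_upd_same power_Suc mult.assoc)
    have "(\<Sum>j\<in>UNIV - {k}. (\<alpha>(k := Suc (\<alpha> k))) j) = (\<Sum>j\<in>UNIV - {k}. \<alpha> j)"
      by (intro sum.cong) auto
    then show "(\<Sum>j\<in>UNIV. (\<alpha>(k := Suc (\<alpha> k))) j) = Suc (\<Sum>j\<in>UNIV. \<alpha> j)"
      using sum.remove[of UNIV k "\<alpha>(k := Suc (\<alpha> k))"] sum.remove[of UNIV k \<alpha>]
      by (simp only: finite UNIV_I fun_upd_same add_Suc)
  qed
  have "(\<lambda>z. \<Sum>\<alpha>\<in>multi_indices p. \<Sum>\<beta>\<in>multi_indices q.
      c \<alpha> \<beta> * (\<Prod>j\<in>UNIV. (z $ j) ^ (\<alpha>(k := Suc (\<alpha> k))) j) * (\<Prod>j\<in>UNIV. cnj (z $ j) ^ \<beta> j))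
      \<in> bihomogeneous_polys (Suc p) q"
  proof (intro bihomogeneous_polys_sum)
    fix \<alpha> \<beta> :: "'n \<Rightarrow> nat" assume "\<alpha> \<in> multi_indices p" "\<beta> \<in> multi_indices q"
    then show "(\<lambda>z. c \<alpha> \<beta> * (\<Prod>j\<in>UNIV. (z $ j) ^ (\<alpha>(k := Suc (\<alpha> k))) j) * (\<Prod>j\<in>UNIV. cnj (z $ j) ^ \<beta> j))
        \<in> bihomogeneous_polys (Suc p) q"
      using monomial_in_bihomogeneous_polys[of "c \<alpha> \<beta>" "\<alpha>(k := Suc (\<alpha> k))" \<beta>]
      by (simp only: shift(2) multi_indices_def mem_Collect_eq)
  qed
  then show "(\<lambda>z. z $ k * f z) \<in> bihomogeneous_polys (Suc p) q"
    unfolding shift(1) c by (simp add: sum_distrib_left mult_ac)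
  have "(\<lambda>z. \<Sum>\<alpha>\<in>multi_indices p. \<Sum>\<beta>\<in>multi_indices q.
      c \<alpha> \<beta> * (\<Prod>j\<in>UNIV. (z $ j) ^ \<alpha> j) * (\<Prod>j\<in>UNIV. cnj (z $ j) ^ (\<beta>(k := Suc (\<beta> k))) j))
      \<in> bihomogeneous_polys p (Suc q)"
  proof (intro bihomogeneous_polys_sum)
    fix \<alpha> \<beta> :: "'n \<Rightarrow> nat" assume "\<alpha> \<in> multi_indices p" "\<beta> \<in> multi_indices q"
    then show "(\<lambda>z. c \<alpha> \<beta> * (\<Prod>j\<in>UNIV. (z $ j) ^ \<alpha> j) * (\<Prod>j\<in>UNIV. cnj (z $ j) ^ (\<beta>(k := Suc (\<beta> k))) j))
        \<in> bihomogeneous_polys p (Suc q)"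
      using monomial_in_bihomogeneous_polys[of "c \<alpha> \<beta>" \<alpha> "\<beta>(k := Suc (\<beta> k))"]
      by (simp only: shift(2) multi_indices_def mem_Collect_eq)
  qed
  moreover have "(\<Prod>j\<in>UNIV. cnj (z $ j) ^ (\<alpha>(k := Suc (\<alpha> k))) j) = cnj (z $ k) * (\<Prod>j\<in>UNIV. cnj (z $ j) ^ \<alpha> j)"
    for z :: "complex ^ 'n" and \<alpha>
    by (rule shift(1))
  ultimately show "(\<lambda>z. cnj (z $ k) * f z) \<in> bihomogeneous_polys p (Suc q)"
    unfolding c by (simp only:) (simp add: sum_distrib_left mult_ac)
qed

lemma bihomogeneous_polys_eq_bipoly: "bihomogeneous_polys p q = {f. bipoly p q f}"
proof (intro equalityI subsetI; unfold mem_Collect_eq)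
  fix f :: "complex ^ 'n \<Rightarrow> complex" assume "f \<in> bihomogeneous_polys p q"
  then obtain c where "\<forall>z. f z = (\<Sum>\<alpha>\<in>multi_indices p. \<Sum>\<beta>\<in>multi_indices q.
        c \<alpha> \<beta> * (\<Prod>j\<in>UNIV. (z $ j) ^ \<alpha> j) * (\<Prod>j\<in>UNIV. cnj (z $ j) ^ \<beta> j))"
    unfolding bihomogeneous_polys_def mem_Collect_eq by (elim exE)
  note c = this[rule_format]
  have "bipoly p q (\<lambda>z. \<Sum>\<alpha>\<in>multi_indices p. \<Sum>\<beta>\<in>multi_indices q.
        c \<alpha> \<beta> * (\<Prod>j\<in>UNIV. (z $ j) ^ \<alpha> j) * (\<Prod>j\<in>UNIV. cnj (z $ j) ^ \<beta> j))"
  proof (intro bipoly_sum)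
    fix \<alpha> \<beta> :: "'n \<Rightarrow> nat" assume "\<alpha> \<in> multi_indices p" "\<beta> \<in> multi_indices q"
    then show "bipoly p q (\<lambda>z. c \<alpha> \<beta> * (\<Prod>j\<in>UNIV. (z $ j) ^ \<alpha> j) * (\<Prod>j\<in>UNIV. cnj (z $ j) ^ \<beta> j))"
      using bipoly_mult[OF bipoly_cmult[OF bipoly_monomial(1)[of \<alpha> UNIV]] bipoly_monomial(2)[of \<beta> UNIV]]
      by (simp add: multi_indices_def)
  qed
  then show "bipoly p q f" by (simp add: c[abs_def])
next
  fix f :: "complex ^ 'n \<Rightarrow> complex" assume "bipoly p q f"
  then show "f \<in> bihomogeneous_polys p q"
  proof (induction rule: bipoly.induct)
    case (const c)
    then show ?case using monomial_in_bihomogeneous_polys[of c "\<lambda>_. 0" "\<lambda>_. 0"] by simp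
  next
    case (add p q f g)
    then show ?case
      using bihomogeneous_polys_sum[of "{True, False}" "\<lambda>b. if b then f else g" p q] by simp
  qed (auto intro: bihomogeneous_polys_mult_component)
qed

lemma bipoly_has_wirtinger_wirtinger:
  "bipoly p q f \<Longrightarrow> has_wirtinger f (\<lambda>k. wirtinger_z k f) (\<lambda>k. wirtinger_zbar k f)"
proof -
  have "has_wirtinger f D E \<Longrightarrow> has_wirtinger f (\<lambda>k. wirtinger_z k f) (\<lambda>k. wirtinger_zbar k f)" for D E
    using has_wirtinger_unique[of f D E] by simp
  moreover assume "bipoly p q f"
  then have "\<exists>D E. has_wirtinger f D E"
  proof (induction rule: bipoly.induct)
    case (const c)
    show ?case by (intro exI) (rule has_wirtinger_const)
  next
    case (component_mult p q f k)
    then obtain D E where "has_wirtinger f D E" by blast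
    then show ?case by (intro exI) (rule has_wirtinger_mult[OF has_wirtinger_component])
  next
    case (cnj_mult p q f k)
    then obtain D E where "has_wirtinger f D E" by blast
    then show ?case by (intro exI) (rule has_wirtinger_mult[OF has_wirtinger_cnj_component])
  next
    case (add p q f g)
    then obtain D E D' E' where "has_wirtinger f D E" "has_wirtinger g D' E'" by blast
    then show ?case by (intro exI) (rule has_wirtinger_add)
  qed
  ultimately show ?thesis by blast
qed

lemma wirtinger_const: "wirtinger_z j (\<lambda>z. c) = (\<lambda>z. 0)" "wirtinger_zbar j (\<lambda>z. c) = (\<lambda>z. 0)"
  by (rule has_wirtinger_unique[OF has_wirtinger_const])+

context
  fixes p q :: nat and f :: "complex ^ 'n \<Rightarrow> complex"
  assumes f: "bipoly p q f"
begin

lemma wirtinger_component_mult: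
  "wirtinger_z j (\<lambda>z. z $ k * f z) = (\<lambda>z. (if j = k then 1 else 0) * f z + z $ k * wirtinger_z j f z)"
  "wirtinger_zbar j (\<lambda>z. z $ k * f z) = (\<lambda>z. z $ k * wirtinger_zbar j f z)"
  using has_wirtinger_unique[OF has_wirtinger_mult[OF has_wirtinger_component bipoly_has_wirtinger_wirtinger[OF f]], of j k]
  by (simp_all add: add.commute)

lemma wirtinger_cnj_mult:
  "wirtinger_z j (\<lambda>z. cnj (z $ k) * f z) = (\<lambda>z. cnj (z $ k) * wirtinger_z j f z)"
  "wirtinger_zbar j (\<lambda>z. cnj (z $ k) * f z) = (\<lambda>z. (if j = k then 1 else 0) * f z + cnj (z $ k) * wirtinger_zbar j f z)"
  using has_wirtinger_unique[OF has_wirtinger_mult[OF has_wirtinger_cnj_component bipoly_has_wirtinger_wirtinger[OF f]], of j k]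
  by (simp_all add: add.commute)

lemma wirtinger_cmult:
  "wirtinger_z j (\<lambda>z. c * f z) = (\<lambda>z. c * wirtinger_z j f z)"
  "wirtinger_zbar j (\<lambda>z. c * f z) = (\<lambda>z. c * wirtinger_zbar j f z)"
  using has_wirtinger_unique[OF has_wirtinger_cmult[OF bipoly_has_wirtinger_wirtinger[OF f]]]
  by simp_all

end

lemma wirtinger_add:
  assumes "bipoly p q f" "bipoly p' q' g"
  shows "wirtinger_z j (\<lambda>z. f z + g z) = (\<lambda>z. wirtinger_z j f z + wirtinger_z j g z)"
    "wirtinger_zbar j (\<lambda>z. f z + g z) = (\<lambda>z. wirtinger_zbar j f z + wirtinger_zbar j g z)"
  using has_wirtinger_unique[OF has_wirtinger_add[OF assms[THEN bipoly_has_wirtinger_wirtinger]]]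
  by simp_all

lemma wirtinger_sum:
  assumes "\<And>i. i \<in> A \<Longrightarrow> bipoly p q (f i)"
  shows "wirtinger_z j (\<lambda>z. \<Sum>i\<in>A. f i z) = (\<lambda>z. \<Sum>i\<in>A. wirtinger_z j (f i) z)"
    "wirtinger_zbar j (\<lambda>z. \<Sum>i\<in>A. f i z) = (\<lambda>z. \<Sum>i\<in>A. wirtinger_zbar j (f i) z)"
  by (rule has_wirtinger_unique[OF has_wirtinger_sum], rule bipoly_has_wirtinger_wirtinger, erule assms)+

text \<open>
  The natural subtraction in \<open>p - 1\<close> is harmless, because the derivative vanishes for \<open>p = 0\<close> and
  the zero function has every bidegree.
\<close>

lemma bipoly_wirtinger_z:
  assumes "bipoly p q f"
  shows "bipoly (p - 1) q (wirtinger_z j f) \<and> (p = 0 \<longrightarrow> wirtinger_z j f = (\<lambda>z. 0))"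
  using assms
proof (induction rule: bipoly.induct)
  case (const c)
  then show ?case by (simp add: wirtinger_const bipoly.const)
next
  case (component_mult p q f k)
  have "bipoly p q (\<lambda>z. z $ k * wirtinger_z j f z)"
  proof (cases p)
    case 0
    then show ?thesis using component_mult by (simp add: bipoly_0)
  next
    case (Suc r)
    then show ?thesis using component_mult bipoly.component_mult[of r q "wirtinger_z j f" k] by simp
  qed
  then show ?case
    using bipoly.add[OF bipoly_cmult[OF component_mult.hyps]] component_mult.hyps
    by (simp add: wirtinger_component_mult)
next
  case (cnj_mult p q f k)
  then show ?case by (auto simp: wirtinger_cnj_mult intro: bipoly.cnj_mult)
next
  case (add p q f g)
  then show ?case by (auto simp: wirtinger_add intro: bipoly.add)
qed

lemma bipoly_wirtinger_zbar:
  assumes "bipoly p q f"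
  shows "bipoly p (q - 1) (wirtinger_zbar j f) \<and> (q = 0 \<longrightarrow> wirtinger_zbar j f = (\<lambda>z. 0))"
  using assms
proof (induction rule: bipoly.induct)
  case (const c)
  then show ?case by (simp add: wirtinger_const bipoly.const)
next
  case (component_mult p q f k)
  then show ?case by (auto simp: wirtinger_component_mult intro: bipoly.component_mult)
next
  case (cnj_mult p q f k)
  have "bipoly p q (\<lambda>z. cnj (z $ k) * wirtinger_zbar j f z)"
  proof (cases q)
    case 0
    then show ?thesis using cnj_mult by (simp add: bipoly_0)
  next
    case (Suc r)
    then show ?thesis using cnj_mult bipoly.cnj_mult[of p r "wirtinger_zbar j f" k] by simp
  qed
  then show ?case
    using bipoly.add[OF bipoly_cmult[OF cnj_mult.hyps]] cnj_mult.hyps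
    by (simp add: wirtinger_cnj_mult)
next
  case (add p q f g)
  then show ?case by (auto simp: wirtinger_add intro: bipoly.add)
qed

lemma wirtinger_commute:
  assumes "bipoly p q f"
  shows "wirtinger_z i (wirtinger_zbar j f) = wirtinger_zbar j (wirtinger_z i f)"
    and "wirtinger_z i (wirtinger_z j f) = wirtinger_z j (wirtinger_z i f)"
proof -
  have "wirtinger_z i (wirtinger_zbar j f) = wirtinger_zbar j (wirtinger_z i f)
      \<and> wirtinger_z i (wirtinger_z j f) = wirtinger_z j (wirtinger_z i f)"
    using assms
  proof (induction rule: bipoly.induct)
    case (const c)
    then show ?case by (simp add: wirtinger_const)
  next
    case (component_mult p q f k)
    note f = component_mult.hyps
    note D = conjunct1[OF bipoly_wirtinger_z[OF f]] and E = conjunct1[OF bipoly_wirtinger_zbar[OF f]]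
    \<comment> \<open>Adding up needs both summands of the product rule in the same bidegree, also for \<open>p = 0\<close>.\<close>
    have zD: "bipoly p q (\<lambda>z. z $ k * wirtinger_z j f z)" for j
    proof (cases p)
      case 0
      then show ?thesis using bipoly_wirtinger_z[OF f] by (simp add: bipoly_0)
    next
      case (Suc r)
      then show ?thesis using D[of j] bipoly.component_mult[of r q "wirtinger_z j f" k] by simp
    qed
    show ?case
      using component_mult.IH
      by (auto simp: wirtinger_component_mult[OF f] wirtinger_component_mult[OF D] wirtinger_component_mult[OF E]
          wirtinger_add[OF f zD] fun_eq_iff wirtinger_add[OF bipoly_0 zD])
  next
    case (cnj_mult p q f k)
    note f = cnj_mult.hyps
    note D = conjunct1[OF bipoly_wirtinger_z[OF f]] and E = conjunct1[OF bipoly_wirtinger_zbar[OF f]]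
    have zE: "bipoly p q (\<lambda>z. cnj (z $ k) * wirtinger_zbar j f z)" for j
    proof (cases q)
      case 0
      then show ?thesis using bipoly_wirtinger_zbar[OF f] by (simp add: bipoly_0)
    next
      case (Suc r)
      then show ?thesis using E[of j] bipoly.cnj_mult[of p r "wirtinger_zbar j f" k] by simp
    qed
    show ?case
      using cnj_mult.IH
      by (auto simp: wirtinger_cnj_mult[OF f] wirtinger_cnj_mult[OF D] wirtinger_cnj_mult[OF E]
          wirtinger_add[OF f zE] fun_eq_iff)
  next
    case (add p q f g)
    note D = conjunct1[OF bipoly_wirtinger_z[OF add.hyps(1)]] conjunct1[OF bipoly_wirtinger_z[OF add.hyps(2)]]
      and E = conjunct1[OF bipoly_wirtinger_zbar[OF add.hyps(1)]] conjunct1[OF bipoly_wirtinger_zbar[OF add.hyps(2)]]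
    show ?case
      using add.IH by (simp add: wirtinger_add[OF add.hyps] wirtinger_add[OF D] wirtinger_add[OF E])
  qed
  then show "wirtinger_z i (wirtinger_zbar j f) = wirtinger_zbar j (wirtinger_z i f)"
    "wirtinger_z i (wirtinger_z j f) = wirtinger_z j (wirtinger_z i f)" by simp_all
qed

text \<open>
  Euler's identity for the holomorphic variables.
\<close>

lemma bipoly_euler:
  assumes "bipoly p q f"
  shows "(\<Sum>k\<in>UNIV. z $ k * wirtinger_z k f z) = of_nat p * f z"
  using assms
proof (induction rule: bipoly.induct)
  case (const c)
  then show ?case by (simp add: wirtinger_const)
next
  case (component_mult p q f j)
  have "(\<Sum>k\<in>UNIV. z $ k * wirtinger_z k (\<lambda>z. z $ j * f z) z)
      = (\<Sum>k\<in>UNIV. (if k = j then z $ k * f z else 0) + z $ j * (z $ k * wirtinger_z k f z))"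
    by (intro sum.cong refl) (auto simp: wirtinger_component_mult[OF component_mult.hyps] distrib_left)
  also have "\<dots> = z $ j * f z + z $ j * (of_nat p * f z)"
    by (simp add: sum.distrib sum_distrib_left[symmetric] component_mult.IH)
  finally show ?case by (simp add: algebra_simps)
next
  case (cnj_mult p q f j)
  have "(\<Sum>k\<in>UNIV. z $ k * wirtinger_z k (\<lambda>z. cnj (z $ j) * f z) z)
      = (\<Sum>k\<in>UNIV. cnj (z $ j) * (z $ k * wirtinger_z k f z))"
    by (intro sum.cong refl) (auto simp: wirtinger_cnj_mult[OF cnj_mult.hyps])
  also have "\<dots> = cnj (z $ j) * (of_nat p * f z)"
    by (simp add: sum_distrib_left[symmetric] cnj_mult.IH)
  finally show ?case by (simp add: algebra_simps)
next
  case (add p q f g)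
  then show ?case
    by (simp add: wirtinger_add[OF add.hyps] distrib_left sum.distrib)
qed

lemma continuous_on_bipoly: "bipoly p q f \<Longrightarrow> continuous_on UNIV f"
proof (induction rule: bipoly.induct)
  case (component_mult p q f k)
  show ?case by (intro continuous_on_mult component_mult.IH continuous_intros)
next
  case (cnj_mult p q f k)
  show ?case by (intro continuous_on_mult cnj_mult.IH continuous_intros)
next
  case (add p q f g)
  show ?case by (intro continuous_on_add add.IH)
qed (rule continuous_on_const)

section \<open>Twisted means at the zeros of a harmonic polynomial\<close>

lemma continuous_on_hermitian_product [continuous_intros]:
  "continuous_on S f \<Longrightarrow> continuous_on S g \<Longrightarrow> continuous_on S (\<lambda>x. hermitian_product (f x) (g x))"
  unfolding hermitian_product_def by (intro continuous_intros)

lemma Re_hermitian_product: "Re (hermitian_product z w) = z \<bullet> w"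
  by (simp add: hermitian_product_def inner_vec_def inner_complex_def)

lemma norm_diff_hermitian: "(norm (z - w))\<^sup>2 = (norm z)\<^sup>2 + (norm w)\<^sup>2 - 2 * Re (hermitian_product z w)"
  by (simp add: Re_hermitian_product power2_norm_eq_inner inner_diff_left inner_diff_right inner_commute)

text \<open>
  At \<open>s = 1\<close> this is the integrand of the twisted spherical mean of \<open>g u * exp (- (norm u)^2 / 4)\<close>
  up to a factor that is constant on spheres around 0; at \<open>s = 0\<close> it is the constant \<open>g z\<close>. The exponential is
  antiholomorphic in \<open>w\<close>: the Gaussian supplies exactly the real part that the twist lacks.
\<close>

definition twist :: "complex ^ 'n \<Rightarrow> real \<Rightarrow> (complex ^ 'n \<Rightarrow> complex) \<Rightarrow> complex ^ 'n \<Rightarrow> complex" where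
  "twist z s g w = g (z - s *\<^sub>R w) * exp (of_real s / 2 * hermitian_product z w)"

lemma continuous_on_twist:
  assumes "continuous_on UNIV g"
  shows "continuous_on UNIV (twist z s g)"
proof -
  have "continuous_on UNIV (\<lambda>w. g (z - s *\<^sub>R w))"
    by (rule continuous_on_compose2[OF assms]) (auto intro!: continuous_intros)
  moreover have "continuous_on UNIV (\<lambda>w. exp (of_real s / 2 * hermitian_product z w))"
    by (intro continuous_intros)
  ultimately show ?thesis
    unfolding twist_def by (rule continuous_on_mult)
qed

lemma has_wirtinger_twist:
  assumes "bipoly p q g"
  shows "has_wirtinger (twist z s g) (\<lambda>k w. - (of_real s * twist z s (wirtinger_z k g) w))
     (\<lambda>k w. of_real s / 2 * z $ k * twist z s g w - of_real s * twist z s (wirtinger_zbar k g) w)"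
  unfolding twist_def
  by (rule has_wirtinger_cong[OF has_wirtinger_mult[OF
        has_wirtinger_affine[OF bipoly_has_wirtinger_wirtinger[OF assms]]
        has_wirtinger_exp[OF has_wirtinger_cmult[OF has_wirtinger_hermitian_right]]]])
     (simp_all add: algebra_simps)

lemma trunc_integral_twist_by_parts:
  assumes m: "m \<ge> 1" and g: "bipoly p q g"
  shows "trunc_integral m \<rho> (\<lambda>w. cnj (w $ k) * twist z s g w) =
      - (of_real s * trunc_integral (Suc m) \<rho> (twist z s (wirtinger_z k g)))"
    and "trunc_integral m \<rho> (\<lambda>w. w $ k * twist z s g w) =
      of_real s / 2 * z $ k * trunc_integral (Suc m) \<rho> (twist z s g)
      - of_real s * trunc_integral (Suc m) \<rho> (twist z s (wirtinger_zbar k g))"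
proof -
  have c: "continuous_on UNIV (twist z s g)" "continuous_on UNIV (twist z s (wirtinger_z k g))"
      "continuous_on UNIV (twist z s (wirtinger_zbar k g))" for k
    using bipoly_wirtinger_z[OF g, of k] bipoly_wirtinger_zbar[OF g, of k] g
    by (auto intro: continuous_on_twist continuous_on_bipoly)
  have cD: "continuous_on UNIV (\<lambda>w. - (of_real s * twist z s (wirtinger_z k g) w))"
    "continuous_on UNIV (\<lambda>w. of_real s / 2 * z $ k * twist z s g w - of_real s * twist z s (wirtinger_zbar k g) w)"
    by (intro continuous_on_minus continuous_on_diff continuous_on_mult continuous_on_const c)+
  note parts = trunc_integral_by_parts_wirtinger[OF m c(1) cD has_wirtinger_twist[OF g]]
  show "trunc_integral m \<rho> (\<lambda>w. cnj (w $ k) * twist z s g w) =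
      - (of_real s * trunc_integral (Suc m) \<rho> (twist z s (wirtinger_z k g)))"
    using parts(1)[of \<rho>] by (simp add: trunc_integral_uminus trunc_integral_cmult)
  have "trunc_integral (Suc m) \<rho> (\<lambda>w. of_real s / 2 * z $ k * twist z s g w - of_real s * twist z s (wirtinger_zbar k g) w)
      = trunc_integral (Suc m) \<rho> (\<lambda>w. of_real s / 2 * z $ k * twist z s g w)
        - trunc_integral (Suc m) \<rho> (\<lambda>w. of_real s * twist z s (wirtinger_zbar k g) w)"
    by (rule trunc_integral_diff) (intro continuous_on_mult continuous_on_const c | simp)+
  then show "trunc_integral m \<rho> (\<lambda>w. w $ k * twist z s g w) =
      of_real s / 2 * z $ k * trunc_integral (Suc m) \<rho> (twist z s g)
      - of_real s * trunc_integral (Suc m) \<rho> (twist z s (wirtinger_zbar k g))"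
    using parts(2)[of \<rho>] by (simp only: trunc_integral_cmult)
qed

lemma trunc_integral_twist_has_derivative:
  fixes f :: "complex ^ 'n \<Rightarrow> complex"
  assumes m: "m \<ge> 1" and f: "bipoly p q f"
  shows "((\<lambda>s. trunc_integral m \<rho> (twist z s f)) has_vector_derivative
    (\<Sum>k\<in>UNIV. z $ k / 2 * trunc_integral m \<rho> (\<lambda>w. cnj (w $ k) * twist z s f w)
       - trunc_integral m \<rho> (\<lambda>w. w $ k * twist z s (wirtinger_z k f) w)
       - trunc_integral m \<rho> (\<lambda>w. cnj (w $ k) * twist z s (wirtinger_zbar k f) w))) (at s)"
proof -
  have D: "continuous_on UNIV (wirtinger_z k f)" "continuous_on UNIV (wirtinger_zbar k f)" "continuous_on UNIV f" for k
    using bipoly_wirtinger_z[OF f, of k] bipoly_wirtinger_zbar[OF f, of k] f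
    by (auto intro: continuous_on_bipoly)
  have Dc: "continuous_on S (\<lambda>x. wirtinger_z k f (h x))" "continuous_on S (\<lambda>x. wirtinger_zbar k f (h x))"
      "continuous_on S (\<lambda>x. f (h x))" if "continuous_on S h" for k and S :: "(real \<times> (complex ^ 'n)) set" and h
    by (rule continuous_on_compose2[OF D(1) that] continuous_on_compose2[OF D(2) that]
        continuous_on_compose2[OF D(3) that], simp)+
  \<comment> \<open>The factor \<open>cnj (w $ k)\<close> in the first term comes from the exponential, the other two terms from
    the motion of the argument \<open>z - s *\<^sub>R w\<close>.\<close>
  define F' where "F' s w = (\<Sum>k\<in>UNIV. z $ k / 2 * (cnj (w $ k) * twist z s f w)
       - w $ k * twist z s (wirtinger_z k f) w - cnj (w $ k) * twist z s (wirtinger_zbar k f) w)" for s w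
  have der: "((\<lambda>s. twist z s f w) has_vector_derivative F' s w) (at s)" for s w
  proof -
    have "((\<lambda>s. f (z + s *\<^sub>R (- w))) has_vector_derivative
        (\<Sum>k\<in>UNIV. (- w) $ k * wirtinger_z k f (z + s *\<^sub>R (- w)) + cnj ((- w) $ k) * wirtinger_zbar k f (z + s *\<^sub>R (- w)))) (at s)"
      by (rule has_wirtinger_line[OF bipoly_has_wirtinger_wirtinger[OF f]])
    moreover have "((\<lambda>s. exp (of_real s / 2 * hermitian_product z w)) has_vector_derivative
        hermitian_product z w / 2 * exp (of_real s / 2 * hermitian_product z w)) (at s)"
    proof -
      have "((\<lambda>s. s *\<^sub>R (hermitian_product z w / 2)) has_vector_derivative hermitian_product z w / 2) (at s)"
        by (auto intro!: derivative_eq_intros)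
      then have "((\<lambda>s. of_real s / 2 * hermitian_product z w) has_vector_derivative hermitian_product z w / 2) (at s)"
        by (simp add: scaleR_conv_of_real)
      from field_vector_diff_chain_at[OF this DERIV_exp]
      show ?thesis by (simp add: o_def)
    qed
    ultimately have "((\<lambda>s. f (z + s *\<^sub>R (- w)) * exp (of_real s / 2 * hermitian_product z w)) has_vector_derivative
        f (z + s *\<^sub>R (- w)) * (hermitian_product z w / 2 * exp (of_real s / 2 * hermitian_product z w)) +
        (\<Sum>k\<in>UNIV. (- w) $ k * wirtinger_z k f (z + s *\<^sub>R (- w)) + cnj ((- w) $ k) * wirtinger_zbar k f (z + s *\<^sub>R (- w)))
          * exp (of_real s / 2 * hermitian_product z w)) (at s)"
      by (rule has_vector_derivative_mult)
    moreover have "F' s w = f (z - s *\<^sub>R w) * (hermitian_product z w / 2 * exp (of_real s / 2 * hermitian_product z w)) +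
        (\<Sum>k\<in>UNIV. (- w) $ k * wirtinger_z k f (z - s *\<^sub>R w) + cnj ((- w) $ k) * wirtinger_zbar k f (z - s *\<^sub>R w))
          * exp (of_real s / 2 * hermitian_product z w)"
    proof -
      define e where "e = exp (of_real s / 2 * hermitian_product z w)"
      have "hermitian_product z w / 2 = (\<Sum>k\<in>UNIV. z $ k / 2 * cnj (w $ k))"
        by (simp add: hermitian_product_def sum_divide_distrib)
      note hp = this
      let ?z = "z - s *\<^sub>R w"
      have "F' s w = (\<Sum>k\<in>UNIV. f ?z * (z $ k / 2 * cnj (w $ k) * e) +
          ((- w) $ k * wirtinger_z k f ?z + cnj ((- w) $ k) * wirtinger_zbar k f ?z) * e)"
        unfolding F'_def twist_def e_def[symmetric] by (intro sum.cong refl) (simp add: algebra_simps)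
      also have "\<dots> = f ?z * ((\<Sum>k\<in>UNIV. z $ k / 2 * cnj (w $ k)) * e) +
          (\<Sum>k\<in>UNIV. (- w) $ k * wirtinger_z k f ?z + cnj ((- w) $ k) * wirtinger_zbar k f ?z) * e"
        by (subst sum.distrib) (simp only: sum_distrib_left sum_distrib_right)
      finally show ?thesis by (simp only: hp e_def)
    qed
    ultimately show ?thesis
      unfolding twist_def by (simp only: scaleR_minus_right add_uminus_conv_diff)
  qed
  have "((\<lambda>s. trunc_integral m \<rho> (twist z s f)) has_vector_derivative trunc_integral m \<rho> (F' s)) (at s)"
    unfolding trunc_integral_def
  proof (rule leibniz_compact_support[where U = UNIV])
    fix t w
    show "((\<lambda>t. of_real (trunc_power m (\<rho> - (norm w)\<^sup>2)) * twist z t f w) has_vector_derivative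
        of_real (trunc_power m (\<rho> - (norm w)\<^sup>2)) * F' t w) (at t)"
      by (rule has_vector_derivative_mult_right[OF der])
    show "continuous_on UNIV (\<lambda>w. of_real (trunc_power m (\<rho> - (norm w)\<^sup>2)) * twist z t f w)"
      by (rule continuous_on_mult[OF _ continuous_on_twist[OF D(3)]]) (intro continuous_intros)
    show "vanishes_outside (\<bar>\<rho>\<bar> + 1) (\<lambda>w. of_real (trunc_power m (\<rho> - (norm w)\<^sup>2)) * twist z t f w)"
      by (rule vanishes_outside_trunc_power[OF m])
  next
    show "continuous_on (UNIV \<times> UNIV) (\<lambda>(t, w). of_real (trunc_power m (\<rho> - (norm w)\<^sup>2)) * F' t w)"
    proof -
      have w: "continuous_on (UNIV \<times> UNIV) (\<lambda>x::real \<times> (complex ^ 'n). z - fst x *\<^sub>R snd x)"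
        "continuous_on (UNIV \<times> UNIV) (\<lambda>x::real \<times> (complex ^ 'n). exp (of_real (fst x) / 2 * hermitian_product z (snd x)))"
        "continuous_on (UNIV \<times> UNIV) (\<lambda>x::real \<times> (complex ^ 'n). complex_of_real (trunc_power m (\<rho> - (norm (snd x))\<^sup>2)))"
        "continuous_on (UNIV \<times> UNIV) (\<lambda>x::real \<times> (complex ^ 'n). snd x $ k)"
        "continuous_on (UNIV \<times> UNIV) (\<lambda>x::real \<times> (complex ^ 'n). cnj (snd x $ k))" for k
        by (intro continuous_intros; simp)+
      show ?thesis
        unfolding split_beta F'_def twist_def
        by (intro continuous_on_mult continuous_on_sum continuous_on_diff continuous_on_const Dc w)
    qed
  qed auto
  also have "trunc_integral m \<rho> (F' s) =
    (\<Sum>k\<in>UNIV. z $ k / 2 * trunc_integral m \<rho> (\<lambda>w. cnj (w $ k) * twist z s f w)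
       - trunc_integral m \<rho> (\<lambda>w. w $ k * twist z s (wirtinger_z k f) w)
       - trunc_integral m \<rho> (\<lambda>w. cnj (w $ k) * twist z s (wirtinger_zbar k f) w))"
  proof -
    have c: "continuous_on UNIV (\<lambda>w. z $ k / 2 * (cnj (w $ k) * twist z s f w))"
      "continuous_on UNIV (\<lambda>w. w $ k * twist z s (wirtinger_z k f) w)"
      "continuous_on UNIV (\<lambda>w. cnj (w $ k) * twist z s (wirtinger_zbar k f) w)" for k
    proof -
      have w: "continuous_on UNIV (\<lambda>w::complex ^ 'n. w $ k)" "continuous_on UNIV (\<lambda>w::complex ^ 'n. cnj (w $ k))"
        by (intro continuous_intros)+
      show "continuous_on UNIV (\<lambda>w. z $ k / 2 * (cnj (w $ k) * twist z s f w))"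
        "continuous_on UNIV (\<lambda>w. w $ k * twist z s (wirtinger_z k f) w)"
        "continuous_on UNIV (\<lambda>w. cnj (w $ k) * twist z s (wirtinger_zbar k f) w)"
        by (intro continuous_on_mult continuous_on_const w continuous_on_twist D)+
    qed
    show ?thesis
      unfolding F'_def[abs_def]
      by (subst trunc_integral_sum[OF m], intro continuous_on_diff c)
         (simp only: trunc_integral_diff[OF m continuous_on_diff[OF c(1) c(2)] c(3)]
           trunc_integral_diff[OF m c(1) c(2)] trunc_integral_cmult)
  qed
  finally show ?thesis .
qed

text \<open>
  The weighted integral \<open>V s\<close> of \<open>twist z s f\<close> starts from \<open>V 0 = 0\<close>, because \<open>f z = 0\<close>. In its
  derivative, integration by parts removes the linear factors in \<open>w\<close>; what remains is a multiple of
  the integral of the Laplacian of \<open>f\<close>, which is 0, and a multiple of the integral for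
  \<open>h = (\<Sum>k. z $ k * wirtinger_z k f)\<close>. The latter is again harmonic, has bidegree \<open>(p - 1, q)\<close>, and
  vanishes at \<open>z\<close> by Euler's identity. Induction on \<open>p\<close> gives \<open>V' = 0\<close>.
\<close>

lemma trunc_integral_twist_harmonic_eq_0:
  fixes f :: "complex ^ 'n \<Rightarrow> complex"
  assumes "bipoly p q f" "\<And>u. (\<Sum>k\<in>UNIV. wirtinger_z k (wirtinger_zbar k f) u) = 0" "f z = 0" "m \<ge> 1"
  shows "trunc_integral m \<rho> (twist z s f) = 0"
  using assms
proof (induction p arbitrary: f m s rule: less_induct)
  case (less p)
  note f = less.prems(1) and harm = less.prems(2) and fz = less.prems(3) and m = less.prems(4)
  have Df: "bipoly (p - 1) q (wirtinger_z k f)" for k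
    using bipoly_wirtinger_z[OF f] by blast
  have Ef: "bipoly p (q - 1) (wirtinger_zbar k f)" for k
    using bipoly_wirtinger_zbar[OF f] by blast
  have DEf: "bipoly (p - 1) (q - 1) (wirtinger_z j (wirtinger_zbar k f))" for j k
    using bipoly_wirtinger_z[OF Ef] by blast
  define h where "h u = (\<Sum>k\<in>UNIV. z $ k * wirtinger_z k f u)" for u
  have h: "bipoly (p - 1) q h"
    unfolding h_def[abs_def] by (intro bipoly_sum bipoly_cmult Df)
  have hz: "h z = 0"
    using bipoly_euler[OF f, of z] fz by (simp add: h_def)
  have hharm: "(\<Sum>k\<in>UNIV. wirtinger_z k (wirtinger_zbar k h) u) = 0" for u
  proof -
    have 1: "wirtinger_zbar k h = (\<lambda>u. \<Sum>j\<in>UNIV. z $ j * wirtinger_z j (wirtinger_zbar k f) u)" for k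
    proof -
      have "wirtinger_zbar k h = (\<lambda>u. \<Sum>j\<in>UNIV. wirtinger_zbar k (\<lambda>u. z $ j * wirtinger_z j f u) u)"
        unfolding h_def[abs_def] by (rule wirtinger_sum(2)) (rule bipoly_cmult[OF Df])
      then show ?thesis by (simp add: wirtinger_cmult(2)[OF Df] wirtinger_commute(1)[OF f])
    qed
    have 2: "wirtinger_z k (wirtinger_zbar k h) = (\<lambda>u. \<Sum>j\<in>UNIV. z $ j * wirtinger_z j (wirtinger_z k (wirtinger_zbar k f)) u)" for k
    proof -
      have "wirtinger_z k (wirtinger_zbar k h) = (\<lambda>u. \<Sum>j\<in>UNIV. wirtinger_z k (\<lambda>u. z $ j * wirtinger_z j (wirtinger_zbar k f) u) u)"
        unfolding 1 by (rule wirtinger_sum(1)) (rule bipoly_cmult[OF DEf])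
      then show ?thesis
        by (simp add: wirtinger_cmult(1)[OF DEf] wirtinger_commute(2)[OF Ef, of k])
    qed
    have "(\<Sum>k\<in>UNIV. wirtinger_z k (wirtinger_zbar k h) u)
        = (\<Sum>j\<in>UNIV. z $ j * (\<Sum>k\<in>UNIV. wirtinger_z j (wirtinger_z k (wirtinger_zbar k f)) u))"
      unfolding 2 by (subst sum.swap) (simp add: sum_distrib_left)
    moreover have "(\<Sum>k\<in>UNIV. wirtinger_z j (wirtinger_z k (wirtinger_zbar k f)) u)
        = wirtinger_z j (\<lambda>u. \<Sum>k\<in>UNIV. wirtinger_z k (wirtinger_zbar k f) u) u" for j
      using wirtinger_sum(1)[of UNIV "p - 1" "q - 1" "\<lambda>k. wirtinger_z k (wirtinger_zbar k f)" j] DEf by simp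
    ultimately show ?thesis by (simp add: harm wirtinger_const)
  qed
  have hvan: "trunc_integral m \<rho> (twist z s h) = 0" if "m \<ge> 1" for m s
  proof (cases "p = 0")
    case True
    then have "h = (\<lambda>u. 0)"
      using bipoly_wirtinger_z[OF f] by (simp add: h_def[abs_def])
    then show ?thesis by (simp add: twist_def[abs_def])
  next
    case False
    then show ?thesis using less.IH[OF _ h hharm hz that] by simp
  qed
  have cD: "continuous_on UNIV (twist z s (wirtinger_z k f))"
    "continuous_on UNIV (twist z s (wirtinger_z k (wirtinger_zbar k f)))" for k s
    by (intro continuous_on_twist continuous_on_bipoly[OF Df] continuous_on_bipoly[OF DEf])+
  have "((\<lambda>s. trunc_integral m \<rho> (twist z s f)) has_vector_derivative 0) (at s)" for s
  proof -
    let ?T = "\<lambda>g. trunc_integral (Suc m) \<rho> (twist z s g)"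
    have "(\<Sum>k\<in>UNIV. z $ k / 2 * trunc_integral m \<rho> (\<lambda>w. cnj (w $ k) * twist z s f w)
       - trunc_integral m \<rho> (\<lambda>w. w $ k * twist z s (wirtinger_z k f) w)
       - trunc_integral m \<rho> (\<lambda>w. cnj (w $ k) * twist z s (wirtinger_zbar k f) w))
      = (\<Sum>k\<in>UNIV. 2 * of_real s * ?T (wirtinger_z k (wirtinger_zbar k f)) - of_real s * (z $ k * ?T (wirtinger_z k f)))"
      by (intro sum.cong refl)
         (simp add: trunc_integral_twist_by_parts[OF m f] trunc_integral_twist_by_parts[OF m Df]
           trunc_integral_twist_by_parts[OF m Ef] wirtinger_commute(1)[OF f, symmetric] algebra_simps)
    also have "\<dots> = 2 * of_real s * (\<Sum>k\<in>UNIV. ?T (wirtinger_z k (wirtinger_zbar k f)))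
        - of_real s * (\<Sum>k\<in>UNIV. z $ k * ?T (wirtinger_z k f))"
      by (simp add: sum_subtractf sum_distrib_left)
    also have "(\<Sum>k\<in>UNIV. ?T (wirtinger_z k (wirtinger_zbar k f)))
        = trunc_integral (Suc m) \<rho> (\<lambda>w. \<Sum>k\<in>UNIV. twist z s (wirtinger_z k (wirtinger_zbar k f)) w)"
      by (rule trunc_integral_sum[symmetric]) (simp_all add: cD)
    also have "(\<lambda>w. \<Sum>k\<in>UNIV. twist z s (wirtinger_z k (wirtinger_zbar k f)) w) = (\<lambda>w. 0)"
      by (simp add: twist_def sum_distrib_right[symmetric] harm)
    also have "(\<Sum>k\<in>UNIV. z $ k * ?T (wirtinger_z k f)) = ?T h"
    proof -
      have "(\<Sum>k\<in>UNIV. z $ k * ?T (wirtinger_z k f)) = (\<Sum>k\<in>UNIV. trunc_integral (Suc m) \<rho> (\<lambda>w. z $ k * twist z s (wirtinger_z k f) w))"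
        by (simp only: trunc_integral_cmult)
      also have "\<dots> = trunc_integral (Suc m) \<rho> (\<lambda>w. \<Sum>k\<in>UNIV. z $ k * twist z s (wirtinger_z k f) w)"
        by (rule trunc_integral_sum[symmetric]) (auto intro!: continuous_on_mult cD)
      also have "(\<lambda>w. \<Sum>k\<in>UNIV. z $ k * twist z s (wirtinger_z k f) w) = twist z s h"
        by (simp add: twist_def h_def fun_eq_iff sum_distrib_right mult.assoc)
      finally show ?thesis .
    qed
    finally have "(\<Sum>k\<in>UNIV. z $ k / 2 * trunc_integral m \<rho> (\<lambda>w. cnj (w $ k) * twist z s f w)
       - trunc_integral m \<rho> (\<lambda>w. w $ k * twist z s (wirtinger_z k f) w)
       - trunc_integral m \<rho> (\<lambda>w. cnj (w $ k) * twist z s (wirtinger_zbar k f) w)) = 0"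
      by (simp add: hvan)
    then show ?thesis
      using trunc_integral_twist_has_derivative[OF m f, of \<rho> z s] by simp
  qed
  then obtain c where c: "\<And>s. trunc_integral m \<rho> (twist z s f) = c"
    using has_vector_derivative_zero_constant[of UNIV "\<lambda>s. trunc_integral m \<rho> (twist z s f)"] by auto
  have "twist z 0 f = (\<lambda>w. 0)" by (simp add: twist_def fz fun_eq_iff)
  then have "c = 0" using c[of 0] by simp
  then show ?case using c by simp
qed

text \<open>
  Completing the square: with \<open>norm w = r\<close>, the Gaussian at \<open>z - w\<close> times the twist is a constant
  times \<open>exp (hermitian_product z w / 2)\<close>.
\<close>

lemma twisted_spherical_mean_eq_0_at_zero:
  fixes P :: "complex ^ 'n \<Rightarrow> complex"
  assumes P: "P \<in> bigraded_harmonics p q" and Pz: "P z = 0" and r: "r > 0"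
  shows "twisted_spherical_mean (\<lambda>u. P u * of_real (exp (- (norm u)\<^sup>2 / 4))) r z = 0"
proof -
  have bP: "bipoly p q P" and harm: "\<And>u. (\<Sum>k\<in>UNIV. wirtinger_z k (wirtinger_zbar k P) u) = 0"
    using P by (auto simp: bigraded_harmonics_def bihomogeneous_polys_eq_bipoly laplacian_def)
  have "sphere_mean r (twist z 1 P) = 0"
  proof (rule sphere_mean_eq_0_if_trunc_integrals_0[OF _ _ r])
    show "continuous_on UNIV (twist z 1 P)"
      by (intro continuous_on_twist continuous_on_bipoly[OF bP])
    show "(LINT w|lborel. of_real (trunc_power 1 (\<rho> - (norm w)\<^sup>2)) * twist z 1 P w) = 0" for \<rho>
      using trunc_integral_twist_harmonic_eq_0[OF bP harm Pz, of 1 \<rho> 1] by (simp add: trunc_integral_def)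
  qed
  moreover have "twisted_spherical_mean (\<lambda>u. P u * of_real (exp (- (norm u)\<^sup>2 / 4))) r z
      = (LINT w|normalized_sphere_measure r. of_real (exp (- ((norm z)\<^sup>2 + r\<^sup>2) / 4)) * twist z 1 P w)"
    unfolding twisted_spherical_mean_def
  proof (rule Bochner_Integration.integral_cong[OF refl])
    fix w :: "complex ^ 'n" assume "w \<in> space (normalized_sphere_measure r)"
    then have w: "norm w = r" by simp
    let ?h = "hermitian_product z w"
    have "of_real (exp (- (norm (z - w))\<^sup>2 / 4)) * exp (\<i> / 2 * of_real (Im ?h))
       = exp (of_real (- (norm (z - w))\<^sup>2 / 4) + \<i> / 2 * of_real (Im ?h))"
      by (simp only: exp_add exp_of_real)
    also have "of_real (- (norm (z - w))\<^sup>2 / 4) + \<i> / 2 * of_real (Im ?h)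
        = of_real (- ((norm z)\<^sup>2 + r\<^sup>2) / 4) + 1 / 2 * ?h"
      unfolding norm_diff_hermitian w by (simp add: complex_eq_iff field_simps)
    also have "exp \<dots> = of_real (exp (- ((norm z)\<^sup>2 + r\<^sup>2) / 4)) * exp (1 / 2 * ?h)"
      by (simp only: exp_add exp_of_real)
    finally show "P (z - w) * of_real (exp (- (norm (z - w))\<^sup>2 / 4)) * exp (\<i> / 2 * of_real (Im ?h))
        = of_real (exp (- ((norm z)\<^sup>2 + r\<^sup>2) / 4)) * twist z 1 P w"
      by (simp add: twist_def)
  qed
  ultimately show ?thesis by (simp add: sphere_mean_def)
qed

section \<open>Vanishing means along a complex line\<close>

text \<open>
  For \<open>m > r\<close> this is \<open>(d/da - 1/2)^r\<close> applied to \<open>trunc_power m\<close>: lowering \<open>m\<close> by one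
  differentiates. The operator arises from differentiating
  \<open>exp (- (\<mu> * x / 2)) * trunc_power m (a + \<mu> * x + cnj \<mu> * cnj x)\<close> with respect to \<open>\<mu>\<close>.
\<close>

fun derived_kernel :: "nat \<Rightarrow> nat \<Rightarrow> real \<Rightarrow> real" where
  "derived_kernel 0 m a = trunc_power m a"
| "derived_kernel (Suc r) m a = derived_kernel r (m - 1) a - derived_kernel r m a / 2"

lemma derived_kernel_nonpos: "m > r \<Longrightarrow> a \<le> 0 \<Longrightarrow> derived_kernel r m a = 0"
  by (induction r arbitrary: m) (auto simp: trunc_power_nonpos)

lemma continuous_on_derived_kernel: "continuous_on S h \<Longrightarrow> continuous_on S (\<lambda>x. derived_kernel r m (h x))"
proof (induction r arbitrary: m)
  case 0
  then show ?case by (simp add: continuous_on_trunc_power)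
next
  case (Suc r)
  then show ?case by (auto intro!: continuous_on_diff continuous_on_divide continuous_on_const)
qed

lemma derived_kernel_has_derivative:
  "m > r \<Longrightarrow> ((derived_kernel r (Suc m)) has_real_derivative derived_kernel r m a) (at a)"
proof (induction r arbitrary: m)
  case 0
  then obtain l where "m = Suc l" by (cases m) auto
  moreover have "derived_kernel 0 k = trunc_power k" for k by (simp add: fun_eq_iff)
  ultimately show ?case using has_derivative_trunc_power[of l a] by simp
next
  case (Suc r)
  then obtain l where l: "m = Suc l" "l > r" by (cases m) auto
  have eq: "derived_kernel (Suc r) (Suc m) = (\<lambda>a. derived_kernel r m a - derived_kernel r (Suc m) a / 2)" by (simp add: fun_eq_iff)
  have "((\<lambda>a. derived_kernel r m a - derived_kernel r (Suc m) a / 2) has_real_derivative derived_kernel r (m - 1) a - derived_kernel r m a / 2) (at a)"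
    using Suc.IH[OF l(2)] Suc.IH[of m] Suc.prems l(1)
    by (intro DERIV_diff DERIV_cdivide) auto
  then show ?case unfolding eq by simp
qed

text \<open>
  The vanishing means are integrated against the radial weight
  \<open>exp ((norm w)^2 / 4) * trunc_power N (\<rho> - (norm w)^2)\<close>, and \<open>u = z - w\<close> is substituted. By the
  choice of the Gaussian the twist becomes holomorphic in \<open>z\<close>, up to the factor
  \<open>exp ((norm z)^2 / 4)\<close>.
\<close>

lemma twisted_means_0_imp_shifted_trunc_integral_0:
  fixes f :: "complex ^ 'n \<Rightarrow> complex"
  assumes f: "continuous_on UNIV f" and mean: "\<And>r. r > 0 \<Longrightarrow> twisted_spherical_mean f r z = 0" and N: "N \<ge> 1"
  shows "(LINT u|lborel. of_real (trunc_power N (\<rho> - (norm (z - u))\<^sup>2)) *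
      (f u * of_real (exp ((norm u)\<^sup>2 / 4)) * exp (- (hermitian_product z u / 2)))) = 0"
proof -
  define G where "G w = f (z - w) * exp (\<i> / 2 * of_real (Im (hermitian_product z w)))" for w
  define F where "F w = of_real (trunc_power N (\<rho> - (norm w)\<^sup>2)) * (of_real (exp ((norm w)\<^sup>2 / 4)) * G w)" for w
  have G: "continuous_on UNIV G"
  proof -
    have "continuous_on UNIV (\<lambda>w. f (z - w))"
      by (rule continuous_on_compose2[OF f]) (auto intro!: continuous_intros)
    moreover have "continuous_on UNIV (\<lambda>w. exp (\<i> / 2 * of_real (Im (hermitian_product z w))))"
      by (intro continuous_intros)
    ultimately show ?thesis unfolding G_def by (rule continuous_on_mult)
  qed
  have gauss: "continuous_on UNIV (\<lambda>w::complex ^ 'n. complex_of_real (exp ((norm w)\<^sup>2 / 4)))"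
    "continuous_on UNIV (\<lambda>w::complex ^ 'n. complex_of_real (trunc_power N (\<rho> - (norm w)\<^sup>2)))"
    by (intro continuous_intros; simp)+
  have Fc: "continuous_on UNIV F"
    unfolding F_def by (intro continuous_on_mult gauss G)
  have "integral\<^sup>L lborel F = 0"
  proof (rule lborel_integral_eq_0_if_sphere_means_0[OF Fc])
    show "vanishes_outside (\<bar>\<rho>\<bar> + 1) F"
      unfolding F_def by (rule vanishes_outside_trunc_power[OF N])
    fix r :: real assume r: "r > 0"
    have "sphere_mean r F = (LINT w|normalized_sphere_measure r. of_real (trunc_power N (\<rho> - r\<^sup>2) * exp (r\<^sup>2 / 4)) * G w)"
      unfolding sphere_mean_def
    proof (rule Bochner_Integration.integral_cong[OF refl])
      fix w :: "complex ^ 'n" assume "w \<in> space (normalized_sphere_measure r)"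
      then have w: "norm w = r" by simp
      show "F w = of_real (trunc_power N (\<rho> - r\<^sup>2) * exp (r\<^sup>2 / 4)) * G w"
        unfolding F_def w by simp
    qed
    also have "\<dots> = of_real (trunc_power N (\<rho> - r\<^sup>2) * exp (r\<^sup>2 / 4)) * twisted_spherical_mean f r z"
      unfolding twisted_spherical_mean_def G_def by (rule integral_mult_right_zero)
    finally show "sphere_mean r F = 0" using mean[OF r] by simp
  qed
  then have "(LINT u|lborel. F (z - u)) = 0"
    using lborel_integral_reflect[OF borel_measurable_continuous_onI[OF Fc], of z] by simp
  moreover have "F (z - u) = of_real (exp ((norm z)\<^sup>2 / 4)) * (of_real (trunc_power N (\<rho> - (norm (z - u))\<^sup>2)) *
      (f u * of_real (exp ((norm u)\<^sup>2 / 4)) * exp (- (hermitian_product z u / 2))))" for u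
  proof -
    let ?h = "hermitian_product z u"
    \<comment> \<open>\<open>hermitian_product z z\<close> is real.\<close>
    have Im: "Im (hermitian_product z (z - u)) = - Im ?h"
    proof -
      have "hermitian_product z (z - u) = hermitian_product z z - ?h"
        by (simp add: hermitian_product_def right_diff_distrib sum_subtractf)
      moreover have "Im (hermitian_product z z) = 0"
        by (simp add: hermitian_product_def mult.commute)
      ultimately show ?thesis by simp
    qed
    have "complex_of_real (exp ((norm (z - u))\<^sup>2 / 4)) * exp (\<i> / 2 * of_real (Im (hermitian_product z (z - u))))
       = exp (of_real ((norm (z - u))\<^sup>2 / 4) + \<i> / 2 * of_real (- Im ?h))"
      unfolding Im by (simp only: exp_add exp_of_real)
    also have "of_real ((norm (z - u))\<^sup>2 / 4) + \<i> / 2 * of_real (- Im ?h)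
        = of_real ((norm z)\<^sup>2 / 4) + (of_real ((norm u)\<^sup>2 / 4) + - (?h / 2))"
      unfolding norm_diff_hermitian by (simp add: complex_eq_iff field_simps)
    also have "exp \<dots> = of_real (exp ((norm z)\<^sup>2 / 4)) * (of_real (exp ((norm u)\<^sup>2 / 4)) * exp (- (?h / 2)))"
      by (simp only: exp_add exp_of_real)
    finally show ?thesis
      by (simp add: F_def G_def mult_ac)
  qed
  ultimately show ?thesis by simp
qed

text \<open>
  For \<open>r = i = j = 0\<close> and \<open>g u = f u * exp ((norm u)^2 / 4)\<close> this is the integral in the preceding
  lemma at the point \<open>z = \<mu> *s \<omega>\<close>, where
  \<open>\<rho>\<close> has been replaced by \<open>\<rho> + (norm z)^2\<close>. The shift removes the term in \<open>\<mu> * cnj \<mu>\<close> from the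
  argument of the weight, so that every \<open>\<mu>\<close>-derivative brings out one factor \<open>x\<close> and every
  conjugate derivative one factor \<open>cnj x\<close>, where \<open>x = hermitian_product \<omega> u\<close>.
\<close>

definition line_moment ::
    "(complex ^ 'n \<Rightarrow> complex) \<Rightarrow> complex ^ 'n \<Rightarrow> real \<Rightarrow> nat \<Rightarrow> nat \<Rightarrow> nat \<Rightarrow> nat \<Rightarrow> complex \<Rightarrow> complex" where
  "line_moment g \<omega> \<rho> r m i j \<mu> = (LINT u|lborel.
     of_real (derived_kernel r m (\<rho> - (norm u)\<^sup>2 + 2 * Re (\<mu> * hermitian_product \<omega> u))) *
     (hermitian_product \<omega> u ^ i * cnj (hermitian_product \<omega> u) ^ j * g u * exp (- (\<mu> * hermitian_product \<omega> u / 2))))"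

lemma norm_hermitian_product_le:
  "norm (hermitian_product \<omega> u) \<le> (\<Sum>j\<in>UNIV. norm (\<omega> $ j)) * norm u"
proof -
  have "norm (hermitian_product \<omega> u) \<le> (\<Sum>j\<in>UNIV. norm (\<omega> $ j) * norm (u $ j))"
    unfolding hermitian_product_def by (rule sum_norm_le) (simp add: norm_mult)
  also have "\<dots> \<le> (\<Sum>j\<in>UNIV. norm (\<omega> $ j) * norm u)"
    by (intro sum_mono mult_left_mono) (auto simp: Finite_Cartesian_Product.norm_nth_le)
  finally show ?thesis by (simp add: sum_distrib_right)
qed

lemma line_derived_kernel_vanishes:
  fixes \<omega> :: "complex ^ 'n"
  assumes m: "m > r" and l: "norm l \<le> L" and u: "norm u > \<bar>\<rho>\<bar> + 1 + 2 * (L * (\<Sum>j\<in>UNIV. norm (\<omega> $ j)))"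
  shows "derived_kernel r m (\<rho> - (norm u)\<^sup>2 + 2 * Re (l * hermitian_product \<omega> u)) = 0"
proof (rule derived_kernel_nonpos[OF m])
  let ?A = "\<Sum>j\<in>UNIV. norm (\<omega> $ j)"
  have A: "?A \<ge> 0" by (simp add: sum_nonneg)
  have L: "L \<ge> 0" using l norm_ge_zero[of l] by linarith
  then have LA: "L * ?A \<ge> 0" using A by simp
  have "Re (l * hermitian_product \<omega> u) \<le> norm l * norm (hermitian_product \<omega> u)"
    using complex_Re_le_cmod[of "l * hermitian_product \<omega> u"] by (simp add: norm_mult)
  also have "\<dots> \<le> L * (?A * norm u)"
    by (intro mult_mono l norm_hermitian_product_le L) simp
  finally have 1: "Re (l * hermitian_product \<omega> u) \<le> L * ?A * norm u" by (simp add: mult.assoc)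
  have u1: "norm u \<ge> 1" "norm u - 2 * (L * ?A) \<ge> \<bar>\<rho>\<bar> + 1" using u LA by linarith+
  have "\<bar>\<rho>\<bar> \<le> 1 * (norm u - 2 * (L * ?A))" using u1 by simp
  also have "\<dots> \<le> norm u * (norm u - 2 * (L * ?A))"
    using u1 by (intro mult_right_mono) auto
  finally have "\<rho> \<le> (norm u)\<^sup>2 - 2 * (L * ?A * norm u)"
    by (simp add: power2_eq_square algebra_simps)
  then show "\<rho> - (norm u)\<^sup>2 + 2 * Re (l * hermitian_product \<omega> u) \<le> 0" using 1 by linarith
qed

lemma line_moment_has_derivative:
  fixes \<omega> :: "complex ^ 'n"
  assumes m: "m > r" and g: "continuous_on UNIV g"
  shows "((\<lambda>t. line_moment g \<omega> \<rho> r (Suc m) i j (\<mu> + of_real t * v)) has_vector_derivative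
    v * line_moment g \<omega> \<rho> (Suc r) (Suc m) (Suc i) j \<mu> + cnj v * line_moment g \<omega> \<rho> r m i (Suc j) \<mu>) (at 0)"
proof -
  let ?x = "\<lambda>u. hermitian_product \<omega> u"
  define a where "a l u = \<rho> - (norm u)\<^sup>2 + 2 * Re (l * ?x u)" for l and u :: "complex ^ 'n"
  define e where "e i j l u = ?x u ^ i * cnj (?x u) ^ j * g u * exp (- (l * ?x u / 2))" for i j l u
  define F' where "F' l u = v * (of_real (derived_kernel (Suc r) (Suc m) (a l u)) * e (Suc i) j l u)
     + cnj v * (of_real (derived_kernel r m (a l u)) * e i (Suc j) l u)" for l u
  \<comment> \<open>\<open>L\<close> bounds the parameter on the segment, and \<open>R\<close> bounds the supports of all the integrands.\<close>
  define L where "L = norm \<mu> + norm v"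
  define R where "R = \<bar>\<rho>\<bar> + 1 + 2 * (L * (\<Sum>j\<in>UNIV. norm (\<omega> $ j)))"
  have lm: "line_moment g \<omega> \<rho> r m i j l = (LINT u|lborel. of_real (derived_kernel r m (a l u)) * e i j l u)" for r m i j l
    by (simp add: line_moment_def a_def e_def)
  have ac: "continuous_on UNIV (a l)" for l
    unfolding a_def by (intro continuous_intros)
  have ec: "continuous_on UNIV (e i j l)" for i j l
  proof -
    have 1: "continuous_on UNIV (\<lambda>u. ?x u ^ i * cnj (?x u) ^ j)" and 2: "continuous_on UNIV (\<lambda>u. exp (- (l * ?x u / 2)))"
      by (intro continuous_intros; simp)+
    show ?thesis unfolding e_def by (rule continuous_on_mult[OF continuous_on_mult[OF 1 g] 2])
  qed
  have vanish: "vanishes_outside R (\<lambda>u. of_real (derived_kernel r m (a l u)) * h u)"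
    if "m > r" "norm l \<le> L" for r m l and h :: "complex ^ 'n \<Rightarrow> complex"
    unfolding vanishes_outside_def a_def R_def using line_derived_kernel_vanishes[OF that, of \<rho> \<omega>] by auto
  have int: "integrable lborel (\<lambda>u. of_real (derived_kernel r m (a l u)) * e i j l u)" if "m > r" "norm l \<le> L" for r m i j l
    by (rule integrable_compact_support[OF _ vanish[OF that]])
       (intro continuous_on_mult continuous_on_of_real continuous_on_derived_kernel ac ec)
  have "((\<lambda>t. LINT u|lborel. of_real (derived_kernel r (Suc m) (a (\<mu> + of_real t * v) u)) * e i j (\<mu> + of_real t * v) u) has_vector_derivative
      (LINT u|lborel. F' (\<mu> + of_real 0 * v) u)) (at 0)"
  proof (rule leibniz_compact_support[where U = "{-1<..<1}" and R = R])
    fix t :: real and u assume t: "t \<in> {-1<..<1}"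
    let ?l = "\<mu> + of_real t * v"
    have "norm (of_real t * v) \<le> norm v" using t by (auto simp: norm_mult mult_left_le_one_le)
    then have lL: "norm ?l \<le> L" unfolding L_def by (intro order_trans[OF norm_triangle_ineq]) simp
    have da: "((\<lambda>t. a (\<mu> + of_real t * v) u) has_real_derivative 2 * Re (v * ?x u)) (at t)"
    proof -
      have "a (\<mu> + of_real t * v) u = (\<rho> - (norm u)\<^sup>2 + 2 * Re (\<mu> * ?x u)) + t * (2 * Re (v * ?x u))" for t
        by (simp add: a_def algebra_simps)
      then show ?thesis by (auto intro!: derivative_eq_intros)
    qed
    have dk: "((\<lambda>t. complex_of_real (derived_kernel r (Suc m) (a (\<mu> + of_real t * v) u))) has_vector_derivative
        of_real (derived_kernel r m (a ?l u) * (2 * Re (v * ?x u)))) (at t)"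
      using DERIV_chain2[OF derived_kernel_has_derivative[OF m] da]
      by (intro has_vector_derivative_of_real) (simp add: has_real_derivative_iff_has_vector_derivative)
    have de: "((\<lambda>t. e i j (\<mu> + of_real t * v) u) has_vector_derivative - (v * ?x u / 2) * e i j ?l u) (at t)"
    proof -
      have "((\<lambda>t. - (\<mu> * ?x u / 2) + t *\<^sub>R (- (v * ?x u / 2))) has_vector_derivative - (v * ?x u / 2)) (at t)"
        by (auto intro!: derivative_eq_intros)
      moreover have "- (\<mu> * ?x u / 2) + t *\<^sub>R (- (v * ?x u / 2)) = - ((\<mu> + of_real t * v) * ?x u / 2)" for t
        by (simp add: scaleR_conv_of_real field_simps)
      ultimately have "((\<lambda>t. - ((\<mu> + of_real t * v) * ?x u / 2)) has_vector_derivative - (v * ?x u / 2)) (at t)"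
        by simp
      from has_vector_derivative_mult_right[OF field_vector_diff_chain_at[OF this DERIV_exp],
          of "?x u ^ i * cnj (?x u) ^ j * g u"]
      show ?thesis by (simp add: o_def e_def mult_ac)
    qed
    have "of_real (derived_kernel r (Suc m) (a ?l u)) * (- (v * ?x u / 2) * e i j ?l u)
        + of_real (derived_kernel r m (a ?l u) * (2 * Re (v * ?x u))) * e i j ?l u = F' ?l u"
    proof -
      \<comment> \<open>Splitting the derivative into its linear and antilinear part in \<open>v\<close>; the exponential contributes
        to the linear part only, which turns \<open>derived_kernel r\<close> into \<open>derived_kernel (Suc r)\<close>.\<close>
      have "complex_of_real (2 * Re (v * ?x u)) = v * ?x u + cnj v * cnj (?x u)"
        by (simp add: complex_eq_iff)
      then show ?thesis unfolding of_real_mult F'_def e_def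
        by (simp add: algebra_simps)
    qed
    with has_vector_derivative_mult[OF dk de]
    show "((\<lambda>t. of_real (derived_kernel r (Suc m) (a (\<mu> + of_real t * v) u)) * e i j (\<mu> + of_real t * v) u) has_vector_derivative F' ?l u) (at t)"
      by simp
    show "continuous_on UNIV (\<lambda>u. of_real (derived_kernel r (Suc m) (a ?l u)) * e i j ?l u)"
      by (intro continuous_on_mult continuous_on_of_real continuous_on_derived_kernel ac ec)
    show "vanishes_outside R (\<lambda>u. of_real (derived_kernel r (Suc m) (a ?l u)) * e i j ?l u)"
      using m by (intro vanish lL) simp
  next
    let ?X = "{-1<..<1::real} \<times> (UNIV :: (complex ^ 'n) set)"
    have a2: "continuous_on ?X (\<lambda>y. a (\<mu> + of_real (fst y) * v) (snd y))"
      unfolding a_def by (intro continuous_intros)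
    have e2: "continuous_on ?X (\<lambda>y. e i j (\<mu> + of_real (fst y) * v) (snd y))" for i j
    proof -
      have 1: "continuous_on ?X (\<lambda>y. ?x (snd y) ^ i * cnj (?x (snd y)) ^ j)"
        and 2: "continuous_on ?X (\<lambda>y. exp (- ((\<mu> + of_real (fst y) * v) * ?x (snd y) / 2)))"
        by (intro continuous_intros; simp)+
      have 3: "continuous_on ?X (\<lambda>y. g (snd y))"
        by (rule continuous_on_compose2[OF g]) (auto intro!: continuous_intros)
      show ?thesis unfolding e_def by (rule continuous_on_mult[OF continuous_on_mult[OF 1 3] 2])
    qed
    show "continuous_on ?X (\<lambda>(t, u). F' (\<mu> + of_real t * v) u)"
      unfolding split_beta F'_def
      by (intro continuous_on_add continuous_on_mult continuous_on_const continuous_on_of_real continuous_on_derived_kernel a2 e2)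
  qed auto
  also have "(LINT u|lborel. F' (\<mu> + of_real 0 * v) u) =
      v * line_moment g \<omega> \<rho> (Suc r) (Suc m) (Suc i) j \<mu> + cnj v * line_moment g \<omega> \<rho> r m i (Suc j) \<mu>"
  proof -
    have l0: "norm \<mu> \<le> L" by (simp add: L_def)
    have "integrable lborel (\<lambda>u. v * (of_real (derived_kernel (Suc r) (Suc m) (a \<mu> u)) * e (Suc i) j \<mu> u))"
      "integrable lborel (\<lambda>u. cnj v * (of_real (derived_kernel r m (a \<mu> u)) * e i (Suc j) \<mu> u))"
      using m by (intro integrable_mult_right int l0; simp)+
    then show ?thesis unfolding F'_def lm by (simp del: derived_kernel.simps)
  qed
  finally show ?thesis unfolding lm .
qed

text \<open>
  A function of \<open>\<mu>\<close> that vanishes identically has vanishing derivatives along \<open>1\<close> and along \<open>\<i>\<close>,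
  hence vanishing Wirtinger derivatives.
\<close>

lemma line_moment_eq_0_step:
  fixes \<omega> :: "complex ^ 'n"
  assumes m: "m > r" and g: "continuous_on UNIV g"
    and zero: "\<And>\<mu>. line_moment g \<omega> \<rho> r (Suc m) i j \<mu> = 0"
  shows "line_moment g \<omega> \<rho> (Suc r) (Suc m) (Suc i) j \<mu> = 0" "line_moment g \<omega> \<rho> r m i (Suc j) \<mu> = 0"
proof -
  have "v * line_moment g \<omega> \<rho> (Suc r) (Suc m) (Suc i) j \<mu> + cnj v * line_moment g \<omega> \<rho> r m i (Suc j) \<mu> = 0" for v
    using line_moment_has_derivative[OF m g, of \<omega> \<rho> i j \<mu> v] vector_derivative_unique_at[OF _ has_vector_derivative_const]
    unfolding zero by blast
  from this[of 1] this[of \<i>]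
  show "line_moment g \<omega> \<rho> (Suc r) (Suc m) (Suc i) j \<mu> = 0" "line_moment g \<omega> \<rho> r m i (Suc j) \<mu> = 0"
    by (auto simp: add_eq_0_iff)
qed

text \<open>
  Differentiating \<open>p\<close> times in \<open>\<mu>\<close> and \<open>q\<close> times in its conjugate. The hypothesis concerns the
  whole complex line through \<open>\<omega>\<close>; this is where the set has to be a complex cone.
\<close>

lemma line_moment_eq_0:
  fixes f :: "complex ^ 'n \<Rightarrow> complex"
  assumes f: "continuous_on UNIV f" and mean: "\<And>r l. r > 0 \<Longrightarrow> twisted_spherical_mean f r (l *s \<omega>) = 0"
    and m: "m > p"
  defines "g \<equiv> \<lambda>u. f u * of_real (exp ((norm u)\<^sup>2 / 4))"
  shows "line_moment g \<omega> \<rho> p m p q \<mu> = 0"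
  using m
proof (induction q arbitrary: m \<mu>)
  have g: "continuous_on UNIV g"
    unfolding g_def by (intro continuous_on_mult f continuous_intros; simp)
  {
    case 0
    then show ?case
    proof (induction p arbitrary: m \<mu>)
      case 0
      define z where "z = \<mu> *s \<omega>"
      have hz: "hermitian_product z u = \<mu> * hermitian_product \<omega> u" for u
        by (simp add: z_def hermitian_product_def sum_distrib_left mult.assoc)
      have "(LINT u|lborel. of_real (trunc_power m (\<rho> + (norm z)\<^sup>2 - (norm (z - u))\<^sup>2)) *
          (f u * of_real (exp ((norm u)\<^sup>2 / 4)) * exp (- (hermitian_product z u / 2)))) = 0"
        using 0 mean by (intro twisted_means_0_imp_shifted_trunc_integral_0[OF f]) (auto simp: z_def)
      moreover have "\<rho> + (norm z)\<^sup>2 - (norm (z - u))\<^sup>2 = \<rho> - (norm u)\<^sup>2 + 2 * Re (\<mu> * hermitian_product \<omega> u)" for u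
        unfolding norm_diff_hermitian hz by simp
      ultimately show ?case by (simp add: line_moment_def g_def hz)
    next
      case (Suc p)
      then obtain l where l: "m = Suc l" "l > p" by (cases m) auto
      show ?case unfolding l(1)
        by (rule line_moment_eq_0_step(1)[OF l(2) g]) (use Suc.IH l in auto)
    qed
  next
    case (Suc q)
    show ?case
      by (rule line_moment_eq_0_step(2)[OF _ g]) (use Suc in auto)
  }
qed

section \<open>Integrals against the derived kernels\<close>

definition kernel_integral :: "nat \<Rightarrow> nat \<Rightarrow> real \<Rightarrow> (complex ^ 'n \<Rightarrow> complex) \<Rightarrow> complex" where
  "kernel_integral r m \<rho> F = (LINT u|lborel. of_real (derived_kernel r m (\<rho> - (norm u)\<^sup>2)) * F u)"

text \<open>
  Integrals are additive on integrable functions only, so linearity is asked for on continuous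
  functions, where the weighted integrals satisfy it.
\<close>

definition linear_on_continuous :: "((complex ^ 'n \<Rightarrow> complex) \<Rightarrow> complex) \<Rightarrow> bool" where
  "linear_on_continuous \<Lambda> \<longleftrightarrow>
    (\<forall>F G. continuous_on UNIV F \<longrightarrow> continuous_on UNIV G \<longrightarrow> \<Lambda> (\<lambda>u. F u + G u) = \<Lambda> F + \<Lambda> G) \<and>
    (\<forall>c F. continuous_on UNIV F \<longrightarrow> \<Lambda> (\<lambda>u. c * F u) = c * \<Lambda> F)"

lemma linear_on_continuousD:
  assumes "linear_on_continuous \<Lambda>" "continuous_on UNIV F"
  shows "continuous_on UNIV G \<Longrightarrow> \<Lambda> (\<lambda>u. F u + G u) = \<Lambda> F + \<Lambda> G" "\<Lambda> (\<lambda>u. c * F u) = c * \<Lambda> F"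
  using assms by (auto simp: linear_on_continuous_def)

lemma linear_on_continuous_sum:
  assumes \<Lambda>: "linear_on_continuous \<Lambda>" and F: "\<And>i. i \<in> A \<Longrightarrow> continuous_on UNIV (F i)"
  shows "\<Lambda> (\<lambda>u. \<Sum>i\<in>A. F i u) = (\<Sum>i\<in>A. \<Lambda> (F i))"
proof -
  have zero: "\<Lambda> (\<lambda>u. 0) = 0"
    using linear_on_continuousD(2)[OF \<Lambda> continuous_on_const, of 0 0] by simp
  show ?thesis
    using F
  proof (induction A rule: infinite_finite_induct)
    case (insert i A)
    have "continuous_on UNIV (\<lambda>u. \<Sum>i\<in>A. F i u)"
      using insert.prems by (intro continuous_on_sum) auto
    then have "\<Lambda> (\<lambda>u. F i u + (\<Sum>i\<in>A. F i u)) = \<Lambda> (F i) + \<Lambda> (\<lambda>u. \<Sum>i\<in>A. F i u)"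
      using insert.prems by (intro linear_on_continuousD(1)[OF \<Lambda>]) auto
    then show ?case using insert by simp
  qed (simp_all add: zero)
qed

lemma integrable_kernel_mult:
  fixes F :: "complex ^ 'n \<Rightarrow> complex"
  assumes m: "m > r" and F: "continuous_on UNIV F"
  shows "integrable lborel (\<lambda>u::complex ^ 'n. of_real (derived_kernel r m (\<rho> - (norm u)\<^sup>2)) * F u)"
proof (rule integrable_compact_support)
  have "continuous_on UNIV (\<lambda>u::complex ^ 'n. \<rho> - (norm u)\<^sup>2)" by (intro continuous_intros)
  then show "continuous_on UNIV (\<lambda>u::complex ^ 'n. of_real (derived_kernel r m (\<rho> - (norm u)\<^sup>2)) * F u)"
    by (intro continuous_on_mult continuous_on_of_real continuous_on_derived_kernel F)
  show "vanishes_outside (\<bar>\<rho>\<bar> + 1) (\<lambda>u::complex ^ 'n. of_real (derived_kernel r m (\<rho> - (norm u)\<^sup>2)) * F u)"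
    using line_derived_kernel_vanishes[OF m, of 0 0 \<rho>] by (auto simp: vanishes_outside_def)
qed

lemma linear_on_continuous_kernel_integral:
  "m > r \<Longrightarrow> linear_on_continuous (kernel_integral r m \<rho>)"
  unfolding linear_on_continuous_def kernel_integral_def
  by (simp add: distrib_left integrable_kernel_mult mult.left_commute)

lemma kernel_integral_0: "kernel_integral 0 m \<rho> F = trunc_integral m \<rho> F"
  by (simp add: kernel_integral_def trunc_integral_def)

lemma kernel_integral_Suc:
  assumes m: "m > r" and F: "continuous_on UNIV F"
  shows "kernel_integral (Suc r) (Suc m) \<rho> F = kernel_integral r m \<rho> F - kernel_integral r (Suc m) \<rho> F / 2"
proof -
  have i: "integrable lborel (\<lambda>u. of_real (derived_kernel r m (\<rho> - (norm u)\<^sup>2)) * F u)"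
    "integrable lborel (\<lambda>u. of_real (derived_kernel r (Suc m) (\<rho> - (norm u)\<^sup>2)) * F u)"
    using m by (intro integrable_kernel_mult F; simp)+
  have "kernel_integral (Suc r) (Suc m) \<rho> F = (LINT u|lborel. of_real (derived_kernel r m (\<rho> - (norm u)\<^sup>2)) * F u
      - of_real (derived_kernel r (Suc m) (\<rho> - (norm u)\<^sup>2)) * F u / 2)"
    unfolding kernel_integral_def by (intro Bochner_Integration.integral_cong refl) (simp add: algebra_simps)
  also have "\<dots> = kernel_integral r m \<rho> F - kernel_integral r (Suc m) \<rho> F / 2"
    unfolding kernel_integral_def
    by (subst Bochner_Integration.integral_diff[OF i(1) integrable_divide_zero]) (simp_all add: i)
  finally show ?thesis .
qed

lemma kernel_integral_has_derivative:
  assumes F: "continuous_on UNIV F"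
  shows "m > r \<Longrightarrow> ((\<lambda>\<rho>. kernel_integral r (Suc m) \<rho> F) has_vector_derivative kernel_integral r m \<rho> F) (at \<rho>)"
proof (induction r arbitrary: m)
  case 0
  then show ?case
    unfolding kernel_integral_0 by (intro trunc_integral_has_derivative F) simp
next
  case (Suc r)
  then obtain l where l: "m = Suc l" "l > r" by (cases m) auto
  have "((\<lambda>\<rho>. kernel_integral r (Suc l) \<rho> F - kernel_integral r (Suc (Suc l)) \<rho> F / 2) has_vector_derivative
      kernel_integral r l \<rho> F - kernel_integral r (Suc l) \<rho> F / 2) (at \<rho>)"
    using l(2) by (intro has_vector_derivative_diff has_vector_derivative_divide Suc.IH) auto
  then show ?case using l F by (simp add: kernel_integral_Suc)
qed

text \<open>
  The hypothesis says that \<open>Y \<rho> = kernel_integral r (Suc m) \<rho> F\<close> solves \<open>Y' = Y / 2\<close>. Since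
  \<open>Y 0 = 0\<close>, it vanishes identically, and so does its derivative.
\<close>

lemma kernel_integral_peel:
  assumes F: "continuous_on UNIV F" and zero: "\<And>m \<rho>. m > Suc r \<Longrightarrow> kernel_integral (Suc r) m \<rho> F = 0" and m: "m > r"
  shows "kernel_integral r m \<rho> F = 0"
proof -
  let ?Y = "\<lambda>\<rho>. kernel_integral r (Suc m) \<rho> F"
  have ode: "kernel_integral r m \<rho> F = ?Y \<rho> / 2" for \<rho>
    using zero[of "Suc m" \<rho>] m by (simp add: kernel_integral_Suc[OF m F])
  \<comment> \<open>The integrating factor of the equation \<open>Y' = Y / 2\<close>.\<close>
  have "((\<lambda>\<rho>. ?Y \<rho> * of_real (exp (- (\<rho> / 2)))) has_vector_derivative 0) (at \<rho>)" for \<rho>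
  proof -
    have "((\<lambda>\<rho>. complex_of_real (exp (- (\<rho> / 2)))) has_vector_derivative of_real (- (1 / 2) * exp (- (\<rho> / 2)))) (at \<rho>)"
      by (intro has_vector_derivative_of_real)
         (auto intro!: derivative_eq_intros simp: has_real_derivative_iff_has_vector_derivative[symmetric])
    from has_vector_derivative_mult[OF kernel_integral_has_derivative[OF F m] this]
    show ?thesis unfolding ode by (simp add: field_simps)
  qed
  then obtain c where c: "\<And>\<rho>. ?Y \<rho> * of_real (exp (- (\<rho> / 2))) = c"
    using has_vector_derivative_zero_constant[of UNIV "\<lambda>\<rho>. ?Y \<rho> * of_real (exp (- (\<rho> / 2)))"] by auto
  have "?Y 0 = 0"
    unfolding kernel_integral_def using m by (simp add: derived_kernel_nonpos)
  then have "?Y \<rho> = 0" using c[of 0] c[of \<rho>] by simp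
  then show ?thesis unfolding ode by simp
qed

lemma kernel_integral_peel_all:
  assumes F: "continuous_on UNIV F" and zero: "\<And>m \<rho>. m > r \<Longrightarrow> kernel_integral r m \<rho> F = 0" and m: "m > 0"
  shows "kernel_integral 0 m \<rho> F = 0"
  using zero m
proof (induction r arbitrary: m \<rho>)
  case 0
  then show ?case by blast
next
  case (Suc r)
  have "kernel_integral r m \<rho> F = 0" if "m > r" for m \<rho>
    by (rule kernel_integral_peel[OF F _ that]) (rule Suc.prems(1))
  then show ?case using Suc.IH Suc.prems(2) by blast
qed

text \<open>
  On the weights, multiplication by \<open>(norm u)^2 = \<rho> - (\<rho> - (norm u)^2)\<close> is a combination of
  \<open>trunc_power m\<close> and \<open>trunc_power (Suc m)\<close>.
\<close>

lemma kernel_integral_norm_square: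
  assumes F: "continuous_on UNIV F" and zero: "\<And>m \<rho>. m > 0 \<Longrightarrow> kernel_integral 0 m \<rho> F = 0" and m: "m > r"
  shows "kernel_integral r m \<rho> (\<lambda>u. of_real ((norm u)\<^sup>2) * F u) = 0"
  using m
proof (induction r arbitrary: m)
  case 0
  have "of_real (trunc_power m (\<rho> - (norm u)\<^sup>2)) * (of_real ((norm u)\<^sup>2) * F u) =
      of_real \<rho> * (of_real (trunc_power m (\<rho> - (norm u)\<^sup>2)) * F u)
      - of_real (real (Suc m)) * (of_real (trunc_power (Suc m) (\<rho> - (norm u)\<^sup>2)) * F u)" for u
  proof -
    have "complex_of_real ((\<rho> - (norm u)\<^sup>2) * trunc_power m (\<rho> - (norm u)\<^sup>2)) =
        of_real (real (Suc m) * trunc_power (Suc m) (\<rho> - (norm u)\<^sup>2))"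
      using 0 by (simp only: mult_trunc_power[of m "\<rho> - (norm u)\<^sup>2"] Suc_le_eq One_nat_def)
    then have eq: "complex_of_real (norm u)^2 * of_real (trunc_power m (\<rho> - (norm u)\<^sup>2)) =
        of_real \<rho> * of_real (trunc_power m (\<rho> - (norm u)\<^sup>2)) - of_real (real (Suc m)) * of_real (trunc_power (Suc m) (\<rho> - (norm u)\<^sup>2))"
      by (simp add: algebra_simps)
    have "of_real (trunc_power m (\<rho> - (norm u)\<^sup>2)) * (of_real ((norm u)\<^sup>2) * F u) =
        (complex_of_real (norm u)^2 * of_real (trunc_power m (\<rho> - (norm u)\<^sup>2))) * F u"
      by simp
    then show ?thesis unfolding eq by (simp add: algebra_simps)
  qed
  then have "kernel_integral 0 m \<rho> (\<lambda>u. of_real ((norm u)\<^sup>2) * F u) =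
      (LINT u|lborel. of_real \<rho> * (of_real (derived_kernel 0 m (\<rho> - (norm u)\<^sup>2)) * F u)
      - of_real (real (Suc m)) * (of_real (derived_kernel 0 (Suc m) (\<rho> - (norm u)\<^sup>2)) * F u))"
    by (simp add: kernel_integral_def)
  also have "\<dots> = of_real \<rho> * kernel_integral 0 m \<rho> F - of_real (real (Suc m)) * kernel_integral 0 (Suc m) \<rho> F"
    unfolding kernel_integral_def
    using integrable_kernel_mult[OF _ F, of 0 m \<rho>] integrable_kernel_mult[OF _ F, of 0 "Suc m" \<rho>] 0
    by (subst Bochner_Integration.integral_diff) (auto intro!: integrable_mult_right simp del: derived_kernel.simps)
  finally show ?case using zero 0 by simp
next
  case (Suc r)
  then obtain l where l: "m = Suc l" "l > r" by (cases m) auto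
  have "continuous_on UNIV (\<lambda>u. of_real ((norm u)\<^sup>2) * F u)"
    by (rule continuous_on_mult[OF _ F]) (intro continuous_intros)
  then show ?case
    using Suc.IH[of l] Suc.IH[of "Suc l"] l by (simp add: kernel_integral_Suc)
qed

section \<open>Moments of a continuous function\<close>

text \<open>
  As a function of \<open>z\<close>, a bihomogeneous polynomial of bidegree \<open>(p, q)\<close>. When \<open>\<Lambda>\<close> is a radial integral,
  it carries the components of \<open>h\<close> in the spaces of harmonics of bidegrees \<open>(p - j, q - j)\<close>.
\<close>

definition moment ::
    "((complex ^ 'n \<Rightarrow> complex) \<Rightarrow> complex) \<Rightarrow> nat \<Rightarrow> nat \<Rightarrow> (complex ^ 'n \<Rightarrow> complex) \<Rightarrow> complex ^ 'n \<Rightarrow> complex" where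
  "moment \<Lambda> p q h z = \<Lambda> (\<lambda>u. h u * (hermitian_product z u ^ p * cnj (hermitian_product z u) ^ q))"

lemma continuous_on_component_mult:
  assumes "continuous_on UNIV (h :: complex ^ 'n \<Rightarrow> complex)"
  shows "continuous_on UNIV (\<lambda>u. u $ k * h u)" "continuous_on UNIV (\<lambda>u. cnj (u $ k) * h u)"
  by (rule continuous_on_mult[OF _ assms], intro continuous_intros)+

lemma continuous_on_moment_integrand:
  assumes "continuous_on UNIV (h :: complex ^ 'n \<Rightarrow> complex)"
  shows "continuous_on UNIV (\<lambda>u. h u * (hermitian_product z u ^ p * cnj (hermitian_product z u) ^ q))"
  by (rule continuous_on_mult[OF assms]) (intro continuous_intros)

context
  fixes \<Lambda> :: "(complex ^ 'n \<Rightarrow> complex) \<Rightarrow> complex"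
  assumes \<Lambda>: "linear_on_continuous \<Lambda>"
begin

lemma moment_Suc_left:
  assumes h: "continuous_on UNIV h"
  shows "moment \<Lambda> (Suc p) q h z = (\<Sum>k\<in>UNIV. z $ k * moment \<Lambda> p q (\<lambda>u. cnj (u $ k) * h u) z)"
proof -
  let ?m = "\<lambda>u. hermitian_product z u ^ p * cnj (hermitian_product z u) ^ q"
  have c: "continuous_on UNIV (\<lambda>u. cnj (u $ k) * h u * ?m u)" for k
    by (rule continuous_on_moment_integrand[OF continuous_on_component_mult(2)[OF h]])
  have "h u * (hermitian_product z u ^ Suc p * cnj (hermitian_product z u) ^ q)
      = (\<Sum>k\<in>UNIV. z $ k * (cnj (u $ k) * h u * ?m u))" for u
  proof -
    have "h u * (hermitian_product z u ^ Suc p * cnj (hermitian_product z u) ^ q) = hermitian_product z u * (h u * ?m u)"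
      by (simp add: mult_ac)
    also have "\<dots> = (\<Sum>k\<in>UNIV. z $ k * cnj (u $ k) * (h u * ?m u))"
      unfolding hermitian_product_def[of z u, THEN arg_cong[where f = "\<lambda>x. x * _"]] by (rule sum_distrib_right)
    finally show ?thesis by (simp add: mult_ac)
  qed
  then have "moment \<Lambda> (Suc p) q h z = \<Lambda> (\<lambda>u. \<Sum>k\<in>UNIV. z $ k * (cnj (u $ k) * h u * ?m u))"
    by (simp add: moment_def)
  also have "\<dots> = (\<Sum>k\<in>UNIV. \<Lambda> (\<lambda>u. z $ k * (cnj (u $ k) * h u * ?m u)))"
    by (rule linear_on_continuous_sum[OF \<Lambda>]) (intro continuous_on_mult[OF continuous_on_const] c)
  finally show ?thesis
    by (simp only: linear_on_continuousD(2)[OF \<Lambda> c] moment_def)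
qed

lemma moment_Suc_right:
  assumes h: "continuous_on UNIV h"
  shows "moment \<Lambda> p (Suc q) h z = (\<Sum>k\<in>UNIV. cnj (z $ k) * moment \<Lambda> p q (\<lambda>u. u $ k * h u) z)"
proof -
  let ?m = "\<lambda>u. hermitian_product z u ^ p * cnj (hermitian_product z u) ^ q"
  have c: "continuous_on UNIV (\<lambda>u. u $ k * h u * ?m u)" for k
    by (rule continuous_on_moment_integrand[OF continuous_on_component_mult(1)[OF h]])
  have "h u * (hermitian_product z u ^ p * cnj (hermitian_product z u) ^ Suc q)
      = (\<Sum>k\<in>UNIV. cnj (z $ k) * (u $ k * h u * ?m u))" for u
  proof -
    have "h u * (hermitian_product z u ^ p * cnj (hermitian_product z u) ^ Suc q) = cnj (hermitian_product z u) * (h u * ?m u)"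
      by (simp add: mult_ac)
    also have "\<dots> = (\<Sum>k\<in>UNIV. cnj (z $ k) * u $ k) * (h u * ?m u)"
    proof -
      have "cnj (hermitian_product z u) = (\<Sum>k\<in>UNIV. cnj (z $ k) * u $ k)"
        by (simp add: hermitian_product_def)
      then show ?thesis by (simp only:)
    qed
    also have "\<dots> = (\<Sum>k\<in>UNIV. cnj (z $ k) * u $ k * (h u * ?m u))"
      by (rule sum_distrib_right)
    finally show ?thesis by (simp add: mult_ac)
  qed
  then have "moment \<Lambda> p (Suc q) h z = \<Lambda> (\<lambda>u. \<Sum>k\<in>UNIV. cnj (z $ k) * (u $ k * h u * ?m u))"
    by (simp add: moment_def)
  also have "\<dots> = (\<Sum>k\<in>UNIV. \<Lambda> (\<lambda>u. cnj (z $ k) * (u $ k * h u * ?m u)))"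
    by (rule linear_on_continuous_sum[OF \<Lambda>]) (intro continuous_on_mult[OF continuous_on_const] c)
  finally show ?thesis
    by (simp only: linear_on_continuousD(2)[OF \<Lambda> c] moment_def)
qed

lemma bipoly_moment:
  assumes "continuous_on UNIV h"
  shows "bipoly p q (moment \<Lambda> p q h)"
  using assms
proof (induction p arbitrary: h)
  case 0
  then show ?case
  proof (induction q arbitrary: h)
    case 0
    have "moment \<Lambda> 0 0 h = (\<lambda>z. \<Lambda> h)" by (simp add: moment_def fun_eq_iff)
    then show ?case by (simp add: bipoly.const)
  next
    case (Suc q)
    have "bipoly 0 (Suc q) (\<lambda>z. \<Sum>k\<in>UNIV. cnj (z $ k) * moment \<Lambda> 0 q (\<lambda>u. u $ k * h u) z)"
      by (intro bipoly_sum bipoly.cnj_mult Suc.IH continuous_on_component_mult Suc.prems)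
    then show ?case by (simp only: moment_Suc_right[OF Suc.prems, abs_def])
  qed
next
  case (Suc p)
  have "bipoly (Suc p) q (\<lambda>z. \<Sum>k\<in>UNIV. z $ k * moment \<Lambda> p q (\<lambda>u. cnj (u $ k) * h u) z)"
    by (intro bipoly_sum bipoly.component_mult Suc.IH continuous_on_component_mult Suc.prems)
  then show ?case by (simp only: moment_Suc_left[OF Suc.prems, abs_def])
qed

lemma wirtinger_z_moment:
  assumes "continuous_on UNIV h"
  shows "wirtinger_z k (moment \<Lambda> p q h) = (\<lambda>z. of_nat p * moment \<Lambda> (p - 1) q (\<lambda>u. cnj (u $ k) * h u) z)"
  using assms
proof (induction p arbitrary: h)
  case 0
  then show ?case using bipoly_wirtinger_z[OF bipoly_moment[OF 0, of 0 q]] by simp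
next
  case (Suc p)
  let ?M = "\<lambda>j. moment \<Lambda> p q (\<lambda>u. cnj (u $ j) * h u)"
  note ch = continuous_on_component_mult(2)[OF Suc.prems]
  have M: "bipoly p q (?M j)" for j by (rule bipoly_moment[OF ch])
  show ?case
  proof
    fix z
    have "wirtinger_z k (moment \<Lambda> (Suc p) q h) z = wirtinger_z k (\<lambda>z. \<Sum>j\<in>UNIV. z $ j * ?M j z) z"
      by (simp only: moment_Suc_left[OF Suc.prems, abs_def])
    also have "\<dots> = (\<Sum>j\<in>UNIV. wirtinger_z k (\<lambda>z. z $ j * ?M j z) z)"
      by (subst wirtinger_sum(1)[of UNIV "Suc p" q]) (simp_all add: bipoly.component_mult M)
    also have "\<dots> = (\<Sum>j\<in>UNIV. (if k = j then 1 else 0) * ?M j z + z $ j * wirtinger_z k (?M j) z)"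
      by (simp only: wirtinger_component_mult(1)[OF M])
    also have "\<dots> = ?M k z + (\<Sum>j\<in>UNIV. z $ j * wirtinger_z k (?M j) z)"
      by (simp add: sum.distrib mult_delta_left)
    also have "(\<Sum>j\<in>UNIV. z $ j * wirtinger_z k (?M j) z)
        = of_nat p * (\<Sum>j\<in>UNIV. z $ j * moment \<Lambda> (p - 1) q (\<lambda>u. cnj (u $ j) * (cnj (u $ k) * h u)) z)"
      unfolding Suc.IH[OF ch] by (simp add: sum_distrib_left mult_ac)
    also have "\<dots> = of_nat p * ?M k z"
      using moment_Suc_left[OF ch[of k], of "p - 1" q z] by (cases p) simp_all
    finally show "wirtinger_z k (moment \<Lambda> (Suc p) q h) z = of_nat (Suc p) * moment \<Lambda> (Suc p - 1) q (\<lambda>u. cnj (u $ k) * h u) z"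
      by (simp add: algebra_simps)
  qed
qed

lemma wirtinger_zbar_moment:
  assumes "continuous_on UNIV h"
  shows "wirtinger_zbar k (moment \<Lambda> p q h) = (\<lambda>z. of_nat q * moment \<Lambda> p (q - 1) (\<lambda>u. u $ k * h u) z)"
  using assms
proof (induction q arbitrary: h)
  case 0
  then show ?case using bipoly_wirtinger_zbar[OF bipoly_moment[OF 0, of p 0]] by simp
next
  case (Suc q)
  let ?M = "\<lambda>j. moment \<Lambda> p q (\<lambda>u. u $ j * h u)"
  note ch = continuous_on_component_mult(1)[OF Suc.prems]
  have M: "bipoly p q (?M j)" for j by (rule bipoly_moment[OF ch])
  show ?case
  proof
    fix z
    have "wirtinger_zbar k (moment \<Lambda> p (Suc q) h) z = wirtinger_zbar k (\<lambda>z. \<Sum>j\<in>UNIV. cnj (z $ j) * ?M j z) z"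
      by (simp only: moment_Suc_right[OF Suc.prems, abs_def])
    also have "\<dots> = (\<Sum>j\<in>UNIV. wirtinger_zbar k (\<lambda>z. cnj (z $ j) * ?M j z) z)"
      by (subst wirtinger_sum(2)[of UNIV p "Suc q"]) (simp_all add: bipoly.cnj_mult M)
    also have "\<dots> = (\<Sum>j\<in>UNIV. (if k = j then 1 else 0) * ?M j z + cnj (z $ j) * wirtinger_zbar k (?M j) z)"
      by (simp only: wirtinger_cnj_mult(2)[OF M])
    also have "\<dots> = ?M k z + (\<Sum>j\<in>UNIV. cnj (z $ j) * wirtinger_zbar k (?M j) z)"
      by (simp add: sum.distrib mult_delta_left)
    also have "(\<Sum>j\<in>UNIV. cnj (z $ j) * wirtinger_zbar k (?M j) z)
        = of_nat q * (\<Sum>j\<in>UNIV. cnj (z $ j) * moment \<Lambda> p (q - 1) (\<lambda>u. u $ j * (u $ k * h u)) z)"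
      unfolding Suc.IH[OF ch] by (simp add: sum_distrib_left mult_ac)
    also have "\<dots> = of_nat q * ?M k z"
      using moment_Suc_right[OF ch[of k], of p "q - 1" z] by (cases q) simp_all
    finally show "wirtinger_zbar k (moment \<Lambda> p (Suc q) h) z = of_nat (Suc q) * moment \<Lambda> p (Suc q - 1) (\<lambda>u. u $ k * h u) z"
      by (simp add: algebra_simps)
  qed
qed

text \<open>
  Each differentiation in \<open>z\<close> moves a factor \<open>cnj (u $ k)\<close> or \<open>u $ k\<close> under \<open>\<Lambda>\<close>, and the sum of their
  products over \<open>k\<close> is \<open>(norm u)^2\<close>. A moment is thus harmonic as soon as the moments of bidegree
  \<open>(p - 1, q - 1)\<close> vanish.
\<close>

lemma laplacian_moment:
  assumes h: "continuous_on UNIV h"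
  shows "laplacian (moment \<Lambda> p q h) z =
    4 * of_nat p * of_nat q * moment \<Lambda> (p - 1) (q - 1) (\<lambda>u. of_real ((norm u)\<^sup>2) * h u) z"
proof -
  let ?m = "\<lambda>u. hermitian_product z u ^ (p - 1) * cnj (hermitian_product z u) ^ (q - 1)"
  note ch = continuous_on_component_mult(1)[OF h]
  have c: "continuous_on UNIV (\<lambda>u. cnj (u $ k) * (u $ k * h u) * ?m u)" for k
    by (rule continuous_on_moment_integrand[OF continuous_on_component_mult(2)[OF ch]])
  have "wirtinger_z k (wirtinger_zbar k (moment \<Lambda> p q h)) z
      = of_nat q * (of_nat p * moment \<Lambda> (p - 1) (q - 1) (\<lambda>u. cnj (u $ k) * (u $ k * h u)) z)" for k
    unfolding wirtinger_zbar_moment[OF h]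
    by (simp only: wirtinger_cmult(1)[OF bipoly_moment[OF ch]] wirtinger_z_moment[OF ch])
  then have "laplacian (moment \<Lambda> p q h) z
      = 4 * of_nat p * of_nat q * (\<Sum>k\<in>UNIV. \<Lambda> (\<lambda>u. cnj (u $ k) * (u $ k * h u) * ?m u))"
    by (simp add: laplacian_def moment_def sum_distrib_left mult_ac)
  also have "(\<Sum>k\<in>UNIV. \<Lambda> (\<lambda>u. cnj (u $ k) * (u $ k * h u) * ?m u))
      = \<Lambda> (\<lambda>u. \<Sum>k\<in>UNIV. cnj (u $ k) * (u $ k * h u) * ?m u)"
    by (rule linear_on_continuous_sum[OF \<Lambda> c, symmetric])
  also have "(\<lambda>u. \<Sum>k\<in>UNIV. cnj (u $ k) * (u $ k * h u) * ?m u) = (\<lambda>u. of_real ((norm u)\<^sup>2) * h u * ?m u)"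
  proof
    fix u :: "complex ^ 'n"
    have "complex_of_real ((norm u)\<^sup>2) = (\<Sum>k\<in>UNIV. cnj (u $ k) * u $ k)"
    proof -
      have "(norm u)\<^sup>2 = (\<Sum>k\<in>UNIV. (norm (u $ k))\<^sup>2)"
        by (simp add: norm_vec_def L2_set_def sum_nonneg)
      then have "complex_of_real ((norm u)\<^sup>2) = (\<Sum>k\<in>UNIV. of_real ((norm (u $ k))\<^sup>2))"
        by (simp only: of_real_sum)
      then show ?thesis by (simp only: complex_norm_square mult.commute)
    qed
    then show "(\<Sum>k\<in>UNIV. cnj (u $ k) * (u $ k * h u) * ?m u) = of_real ((norm u)\<^sup>2) * h u * ?m u"
      by (simp add: sum_distrib_right mult.assoc)
  qed
  finally show ?thesis by (simp only: moment_def[of \<Lambda> "p - 1" "q - 1"])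
qed

end

text \<open>
  Polarisation: the moments of \<open>u $ k * h u\<close> are, up to positive factors, derivatives in \<open>z\<close> of
  moments of \<open>h\<close>.
\<close>

lemma moments_0_imp_component_moments_0:
  assumes \<Lambda>: "linear_on_continuous \<Lambda>" and h: "continuous_on UNIV h" and zero: "\<And>p q z. moment \<Lambda> p q h z = 0"
  shows "moment \<Lambda> p q (\<lambda>u. u $ k * h u) z = 0" "moment \<Lambda> p q (\<lambda>u. cnj (u $ k) * h u) z = 0"
proof -
  have 0: "moment \<Lambda> p q h = (\<lambda>z. 0)" for p q using zero by (simp add: fun_eq_iff)
  have "of_nat (Suc q) * moment \<Lambda> p (Suc q - 1) (\<lambda>u. u $ k * h u) z = 0"
    using fun_cong[OF wirtinger_zbar_moment[OF \<Lambda> h, of k p "Suc q"], of z] unfolding 0 wirtinger_const by (rule sym)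
  then show "moment \<Lambda> p q (\<lambda>u. u $ k * h u) z = 0" by (simp del: of_nat_Suc)
  have "of_nat (Suc p) * moment \<Lambda> (Suc p - 1) q (\<lambda>u. cnj (u $ k) * h u) z = 0"
    using fun_cong[OF wirtinger_z_moment[OF \<Lambda> h, of k "Suc p" q], of z] unfolding 0 wirtinger_const by (rule sym)
  then show "moment \<Lambda> p q (\<lambda>u. cnj (u $ k) * h u) z = 0" by (simp del: of_nat_Suc)
qed

lemma linear_on_continuous_moment:
  fixes z :: "complex ^ 'n"
  assumes \<Lambda>: "linear_on_continuous \<Lambda>"
  shows "linear_on_continuous (\<lambda>h. moment \<Lambda> p q h z)"
  unfolding linear_on_continuous_def moment_def
proof (intro conjI allI impI)
  fix F G :: "complex ^ 'n \<Rightarrow> complex" and c assume F: "continuous_on UNIV F"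
  note lin = linear_on_continuousD[OF \<Lambda> continuous_on_moment_integrand[OF F]]
  let ?m = "\<lambda>u. hermitian_product z u ^ p * cnj (hermitian_product z u) ^ q"
  show "\<Lambda> (\<lambda>u. c * F u * ?m u) = c * \<Lambda> (\<lambda>u. F u * ?m u)"
    by (simp only: mult.assoc[of c] lin(2))
  assume G: "continuous_on UNIV G"
  show "\<Lambda> (\<lambda>u. (F u + G u) * ?m u) = \<Lambda> (\<lambda>u. F u * ?m u) + \<Lambda> (\<lambda>u. G u * ?m u)"
    by (simp only: distrib_right lin(1)[OF continuous_on_moment_integrand[OF G]])
qed

lemma bounded_linear_complex_vec:
  fixes m :: "complex ^ 'n \<Rightarrow> real"
  assumes "bounded_linear m"
  shows "m u = (\<Sum>k\<in>UNIV. Re (u $ k) * m (axis k 1) + Im (u $ k) * m (axis k \<i>))"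
proof -
  interpret bounded_linear m by fact
  have "u = (\<Sum>k\<in>UNIV. Re (u $ k) *\<^sub>R axis k 1 + Im (u $ k) *\<^sub>R axis k \<i>)"
  proof (rule vec_eq_iff[THEN iffD2], rule allI)
    fix i
    have "(\<Sum>k\<in>UNIV. Re (u $ k) *\<^sub>R axis k 1 + Im (u $ k) *\<^sub>R axis k \<i>) $ i
        = (\<Sum>k\<in>UNIV. if k = i then u $ i else 0)"
      unfolding sum_component
      by (intro sum.cong refl) (auto simp: axis_def complex_eq_iff)
    then show "u $ i = (\<Sum>k\<in>UNIV. Re (u $ k) *\<^sub>R axis k 1 + Im (u $ k) *\<^sub>R axis k \<i>) $ i" by simp
  qed
  then have "m u = m (\<Sum>k\<in>UNIV. Re (u $ k) *\<^sub>R axis k 1 + Im (u $ k) *\<^sub>R axis k \<i>)" by (rule arg_cong)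
  then show ?thesis by (simp add: sum add scaleR)
qed

lemma continuous_on_real_polynomial_function: "real_polynomial_function m \<Longrightarrow> continuous_on S m"
  by (simp add: continuous_at_imp_continuous_on continuous_real_polymonial_function)

text \<open>
  The functions whose moments all vanish are closed under multiplication by coordinates and their
  conjugates, hence by polynomials.
\<close>

lemma moments_0_imp_polynomial_moments_0:
  fixes h :: "complex ^ 'n \<Rightarrow> complex"
  assumes \<Lambda>: "linear_on_continuous \<Lambda>" and m: "real_polynomial_function m"
    and h: "continuous_on UNIV h" and zero: "\<And>p q z. moment \<Lambda> p q h z = 0"
  shows "moment \<Lambda> p q (\<lambda>u. of_real (m u) * h u) z = 0"
  using m h zero
proof (induction m arbitrary: h p q z rule: real_polynomial_function.induct)
  case (linear m)
  let ?c = "\<lambda>k s. (of_real (m (axis k 1)) + s * \<i> * of_real (m (axis k \<i>))) / 2 :: complex"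
  have "of_real (m u) * h u = (\<Sum>k\<in>UNIV. ?c k (-1) * (u $ k * h u) + ?c k 1 * (cnj (u $ k) * h u))" for u
  proof -
    have Re_Im: "complex_of_real (Re a * x + Im a * y) =
        (of_real x + (-1) * \<i> * of_real y) / 2 * a + (of_real x + 1 * \<i> * of_real y) / 2 * cnj a"
      for a x y by (simp add: complex_eq_iff field_simps)
    have "complex_of_real (m u) = (\<Sum>k\<in>UNIV. ?c k (-1) * u $ k + ?c k 1 * cnj (u $ k))"
      unfolding bounded_linear_complex_vec[OF linear.hyps, of u] of_real_sum
      by (intro sum.cong refl Re_Im)
    then show ?thesis
      by (simp only: distrib_right sum_distrib_right mult.assoc)
  qed
  then have eq: "(\<lambda>u. of_real (m u) * h u) = (\<lambda>u. \<Sum>k\<in>UNIV. ?c k (-1) * (u $ k * h u) + ?c k 1 * (cnj (u $ k) * h u))"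
    by (rule ext)
  note ch = continuous_on_component_mult[OF linear.prems(1)]
  note M = linear_on_continuous_moment[OF \<Lambda>]
  have c: "continuous_on UNIV (\<lambda>u. d * (u $ k * h u))" "continuous_on UNIV (\<lambda>u. d * (cnj (u $ k) * h u))" for d k
    by (intro continuous_on_mult[OF continuous_on_const] ch)+
  have "moment \<Lambda> p q (\<lambda>u. of_real (m u) * h u) z
     = (\<Sum>k\<in>UNIV. moment \<Lambda> p q (\<lambda>u. ?c k (-1) * (u $ k * h u) + ?c k 1 * (cnj (u $ k) * h u)) z)"
    unfolding eq by (rule linear_on_continuous_sum[OF M]) (intro continuous_on_add c)
  also have "\<dots> = 0"
    by (simp only: linear_on_continuousD(1)[OF M c(1) c(2)] linear_on_continuousD(2)[OF M ch(1)]
        linear_on_continuousD(2)[OF M ch(2)] moments_0_imp_component_moments_0[OF \<Lambda> linear.prems]) simp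
  finally show ?case .
next
  case (const c)
  then show ?case
    using linear_on_continuousD(2)[OF linear_on_continuous_moment[OF \<Lambda>] const.prems(1)] by simp
next
  case (add f g)
  have c: "continuous_on UNIV (\<lambda>u. of_real (f u) * h u)" "continuous_on UNIV (\<lambda>u. of_real (g u) * h u)"
    by (intro continuous_on_mult continuous_on_of_real continuous_on_real_polynomial_function add.hyps add.prems)+
  then show ?case
    using linear_on_continuousD(1)[OF linear_on_continuous_moment[OF \<Lambda>] c] add.IH[OF add.prems]
    by (simp add: distrib_right)
next
  case (mult f g)
  have "continuous_on UNIV (\<lambda>u. of_real (g u) * h u)"
    by (intro continuous_on_mult continuous_on_of_real continuous_on_real_polynomial_function mult.hyps mult.prems)
  from mult.IH(1)[OF this mult.IH(2)[OF mult.prems]]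
  show ?case by (simp add: mult.assoc)
qed

text \<open>
  For a weight that is positive at \<open>z\<close>, the function is orthogonal to all polynomials, hence by the
  Stone-Weierstrass theorem to its own conjugate.
\<close>

lemma continuous_eq_0_if_moments_0:
  fixes g :: "complex ^ 'n \<Rightarrow> complex"
  assumes g: "continuous_on UNIV g"
    and zero: "\<And>p q \<rho> z. moment (kernel_integral 0 1 \<rho>) p q g z = 0"
  shows "g z = 0"
proof -
  \<comment> \<open>This choice of \<open>\<rho>\<close> gives the weight \<open>\<kappa>\<close> the value 1 at \<open>z\<close>.\<close>
  define \<rho> where "\<rho> = (norm z)\<^sup>2 + 1"
  define \<kappa> where "\<kappa> u = trunc_power 1 (\<rho> - (norm u)\<^sup>2)" for u :: "complex ^ 'n"
  have \<kappa>0: "\<kappa> u \<ge> 0" for u by (simp add: \<kappa>_def trunc_power_def)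
  have \<kappa>c: "continuous_on UNIV \<kappa>" unfolding \<kappa>_def by (intro continuous_intros)
  have \<kappa>out: "\<kappa> u = 0" if "u \<notin> cball 0 (sqrt \<rho>)" for u
  proof -
    have "\<rho> \<le> (norm u)\<^sup>2" using that real_le_lsqrt[of "\<rho>" "norm u"] by (auto simp: not_le less_imp_le sqrt_le_D)
    then show ?thesis by (simp add: \<kappa>_def trunc_power_nonpos)
  qed
  define \<Lambda> where "\<Lambda> = (kernel_integral 0 1 \<rho> :: (complex ^ 'n \<Rightarrow> complex) \<Rightarrow> complex)"
  have \<Lambda>: "linear_on_continuous \<Lambda>" unfolding \<Lambda>_def by (rule linear_on_continuous_kernel_integral) simp
  have \<Lambda>eq: "\<Lambda> F = (LINT u|lborel. of_real (\<kappa> u) * F u)" for F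
    by (simp add: \<Lambda>_def kernel_integral_def \<kappa>_def)
  have int: "integrable lborel (\<lambda>u. of_real (\<kappa> u) * F u)" if "continuous_on UNIV F" for F :: "complex ^ 'n \<Rightarrow> complex"
    using integrable_kernel_mult[OF _ that, of 0 1 \<rho>] by (simp add: \<kappa>_def)
  have poly: "\<Lambda> (\<lambda>u. of_real (m u) * g u) = 0" if "real_polynomial_function m" for m
    using moments_0_imp_polynomial_moments_0[OF \<Lambda> that g, of 0 0] zero by (simp add: \<Lambda>_def moment_def)
  define B where "B = (LINT u|lborel. norm (of_real (\<kappa> u) * g u))"
  have B0: "B \<ge> 0" by (simp add: B_def)
  have cont: "\<Lambda> (\<lambda>u. of_real (a u) * g u) = 0" if a: "continuous_on UNIV a" for a :: "complex ^ 'n \<Rightarrow> real"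
  proof -
    have bound: "norm (\<Lambda> (\<lambda>u. of_real (a u) * g u)) \<le> e * B" if e: "e > 0" for e
    proof -
      obtain m where m: "real_polynomial_function m" "\<And>u. u \<in> cball 0 (sqrt \<rho>) \<Longrightarrow> \<bar>a u - m u\<bar> < e"
        using Stone_Weierstrass_real_polynomial_function[OF compact_cball continuous_on_subset[OF a subset_UNIV] e] by blast
      have mc: "continuous_on UNIV m"
        by (rule continuous_on_real_polynomial_function[OF m(1)])
      have ca: "continuous_on UNIV (\<lambda>u. of_real (a u) * g u)" "continuous_on UNIV (\<lambda>u. of_real (m u) * g u)"
        by (intro continuous_on_mult continuous_on_of_real a mc g)+
      have "\<Lambda> (\<lambda>u. of_real (a u) * g u) = (LINT u|lborel. of_real (\<kappa> u) * (of_real (a u) * g u) - of_real (\<kappa> u) * (of_real (m u) * g u))"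
        using poly[OF m(1)] by (simp add: \<Lambda>eq int ca)
      also have "norm \<dots> \<le> (LINT u|lborel. e * norm (of_real (\<kappa> u) * g u))"
      proof (rule Bochner_Integration.integral_norm_bound_integral)
        show "integrable lborel (\<lambda>u. of_real (\<kappa> u) * (of_real (a u) * g u) - of_real (\<kappa> u) * (of_real (m u) * g u))"
          by (intro Bochner_Integration.integrable_diff int ca)
        show "integrable lborel (\<lambda>u. e * norm (of_real (\<kappa> u) * g u))"
          by (intro integrable_mult_right integrable_norm int g)
        fix u :: "complex ^ 'n"
        have "of_real (\<kappa> u) * (of_real (a u) * g u) - of_real (\<kappa> u) * (of_real (m u) * g u) = of_real (a u - m u) * (of_real (\<kappa> u) * g u)"
          by (simp add: algebra_simps)
        then have "norm (of_real (\<kappa> u) * (of_real (a u) * g u) - of_real (\<kappa> u) * (of_real (m u) * g u)) = \<bar>a u - m u\<bar> * norm (of_real (\<kappa> u) * g u)"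
          by (simp only: norm_mult norm_of_real)
        also have "\<dots> \<le> e * norm (of_real (\<kappa> u) * g u)"
        proof (cases "u \<in> cball 0 (sqrt \<rho>)")
          case True
          then show ?thesis using m(2)[OF True] by (intro mult_right_mono) auto
        next
          case False
          then show ?thesis by (simp add: \<kappa>out)
        qed
        finally show "norm (of_real (\<kappa> u) * (of_real (a u) * g u) - of_real (\<kappa> u) * (of_real (m u) * g u)) \<le> e * norm (of_real (\<kappa> u) * g u)" .
      qed
      also have "\<dots> = e * B" by (simp add: B_def)
      finally show ?thesis .
    qed
    have "norm (\<Lambda> (\<lambda>u. of_real (a u) * g u)) \<le> 0"
    proof (rule field_le_epsilon)
      fix e :: real assume e: "e > 0"
      \<comment> \<open>The denominator \<open>B + 1\<close> stays positive if \<open>B = 0\<close>.\<close>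
      have "e / (B + 1) * B \<le> e" using e B0 by (simp add: field_simps)
      then show "norm (\<Lambda> (\<lambda>u. of_real (a u) * g u)) \<le> 0 + e"
        using bound[of "e / (B + 1)"] e B0 by simp
    qed
    then show ?thesis by simp
  qed
  define \<phi> where "\<phi> u = \<kappa> u * (norm (g u))\<^sup>2" for u
  have c: "continuous_on UNIV (\<lambda>u. Re (g u))" "continuous_on UNIV (\<lambda>u. Im (g u))"
    by (intro continuous_on_Re continuous_on_Im g)+
  have cg: "continuous_on UNIV (\<lambda>u. of_real (Re (g u)) * g u)" "continuous_on UNIV (\<lambda>u. (- \<i>) * (of_real (Im (g u)) * g u))"
    "continuous_on UNIV (\<lambda>u. of_real (Im (g u)) * g u)"
    by (intro continuous_on_mult continuous_on_of_real continuous_on_const c g)+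
  have "(LINT u|lborel. complex_of_real (\<phi> u)) = \<Lambda> (\<lambda>u. of_real (Re (g u)) * g u + (- \<i>) * (of_real (Im (g u)) * g u))"
    unfolding \<Lambda>eq
  proof (intro Bochner_Integration.integral_cong refl)
    fix u
    have "complex_of_real ((norm (g u))\<^sup>2) = of_real (Re (g u)) * g u + (- \<i>) * (of_real (Im (g u)) * g u)"
      unfolding cmod_power2 by (simp add: complex_eq_iff power2_eq_square)
    then show "complex_of_real (\<phi> u) = of_real (\<kappa> u) * (of_real (Re (g u)) * g u + (- \<i>) * (of_real (Im (g u)) * g u))"
      by (simp only: \<phi>_def of_real_mult)
  qed
  also have "\<dots> = 0"
    unfolding linear_on_continuousD(1)[OF \<Lambda> cg(1) cg(2)] linear_on_continuousD(2)[OF \<Lambda> cg(3)] cont[OF c(1)] cont[OF c(2)]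
    by simp
  finally have int0: "(LINT u|lborel. complex_of_real (\<phi> u)) = 0" .
  let ?D = "cbox (- (sqrt \<rho> *\<^sub>R One)) (sqrt \<rho> *\<^sub>R One) :: (complex ^ 'n) set"
  have \<phi>c: "continuous_on UNIV \<phi>"
    unfolding \<phi>_def by (intro continuous_on_mult continuous_on_power continuous_on_norm \<kappa>c g)
  have van: "vanishes_outside (sqrt \<rho>) (\<lambda>u. complex_of_real (\<phi> u))"
    using \<kappa>out by (auto simp: vanishes_outside_def \<phi>_def)
  have D0: "integral ?D (\<lambda>u. complex_of_real (\<phi> u)) = 0"
    using lborel_integral_compact_support[OF continuous_on_of_real[OF \<phi>c] van] int0 by simp
  have "(\<lambda>u. complex_of_real (\<phi> u)) integrable_on ?D"
    by (rule integrable_continuous[OF continuous_on_subset[OF continuous_on_of_real[OF \<phi>c] subset_UNIV]])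
  from has_integral_linear[OF integrable_integral[OF this] bounded_linear_Re]
  have hi: "(\<phi> has_integral 0) ?D" by (simp only: D0 o_def Re_complex_of_real zero_complex.sel)
  have z: "norm z < sqrt \<rho>"
    unfolding \<rho>_def by (rule real_less_rsqrt) simp
  have zD: "z \<in> ?D" using cball_subset_cbox_One[of "sqrt \<rho>"] z by auto
  have "box (- (sqrt \<rho> *\<^sub>R One)) (sqrt \<rho> *\<^sub>R One) \<noteq> ({} :: (complex ^ 'n) set)"
    using order.strict_trans1[OF norm_ge_zero z] by (simp add: box_ne_empty inner_add_left)
  then have "\<phi> z = 0"
    using has_integral_0_cbox_imp_0[OF continuous_on_subset[OF \<phi>c subset_UNIV] _ hi _ zD] \<kappa>0
    by (simp add: \<phi>_def)
  moreover have "\<kappa> z = 1" by (simp add: \<kappa>_def \<rho>_def trunc_power_def)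
  ultimately show ?thesis by (simp add: \<phi>_def)
qed

section \<open>Complex cones of injectivity\<close>

text \<open>
  All weighted moments of \<open>g u = f u * exp ((norm u)^2 / 4)\<close> vanish, by induction on \<open>p\<close>: the moments
  of bidegree \<open>(p - 1, q - 1)\<close> vanish, so those of bidegree \<open>(p, q)\<close> are harmonic polynomials. With the
  weight \<open>derived_kernel p m\<close> they vanish on the cone, hence everywhere. Solving differential equations
  in \<open>\<rho>\<close> leads back to the weight \<open>trunc_power m\<close>.
\<close>

lemma cone_injectivity_if_no_harmonic_vanishes:
  fixes C :: "(complex ^ 'n) set" and f :: "complex ^ 'n \<Rightarrow> complex"
  assumes cone: "is_complex_cone C"
    and no_harm: "\<And>p q P. P \<in> bigraded_harmonics p q \<Longrightarrow> C \<subseteq> P -` {0} \<Longrightarrow> P = (\<lambda>z. 0)"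
    and f: "continuous_on UNIV f"
    and mean: "\<And>r z. r > 0 \<Longrightarrow> z \<in> C \<Longrightarrow> twisted_spherical_mean f r z = 0"
  shows "f z = 0"
proof -
  define g where "g u = f u * of_real (exp ((norm u)\<^sup>2 / 4))" for u
  have g: "continuous_on UNIV g"
    unfolding g_def by (intro continuous_on_mult f continuous_intros; simp)
  have main: "moment (kernel_integral 0 m \<rho>) p q g z = 0" if "m > 0" for m \<rho> p q z
    using that
  proof (induction p arbitrary: q m \<rho> z rule: less_induct)
    case (less p)
    let ?F = "\<lambda>z u. g u * (hermitian_product z u ^ p * cnj (hermitian_product z u) ^ q)"
    have Fc: "continuous_on UNIV (?F z)" for z
      by (rule continuous_on_moment_integrand[OF g])
    have "moment (kernel_integral p m \<rho>) p q g = (\<lambda>z. 0)" if m: "m > p" for m \<rho>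
    proof (rule no_harm)
      have \<Lambda>: "linear_on_continuous (kernel_integral p m \<rho> :: (complex ^ 'n \<Rightarrow> complex) \<Rightarrow> complex)"
        by (rule linear_on_continuous_kernel_integral[OF m])
      have "laplacian (moment (kernel_integral p m \<rho>) p q g) z = 0" for z
      proof (cases "p = 0 \<or> q = 0")
        case True
        then show ?thesis unfolding laplacian_moment[OF \<Lambda> g] by auto
      next
        case False
        let ?G = "\<lambda>u. g u * (hermitian_product z u ^ (p - 1) * cnj (hermitian_product z u) ^ (q - 1))"
        have "kernel_integral p m \<rho> (\<lambda>u. of_real ((norm u)\<^sup>2) * ?G u) = 0"
        proof (rule kernel_integral_norm_square[OF continuous_on_moment_integrand[OF g] _ m])
          fix m' \<rho>' assume "m' > (0::nat)"
          then have "moment (kernel_integral 0 m' \<rho>') (p - 1) (q - 1) g z = 0"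
            using False by (intro less.IH) auto
          then show "kernel_integral 0 m' \<rho>' ?G = 0" by (simp only: moment_def)
        qed
        then have "moment (kernel_integral p m \<rho>) (p - 1) (q - 1) (\<lambda>u. of_real ((norm u)\<^sup>2) * g u) z = 0"
          by (simp only: moment_def mult.assoc)
        then show ?thesis unfolding laplacian_moment[OF \<Lambda> g] by simp
      qed
      then show "moment (kernel_integral p m \<rho>) p q g \<in> bigraded_harmonics p q"
        using bipoly_moment[OF \<Lambda> g] by (simp add: bigraded_harmonics_def bihomogeneous_polys_eq_bipoly)
      show "C \<subseteq> moment (kernel_integral p m \<rho>) p q g -` {0}"
      proof
        fix \<omega> assume \<omega>: "\<omega> \<in> C"
        then have "l *s \<omega> \<in> C" for l
          using cone unfolding is_complex_cone_def by blast
        then have "line_moment g \<omega> \<rho> p m p q 0 = 0"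
          unfolding g_def by (intro line_moment_eq_0[OF f _ m] mean)
        then show "\<omega> \<in> moment (kernel_integral p m \<rho>) p q g -` {0}"
          by (simp add: line_moment_def moment_def kernel_integral_def mult_ac)
      qed
    qed
    then have "kernel_integral p m \<rho> (?F z) = 0" if "m > p" for m \<rho> z
      using that by (metis moment_def)
    then show ?case
      unfolding moment_def by (intro kernel_integral_peel_all[OF Fc _ less.prems])
  qed
  have "g z = 0"
    by (rule continuous_eq_0_if_moments_0[OF g main]) simp
  then show ?thesis by (simp add: g_def)
qed

theorem theorem3p1:
  fixes C :: "(complex ^ 'n) set"
  assumes "CARD('n) \<ge> 2"
    and "is_complex_cone C"
  shows "(\<forall>f :: complex ^ 'n \<Rightarrow> complex.
            continuous_on UNIV f \<and> (\<forall>r>0. \<forall>z\<in>C. twisted_spherical_mean f r z = 0)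
              \<longrightarrow> (\<forall>z. f z = 0))
         \<longleftrightarrow>
         (\<forall>p q. \<forall>P \<in> bigraded_harmonics p q. P \<noteq> (\<lambda>z. 0) \<longrightarrow> \<not> C \<subseteq> P -` {0})"
    (is "?inj \<longleftrightarrow> ?harm")
proof
  assume inj: ?inj
  show ?harm
  proof (intro allI ballI impI notI)
    fix p q and P :: "complex ^ 'n \<Rightarrow> complex"
    assume P: "P \<in> bigraded_harmonics p q" "P \<noteq> (\<lambda>z. 0)" and C: "C \<subseteq> P -` {0}"
    \<comment> \<open>The Gaussian makes all twisted spherical means vanish at the zeros of \<open>P\<close>.\<close>
    let ?f = "\<lambda>u. P u * of_real (exp (- (norm u)\<^sup>2 / 4))"
    have Pc: "continuous_on UNIV P"
      using P(1) by (auto simp: bigraded_harmonics_def bihomogeneous_polys_eq_bipoly intro: continuous_on_bipoly)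
    have "continuous_on UNIV (\<lambda>u::complex ^ 'n. complex_of_real (exp (- (norm u)\<^sup>2 / 4)))"
      by (intro continuous_intros; simp)
    then have "continuous_on UNIV ?f"
      by (rule continuous_on_mult[OF Pc])
    moreover have "\<forall>r>0. \<forall>z\<in>C. twisted_spherical_mean ?f r z = 0"
      using twisted_spherical_mean_eq_0_at_zero[OF P(1)] C by blast
    ultimately have "\<forall>z. ?f z = 0" using inj by blast
    then have "P = (\<lambda>z. 0)" by (simp add: fun_eq_iff)
    with P(2) show False by contradiction
  qed
next
  assume harm: ?harm
  show ?inj
  proof (intro allI impI)
    fix f :: "complex ^ 'n \<Rightarrow> complex" and z
    assume "continuous_on UNIV f \<and> (\<forall>r>0. \<forall>z\<in>C. twisted_spherical_mean f r z = 0)"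
    then show "f z = 0"
      using harm by (intro cone_injectivity_if_no_harmonic_vanishes[OF assms(2), of f z]) blast+
  qed
qed

end
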